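(* Let $\boldsymbol f\in L^2(\Omega;\mathbb R^d)$, $g\in L^2(\Omega)$ and $z_\Gamma\in H^{-1/2}(\Gamma)$ satisfy $$\frac{\widetilde\rho}{r}\max\{1,\widetilde\rho\,\kappa_2\,r\}\,(1+\delta_2+C_{tr})\big(\|\boldsymbol f\|_{0,\Omega}+\|g\|_{0,\Omega}+\|z_\Gamma\|_{-1/2,\Gamma}\big)<1,\qquad\widetilde\rho:=\frac{(\widehat C+\widetilde\beta+\|a\|)^2}{\widehat C\,\widetilde\beta}.$$ Then the operator $\mathcal J_h$ has a unique fixed point $(\boldsymbol u_h,p_h)\in\boldsymbol W_h$. Equivalently, the discrete nonlinear problem: find $((\boldsymbol\sigma_h,\boldsymbol u_h,p_h),\boldsymbol\gamma_h)\in\mathbf H_h\times\mathbf Q_h$ such that $$a_{\boldsymbol u_h,p_h}((\boldsymbol\sigma_h,\boldsymbol u_h,p_h),(\boldsymbol\tau_h,\boldsymbol v_h,q_h))+b((\boldsymbol\tau_h,\boldsymbol v_h,q_h),\boldsymbol\gamma_h)=F(\boldsymbol\tau_h,\boldsymbol v_h,q_h),\qquad b((\boldsymbol\sigma_h,\boldsymbol u_h,p_h),\boldsymbol\eta_h)=0$$ for all $(\boldsymbol\tau_h,\boldsymbol v_h,q_h)\in\mathbf H_h$ and $\boldsymbol\eta_h\in\mathbf Q_h$, has a unique solution with $(\boldsymbol u_h,p_h)\in\boldsymbol W_h$. Moreover, $$\|((\boldsymbol\sigma_h,\boldsymbol u_h,p_h),\boldsymbol\gamma_h)\|_{\mathbf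 H\times\mathbf Q}\le\widetilde\rho\,(1+\delta_2+C_{tr})\big(\|\boldsymbol f\|_{0,\Omega}+\|g\|_{0,\Omega}+\|z_\Gamma\|_{-1/2,\Gamma}\big).$$
   Context: Domain and data. $d\in\{2,3\}$; $\Omega\subset\mathbb R^d$ is a bounded polygonal/polyhedral Lipschitz domain whose boundary $\Gamma=\partial\Omega$ is split as $\Gamma=\overline{\Gamma_D}\cup\overline{\Gamma_N}$ with $\Gamma_D,\Gamma_N$ disjoint and both of positive measure; $\boldsymbol n$ is the outward unit normal. $\lambda,\mu>0$, $\alpha\in[0,1]$, $c_0>0$, and $r>0$ is given. $\varepsilon(\boldsymbol v)=\frac12(\nabla\boldsymbol v+(\nabla\boldsymbol v)^{t})$, $\mathbf I$ is the identity, $\mathcal C^{-1}\boldsymbol\tau=\frac1{2\mu}\boldsymbol\tau-\frac{\lambda}{2\mu(d\lambda+2\mu)}\mathrm{tr}(\boldsymbol\tau)\mathbf I$. Spaces. $\mathcal H_{\Gamma_N}(\mathbf{div},\Omega)$ is the space of $\boldsymbol\tau\in L^2(\Omega;\mathbb R^{d\times d})$ with row-wise divergence $\mathbf{div}\,\boldsymbol\tau\in L^2(\Omega;\mathbb R^d)$ and $\boldsymbol\tau\boldsymbol n=\boldsymbol 0$ on $\Gamma_N$, $\|\boldsymbol\tau\|_{\mathbf{div},\Omega}^2=\|\boldsymbol\tau\|_{0,\Omega}^2+\|\mathbf{div}\,\boldsymbol\tau\|_{0,\Omega}^2$. $\mathbf H^1_{\Gamma_D}(\Omega)=\{\boldsymbol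 v\in H^1(\Omega;\mathbb R^d):\boldsymbol v=\boldsymbol 0\text{ on }\Gamma_D\}$. $\mathbf H=\mathcal H_{\Gamma_N}(\mathbf{div},\Omega)\times\mathbf H^1_{\Gamma_D}(\Omega)\times H^1(\Omega)$ with norm $\|(\boldsymbol\tau,\boldsymbol v,q)\|_{\mathbf H}=\|\boldsymbol\tau\|_{\mathbf{div},\Omega}+\|\boldsymbol v\|_{1,\Omega}+\|q\|_{1,\Omega}$. $\mathbf Q$ is the space of skew-symmetric tensors in $L^2(\Omega;\mathbb R^{d\times d})$ with the $L^2$ norm, and $\|((\boldsymbol\tau,\boldsymbol v,q),\boldsymbol\eta)\|_{\mathbf H\times\mathbf Q}=\|(\boldsymbol\tau,\boldsymbol v,q)\|_{\mathbf H}+\|\boldsymbol\eta\|_{0,\Omega}$. Permeability. $\kappa(\cdot,\cdot)$, evaluated at pairs in $\mathbf H^1_{\Gamma_D}(\Omega)\times H^1(\Omega)$, is a (possibly anisotropic) second-order tensor in $L^\infty(\Omega;\mathbb R^{d\times d})$, and there are constants $\kappa_1,\kappa_2>0$ with $\kappa_1|\boldsymbol w|^2\le \boldsymbol w^{t}\kappa(\cdot,\cdot)\boldsymbol w$ for all $\boldsymbol w\in\mathbb R^d\setminus\{\boldsymbol 0\}$ and $\|\kappa(\cdot,q_1)-\kappa(\cdot,q_2)\|_{L^\infty(\Omega)}\le\kappa_2\|q_1-q_2\|_{1,\Omega}$ for all $q_1,q_2\in H^1(\Omega)$; it is also assumed that $\kappa(\cdot,0)=0$. Parameters. $C_P,C_K>0$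 are the Poincaré and Korn constants: $\|\boldsymbol v\|_{0,\Omega}\le C_P\|\nabla\boldsymbol v\|_{0,\Omega}$ and $\|\nabla\boldsymbol v\|_{0,\Omega}\le C_K\|\varepsilon(\boldsymbol v)\|_{0,\Omega}$ for all $\boldsymbol v\in\mathbf H^1_{\Gamma_D}(\Omega)$; $\delta_1=\frac{3\mu}2$, $\delta_2=\frac3{C_K\mu}$; $C_{tr}>0$ is the constant of the trace inequality $\|q\|_{1/2,\Gamma}\le C_{tr}\|q\|_{1,\Omega}$. Forms. $$\begin{aligned}a_{\widehat{\boldsymbol u},\widehat p}((\boldsymbol\sigma,\boldsymbol u,p),(\boldsymbol\tau,\boldsymbol v,q))=&\int_\Omega\mathcal C^{-1}\boldsymbol\sigma:\boldsymbol\tau+\frac{\alpha}{d\lambda+2\mu}\int_\Omega p\,\mathrm{tr}(\boldsymbol\tau)+\int_\Omega\boldsymbol u\cdot\mathbf{div}\,\boldsymbol\tau+\Big(c_0+\frac{d\alpha^2}{d\lambda+2\mu}\Big)\int_\Omega pq\\&+\int_\Omega\kappa(\widehat{\boldsymbol u},\widehat p)\nabla p\cdot\nabla q+\frac{\alpha}{d\lambda+2\mu}\int_\Omega q\,\mathrm{tr}(\boldsymbol\sigma)+\int_\Omega\boldsymbol v\cdot\mathbf{div}\,\boldsymbol\sigma\\&+\delta_1\int_\Omega\big(\mathcal C^{-1}(\boldsymbol\sigma+\alpha p\mathbf I)-\varepsilon(\boldsymbol u)\big):\big(\mathcal C^{-1}(\boldsymbol\tau+\alpha q\mathbf I)-\varepsilon(\boldsymbol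 v)\big)+\delta_2\int_\Omega\mathbf{div}\,\boldsymbol\tau\cdot\mathbf{div}\,\boldsymbol\sigma,\end{aligned}$$ $b((\boldsymbol\tau,\boldsymbol v,q),\boldsymbol\eta)=\int_\Omega\boldsymbol\tau:\boldsymbol\eta$, and $F(\boldsymbol\tau,\boldsymbol v,q)=-\int_\Omega\boldsymbol f\cdot\boldsymbol v-\delta_2\int_\Omega\boldsymbol f\cdot\mathbf{div}\,\boldsymbol\tau+\int_\Omega gq+\langle z_\Gamma,q\rangle_\Gamma$. Discrete spaces. $\mathcal T_h$ is a regular partition of $\overline\Omega$ into triangles/tetrahedra, and $k\ge0$ is an integer. $\mathcal H_h^{\boldsymbol\sigma}$, $\mathbf H_h^{\boldsymbol u}$, $H_h^p$ are, respectively, the subspaces of $\mathcal H_{\Gamma_N}(\mathbf{div},\Omega)$, of $C(\overline\Omega)^d\cap\mathbf H^1_{\Gamma_D}(\Omega)$ and of $C(\overline\Omega)$ consisting of functions that are polynomial of degree $\le k+1$ (entrywise) on each $K\in\mathcal T_h$; $\mathbf Q_h$ is the space of skew-symmetric $L^2$ tensors that are polynomial of degree $\le k$ on each $K$. $\mathbf H_h=\mathcal H_h^{\boldsymbol\sigma}\times\mathbf H_h^{\boldsymbol u}\times H_h^p$. $\boldsymbol W_h=\{(\widehat{\boldsymbol u}_h,\widehat p_h)\in\mathbf H_h^{\boldsymbol u}\times H_h^p:\|\widehat{\boldsymbol u}_h\|_{1,\Omega}+\|\widehat p_h\|_{1,\Omega}\le r\}$. Constants. $\widehat C>0$ is the coercivity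 constant: $a_{\widehat{\boldsymbol u},\widehat p}((\boldsymbol\tau,\boldsymbol v,q),(\boldsymbol\tau,\boldsymbol v,q))\ge\widehat C\|(\boldsymbol\tau,\boldsymbol v,q)\|_{\mathbf H}^2$ on $\mathbf H$ for all $(\widehat{\boldsymbol u},\widehat p)\in\mathbf H^1_{\Gamma_D}(\Omega)\times H^1(\Omega)$ with $\|\widehat{\boldsymbol u}\|_{1,\Omega}+\|\widehat p\|_{1,\Omega}\le r$ (in particular on $\mathbf H_h$); $\widetilde\beta>0$ is the discrete inf-sup constant: $\sup_{0\ne(\boldsymbol\tau_h,\boldsymbol v_h,q_h)\in\mathbf H_h}b((\boldsymbol\tau_h,\boldsymbol v_h,q_h),\boldsymbol\eta_h)/\|(\boldsymbol\tau_h,\boldsymbol v_h,q_h)\|_{\mathbf H}\ge\widetilde\beta\|\boldsymbol\eta_h\|_{0,\Omega}$ for all $\boldsymbol\eta_h\in\mathbf Q_h$ (a known property of these Arnold–Falk–Winther spaces); and the boundedness constant of $a$ is $$\|a\|=\frac1{2\mu}+\frac{\alpha\sqrt d}{\mu}+c_0+\frac{d\alpha^2}{2\mu}+r+2+\delta_2+\delta_1\Big(1+\frac1{2\mu}+\frac{\alpha\sqrt d}{2\mu}\Big)^2.$$ Operator. $\mathcal J_h:\boldsymbol W_h\to\mathbf H_h^{\boldsymbol u}\times H_h^p$, $\mathcal J_h(\widehat{\boldsymbol u}_h,\widehat p_h)=(\boldsymbol u_h,p_h)$, where $(\boldsymbol u_h,p_h)$ are components of the solution $((\boldsymbol\sigma_h,\boldsymbol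 u_h,p_h),\boldsymbol\gamma_h)\in\mathbf H_h\times\mathbf Q_h$ of: $a_{\widehat{\boldsymbol u}_h,\widehat p_h}((\boldsymbol\sigma_h,\boldsymbol u_h,p_h),(\boldsymbol\tau_h,\boldsymbol v_h,q_h))+b((\boldsymbol\tau_h,\boldsymbol v_h,q_h),\boldsymbol\gamma_h)=F(\boldsymbol\tau_h,\boldsymbol v_h,q_h)$ for all $(\boldsymbol\tau_h,\boldsymbol v_h,q_h)\in\mathbf H_h$, and $b((\boldsymbol\sigma_h,\boldsymbol u_h,p_h),\boldsymbol\eta_h)=0$ for all $\boldsymbol\eta_h\in\mathbf Q_h$.
   Formalization: The assumption κ(·,0)=0 is dropped because it contradicts the ellipticity bound at q=0; the Lipschitz bound on κ is read with independent first arguments, ‖κ(u1,q1)−κ(u2,q2)‖ ≤ κ2‖q1−q2‖, since with a common first argument a fixed point may fail to exist. *)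

theory Defs
  imports "HOL-Analysis.Analysis" "HOL-Probability.Essential_Supremum"
begin

text \<open>
  Elements of Lebesgue and Sobolev spaces are represented by functions on the whole type; only
  their values on \<Omega> (for boundary data: on the boundary of \<Omega>) matter, and identity of elements
  of these spaces is equality almost everywhere, \<open>ae_eq\<close> below.  The Euclidean norm and inner
  product of \<open>real^'d^'d\<close> are the Frobenius norm and the product written with a colon.
\<close>

type_synonym 'd scal = "real^'d \<Rightarrow> real"
type_synonym 'd vect = "real^'d \<Rightarrow> real^'d"
type_synonym 'd tens = "real^'d \<Rightarrow> real^'d^'d"


section \<open>Lebesgue spaces\<close>

definition L2_space :: "'a measure \<Rightarrow> ('a \<Rightarrow> 'b::euclidean_space) set" where
  "L2_space M = {f \<in> borel_measurable M. integrable M (\<lambda>x. (norm (f x))\<^sup>2)}"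

definition L2_norm :: "'a measure \<Rightarrow> ('a \<Rightarrow> 'b::euclidean_space) \<Rightarrow> real" where
  "L2_norm M f = sqrt (\<integral>x. (norm (f x))\<^sup>2 \<partial>M)"

definition L2_inner :: "'a measure \<Rightarrow> ('a \<Rightarrow> 'b::euclidean_space) \<Rightarrow> ('a \<Rightarrow> 'b) \<Rightarrow> real" where
  "L2_inner M f g = (\<integral>x. f x \<bullet> g x \<partial>M)"

definition Linf_norm :: "'a measure \<Rightarrow> ('a \<Rightarrow> 'b::euclidean_space) \<Rightarrow> ereal" where
  "Linf_norm M f = esssup M (\<lambda>x. ereal (norm (f x)))"

definition Linf_space :: "'a measure \<Rightarrow> ('a \<Rightarrow> 'b::euclidean_space) set" where
  "Linf_space M = {f \<in> borel_measurable M. Linf_norm M f < \<infinity>}"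

definition ae_eq :: "(real^'d) set \<Rightarrow> (real^'d \<Rightarrow> 'b) \<Rightarrow> (real^'d \<Rightarrow> 'b) \<Rightarrow> bool" where
  "ae_eq \<Omega> f g \<longleftrightarrow> (AE x in lebesgue_on \<Omega>. f x = g x)"


section \<open>The domain and its boundary measure\<close>

text \<open>
  Coordinate-free form of "locally the region on one side of a Lipschitz graph": \<open>e\<close> is the
  direction of the graph, and \<open>\<phi>\<close>, being constant along \<open>e\<close>, is a function on its orthogonal
  complement.
\<close>

definition lipschitz_boundary :: "(real^'d) set \<Rightarrow> bool" where
  "lipschitz_boundary \<Omega> \<longleftrightarrow>
     (\<forall>x\<in>frontier \<Omega>. \<exists>U e L (\<phi> :: real^'d \<Rightarrow> real).
        open U \<and> x \<in> U \<and> norm e = 1 \<and> L-lipschitz_on UNIV \<phi> \<and>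
        (\<forall>y t. \<phi> (y + t *\<^sub>R e) = \<phi> y) \<and> \<Omega> \<inter> U = {y \<in> U. \<phi> y < y \<bullet> e})"

definition polyhedral_lipschitz_domain :: "(real^'d) set \<Rightarrow> bool" where
  "polyhedral_lipschitz_domain \<Omega> \<longleftrightarrow>
     open \<Omega> \<and> connected \<Omega> \<and> bounded \<Omega> \<and> \<Omega> \<noteq> {} \<and> lipschitz_boundary \<Omega> \<and>
     (\<exists>\<P>. finite \<P> \<and> (\<forall>S\<in>\<P>. polytope S) \<and> closure \<Omega> = \<Union>\<P>)"

text \<open>
  The \<open>s\<close>-dimensional Hausdorff measure (used with \<open>s \<ge> 1\<close>), normalised so that for
  \<open>s = CARD('d) - 1\<close> it is the usual surface measure on hypersurfaces.
\<close>

definition hausdorff_outer :: "nat \<Rightarrow> 'a::metric_space set \<Rightarrow> ennreal" where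
  "hausdorff_outer s A =
     (SUP \<delta>\<in>{0<..}. INF U\<in>{U :: nat \<Rightarrow> 'a set. A \<subseteq> (\<Union>i. U i) \<and>
                              (\<forall>i. bounded (U i) \<and> diameter (U i) \<le> \<delta>)}.
        (\<Sum>i. ennreal (unit_ball_vol (real s) * (diameter (U i) / 2) ^ s)))"

definition surface_measure :: "(real^'d) set \<Rightarrow> (real^'d) measure" where
  "surface_measure \<Omega> =
     restrict_space (measure_of UNIV (sets borel) (hausdorff_outer (CARD('d) - 1))) (frontier \<Omega>)"


section \<open>Weak derivatives\<close>

definition partial :: "('d::finite) \<Rightarrow> 'd scal \<Rightarrow> 'd scal" where
  "partial i f x = frechet_derivative f (at x) (axis i 1)"

primrec Ck :: "nat \<Rightarrow> ('d::finite) scal \<Rightarrow> bool" where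
  "Ck 0 f \<longleftrightarrow> continuous_on UNIV f"
| "Ck (Suc m) f \<longleftrightarrow> (\<forall>x. f differentiable at x) \<and> (\<forall>i. Ck m (partial i f))"

definition test_functions :: "(real^'d) set \<Rightarrow> 'd scal set" where
  "test_functions \<Omega> =
     {\<phi>. (\<forall>m. Ck m \<phi>) \<and> compact (closure {x. \<phi> x \<noteq> 0}) \<and> closure {x. \<phi> x \<noteq> 0} \<subseteq> \<Omega>}"

definition is_weak_grad :: "(real^'d) set \<Rightarrow> 'd scal \<Rightarrow> 'd vect \<Rightarrow> bool" where
  "is_weak_grad \<Omega> q G \<longleftrightarrow>
     (\<forall>\<phi>\<in>test_functions \<Omega>. \<forall>i.
        (\<integral>x. q x * partial i \<phi> x \<partial>lebesgue_on \<Omega>) = - (\<integral>x. G x $ i * \<phi> x \<partial>lebesgue_on \<Omega>))"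

definition is_weak_div :: "(real^'d) set \<Rightarrow> 'd tens \<Rightarrow> 'd vect \<Rightarrow> bool" where
  "is_weak_div \<Omega> \<tau> D \<longleftrightarrow>
     (\<forall>\<phi>\<in>test_functions \<Omega>. \<forall>i.
        (\<integral>x. (\<Sum>j\<in>UNIV. \<tau> x $ i $ j * partial j \<phi> x) \<partial>lebesgue_on \<Omega>)
          = - (\<integral>x. D x $ i * \<phi> x \<partial>lebesgue_on \<Omega>))"

text \<open>
  The weak gradient and weak row-wise divergence are unique up to null sets; outside the spaces
  \<open>H1\<close>, \<open>H1v\<close> and \<open>Hdiv\<close> below, the following operators have no meaning.
\<close>

definition wgrad :: "(real^'d) set \<Rightarrow> 'd scal \<Rightarrow> 'd vect" where
  "wgrad \<Omega> q = (SOME G. G \<in> L2_space (lebesgue_on \<Omega>) \<and> is_weak_grad \<Omega> q G)"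

definition wgradv :: "(real^'d) set \<Rightarrow> 'd vect \<Rightarrow> 'd tens" where
  "wgradv \<Omega> v x = (\<chi> i. wgrad \<Omega> (\<lambda>y. v y $ i) x)"

definition wdiv :: "(real^'d) set \<Rightarrow> 'd tens \<Rightarrow> 'd vect" where
  "wdiv \<Omega> \<tau> = (SOME D. D \<in> L2_space (lebesgue_on \<Omega>) \<and> is_weak_div \<Omega> \<tau> D)"

definition strain :: "(real^'d) set \<Rightarrow> 'd vect \<Rightarrow> 'd tens" where
  "strain \<Omega> v x = (1/2) *\<^sub>R (wgradv \<Omega> v x + transpose (wgradv \<Omega> v x))"


section \<open>Sobolev spaces and traces\<close>

definition H1 :: "(real^'d) set \<Rightarrow> 'd scal set" where
  "H1 \<Omega> = {q \<in> L2_space (lebesgue_on \<Omega>). \<exists>G\<in>L2_space (lebesgue_on \<Omega>). is_weak_grad \<Omega> q G}"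

definition H1_norm :: "(real^'d) set \<Rightarrow> 'd scal \<Rightarrow> real" where
  "H1_norm \<Omega> q =
     sqrt ((L2_norm (lebesgue_on \<Omega>) q)\<^sup>2 + (L2_norm (lebesgue_on \<Omega>) (wgrad \<Omega> q))\<^sup>2)"

definition H1v :: "(real^'d) set \<Rightarrow> 'd vect set" where
  "H1v \<Omega> = {v. \<forall>i. (\<lambda>x. v x $ i) \<in> H1 \<Omega>}"

definition H1v_norm :: "(real^'d) set \<Rightarrow> 'd vect \<Rightarrow> real" where
  "H1v_norm \<Omega> v =
     sqrt ((L2_norm (lebesgue_on \<Omega>) v)\<^sup>2 + (L2_norm (lebesgue_on \<Omega>) (wgradv \<Omega> v))\<^sup>2)"

text \<open>
  On a Lipschitz domain the trace of an \<open>H1\<close> function is, at almost every boundary point, the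
  limit of its averages over small balls intersected with \<Omega>.  For functions continuous up to the
  boundary this is the restriction to the boundary.
\<close>

definition boundary_average ::
    "(real^'d) set \<Rightarrow> (real^'d \<Rightarrow> 'b::euclidean_space) \<Rightarrow> real^'d \<Rightarrow> real \<Rightarrow> 'b" where
  "boundary_average \<Omega> f x r =
     (1 / measure lebesgue (\<Omega> \<inter> ball x r)) *\<^sub>R (\<integral>y. f y \<partial>lebesgue_on (\<Omega> \<inter> ball x r))"

definition bdry_trace :: "(real^'d) set \<Rightarrow> 'd scal \<Rightarrow> 'd scal" where
  "bdry_trace \<Omega> q x = Lim (at_right 0) (boundary_average \<Omega> q x)"

definition vanishes_on :: "(real^'d) set \<Rightarrow> (real^'d) set \<Rightarrow> 'd vect \<Rightarrow> bool" where
  "vanishes_on \<Omega> \<Gamma> v \<longleftrightarrow>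
     (AE x in surface_measure \<Omega>. x \<in> \<Gamma> \<longrightarrow> (boundary_average \<Omega> v x \<longlongrightarrow> 0) (at_right 0))"

definition H1D :: "(real^'d) set \<Rightarrow> (real^'d) set \<Rightarrow> 'd vect set" where
  "H1D \<Omega> \<Gamma>D = {v \<in> H1v \<Omega>. vanishes_on \<Omega> \<Gamma>D v}"

definition Hdiv :: "(real^'d) set \<Rightarrow> 'd tens set" where
  "Hdiv \<Omega> =
     {\<tau> \<in> L2_space (lebesgue_on \<Omega>). \<exists>D\<in>L2_space (lebesgue_on \<Omega>). is_weak_div \<Omega> \<tau> D}"

definition Hdiv_norm :: "(real^'d) set \<Rightarrow> 'd tens \<Rightarrow> real" where
  "Hdiv_norm \<Omega> \<tau> =
     sqrt ((L2_norm (lebesgue_on \<Omega>) \<tau>)\<^sup>2 + (L2_norm (lebesgue_on \<Omega>) (wdiv \<Omega> \<tau>))\<^sup>2)"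

text \<open>
  The normal trace of an \<open>Hdiv\<close> tensor is the functional given by Green's formula; it vanishes on
  the complementary part of the boundary if it annihilates the traces of all \<open>w\<close> with \<open>w = 0\<close>
  on \<open>\<Gamma>D\<close>.
\<close>

definition HdivN :: "(real^'d) set \<Rightarrow> (real^'d) set \<Rightarrow> 'd tens set" where
  "HdivN \<Omega> \<Gamma>D =
     {\<tau> \<in> Hdiv \<Omega>. \<forall>w\<in>H1D \<Omega> \<Gamma>D.
        L2_inner (lebesgue_on \<Omega>) \<tau> (wgradv \<Omega> w) + L2_inner (lebesgue_on \<Omega>) (wdiv \<Omega> \<tau>) w = 0}"

text \<open>
  The trace space of order one half with its Sobolev--Slobodeckij norm; the exponent
  \<open>(CARD('d) - 1) + 2 * (1/2)\<close> of the kernel is \<open>CARD('d)\<close>.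
\<close>

definition Hhalf_seminorm2 :: "(real^'d) set \<Rightarrow> 'd scal \<Rightarrow> ennreal" where
  "Hhalf_seminorm2 \<Omega> \<xi> =
     (\<integral>\<^sup>+x. \<integral>\<^sup>+y. ennreal ((\<xi> x - \<xi> y)\<^sup>2 / norm (x - y) ^ CARD('d))
        \<partial>surface_measure \<Omega> \<partial>surface_measure \<Omega>)"

definition Hhalf :: "(real^'d) set \<Rightarrow> 'd scal set" where
  "Hhalf \<Omega> = {\<xi> \<in> L2_space (surface_measure \<Omega>). Hhalf_seminorm2 \<Omega> \<xi> < \<infinity>}"

definition Hhalf_norm :: "(real^'d) set \<Rightarrow> 'd scal \<Rightarrow> real" where
  "Hhalf_norm \<Omega> \<xi> =
     sqrt ((L2_norm (surface_measure \<Omega>) \<xi>)\<^sup>2 + enn2real (Hhalf_seminorm2 \<Omega> \<xi>))"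

text \<open>
  Its dual.  A bounded functional does not distinguish functions that agree almost everywhere on
  the boundary; in the supremum, elements of norm 0 contribute \<open>0 / 0 = 0\<close>.
\<close>

definition Hmhalf :: "(real^'d) set \<Rightarrow> ('d scal \<Rightarrow> real) set" where
  "Hmhalf \<Omega> =
     {z. (\<forall>\<xi>\<in>Hhalf \<Omega>. \<forall>\<zeta>\<in>Hhalf \<Omega>. z (\<lambda>x. \<xi> x + \<zeta> x) = z \<xi> + z \<zeta>) \<and>
         (\<forall>c. \<forall>\<xi>\<in>Hhalf \<Omega>. z (\<lambda>x. c * \<xi> x) = c * z \<xi>) \<and>
         (\<exists>C. \<forall>\<xi>\<in>Hhalf \<Omega>. \<bar>z \<xi>\<bar> \<le> C * Hhalf_norm \<Omega> \<xi>)}"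

definition Hmhalf_norm :: "(real^'d) set \<Rightarrow> ('d scal \<Rightarrow> real) \<Rightarrow> real" where
  "Hmhalf_norm \<Omega> z = (SUP \<xi>\<in>Hhalf \<Omega>. \<bar>z \<xi>\<bar> / Hhalf_norm \<Omega> \<xi>)"


section \<open>Product spaces and forms\<close>

type_synonym 'd triple = "'d tens \<times> 'd vect \<times> 'd scal"

definition H_space :: "(real^'d) set \<Rightarrow> (real^'d) set \<Rightarrow> 'd triple set" where
  "H_space \<Omega> \<Gamma>D = HdivN \<Omega> \<Gamma>D \<times> H1D \<Omega> \<Gamma>D \<times> H1 \<Omega>"

fun H_norm :: "(real^'d) set \<Rightarrow> 'd triple \<Rightarrow> real" where
  "H_norm \<Omega> (\<tau>, v, q) = Hdiv_norm \<Omega> \<tau> + H1v_norm \<Omega> v + H1_norm \<Omega> q"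

fun HQ_norm :: "(real^'d) set \<Rightarrow> 'd triple \<times> 'd tens \<Rightarrow> real" where
  "HQ_norm \<Omega> (y, \<eta>) = H_norm \<Omega> y + L2_norm (lebesgue_on \<Omega>) \<eta>"

definition Q_space :: "(real^'d) set \<Rightarrow> 'd tens set" where
  "Q_space \<Omega> = {\<eta> \<in> L2_space (lebesgue_on \<Omega>). AE x in lebesgue_on \<Omega>. transpose (\<eta> x) = - \<eta> x}"

definition compliance :: "real \<Rightarrow> real \<Rightarrow> real^'d^'d \<Rightarrow> real^'d^'d" where
  "compliance lam mu \<tau> =
     (1 / (2 * mu)) *\<^sub>R \<tau>
       - (lam / (2 * mu * (real CARD('d) * lam + 2 * mu)) * trace \<tau>) *\<^sub>R mat 1"

text \<open>\<open>K\<close> stands for the tensor field obtained by evaluating the permeability.\<close>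

fun form_a :: "(real^'d) set \<Rightarrow> real \<Rightarrow> real \<Rightarrow> real \<Rightarrow> real \<Rightarrow> real \<Rightarrow> real \<Rightarrow> 'd tens
    \<Rightarrow> 'd triple \<Rightarrow> 'd triple \<Rightarrow> real" where
  "form_a \<Omega> lam mu \<alpha> c0 \<delta>1 \<delta>2 K (\<sigma>, u, p) (\<tau>, v, q) =
     L2_inner (lebesgue_on \<Omega>) (\<lambda>x. compliance lam mu (\<sigma> x)) \<tau>
     + \<alpha> / (real CARD('d) * lam + 2 * mu) * L2_inner (lebesgue_on \<Omega>) p (\<lambda>x. trace (\<tau> x))
     + L2_inner (lebesgue_on \<Omega>) u (wdiv \<Omega> \<tau>)
     + (c0 + real CARD('d) * \<alpha>\<^sup>2 / (real CARD('d) * lam + 2 * mu)) * L2_inner (lebesgue_on \<Omega>) p q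
     + L2_inner (lebesgue_on \<Omega>) (\<lambda>x. K x *v wgrad \<Omega> p x) (wgrad \<Omega> q)
     + \<alpha> / (real CARD('d) * lam + 2 * mu) * L2_inner (lebesgue_on \<Omega>) q (\<lambda>x. trace (\<sigma> x))
     + L2_inner (lebesgue_on \<Omega>) v (wdiv \<Omega> \<sigma>)
     + \<delta>1 * L2_inner (lebesgue_on \<Omega>)
              (\<lambda>x. compliance lam mu (\<sigma> x + (\<alpha> * p x) *\<^sub>R mat 1) - strain \<Omega> u x)
              (\<lambda>x. compliance lam mu (\<tau> x + (\<alpha> * q x) *\<^sub>R mat 1) - strain \<Omega> v x)
     + \<delta>2 * L2_inner (lebesgue_on \<Omega>) (wdiv \<Omega> \<tau>) (wdiv \<Omega> \<sigma>)"

fun form_b :: "(real^'d) set \<Rightarrow> 'd triple \<Rightarrow> 'd tens \<Rightarrow> real" where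
  "form_b \<Omega> (\<tau>, v, q) \<eta> = L2_inner (lebesgue_on \<Omega>) \<tau> \<eta>"

fun form_F :: "(real^'d) set \<Rightarrow> real \<Rightarrow> 'd vect \<Rightarrow> 'd scal \<Rightarrow> ('d scal \<Rightarrow> real) \<Rightarrow> 'd triple \<Rightarrow> real"
  where
  "form_F \<Omega> \<delta>2 f g z (\<tau>, v, q) =
     - L2_inner (lebesgue_on \<Omega>) f v - \<delta>2 * L2_inner (lebesgue_on \<Omega>) f (wdiv \<Omega> \<tau>)
     + L2_inner (lebesgue_on \<Omega>) g q + z (bdry_trace \<Omega> q)"


section \<open>Discrete spaces\<close>

text \<open>
  The library notion \<^const>\<open>triangulation\<close> includes conformity: two cells meet in a common face.
\<close>

definition mesh :: "(real^'d) set \<Rightarrow> (real^'d) set set \<Rightarrow> bool" where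
  "mesh \<Omega> \<T> \<longleftrightarrow>
     triangulation \<T> \<and> (\<forall>K\<in>\<T>. int CARD('d) simplex K) \<and> \<Union>\<T> = closure \<Omega>"

definition poly_le :: "nat \<Rightarrow> ('d::finite) scal set" where
  "poly_le m =
     {P. \<exists>c :: ('d \<Rightarrow> nat) \<Rightarrow> real.
           \<forall>x. P x = (\<Sum>a | (\<Sum>i\<in>UNIV. a i) \<le> m. c a * (\<Prod>i\<in>UNIV. (x $ i) ^ a i))}"

text \<open>
  Only the interiors of the cells are constrained, since discontinuous functions may take any
  values on the faces; for functions continuous on the closed domain the polynomial
  representation extends to the closed cells.
\<close>

definition piecewise_poly :: "(real^'d) set set \<Rightarrow> nat \<Rightarrow> 'd scal \<Rightarrow> bool" where
  "piecewise_poly \<T> m f \<longleftrightarrow> (\<forall>K\<in>\<T>. \<exists>P\<in>poly_le m. \<forall>x\<in>interior K. f x = P x)"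

definition Hh_sigma :: "(real^'d) set \<Rightarrow> (real^'d) set \<Rightarrow> (real^'d) set set \<Rightarrow> nat \<Rightarrow> 'd tens set"
  where
  "Hh_sigma \<Omega> \<Gamma>D \<T> k =
     {\<tau> \<in> HdivN \<Omega> \<Gamma>D. \<forall>i j. piecewise_poly \<T> (k + 1) (\<lambda>x. \<tau> x $ i $ j)}"

definition Hh_u :: "(real^'d) set \<Rightarrow> (real^'d) set \<Rightarrow> (real^'d) set set \<Rightarrow> nat \<Rightarrow> 'd vect set" where
  "Hh_u \<Omega> \<Gamma>D \<T> k =
     {v \<in> H1D \<Omega> \<Gamma>D. continuous_on (closure \<Omega>) v \<and> (\<forall>i. piecewise_poly \<T> (k + 1) (\<lambda>x. v x $ i))}"

text \<open>Continuous piecewise polynomials automatically belong to \<open>H1\<close>.\<close>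

definition Hh_p :: "(real^'d) set \<Rightarrow> (real^'d) set set \<Rightarrow> nat \<Rightarrow> 'd scal set" where
  "Hh_p \<Omega> \<T> k = {q \<in> H1 \<Omega>. continuous_on (closure \<Omega>) q \<and> piecewise_poly \<T> (k + 1) q}"

definition Qh :: "(real^'d) set \<Rightarrow> (real^'d) set set \<Rightarrow> nat \<Rightarrow> 'd tens set" where
  "Qh \<Omega> \<T> k = {\<eta> \<in> Q_space \<Omega>. \<forall>i j. piecewise_poly \<T> k (\<lambda>x. \<eta> x $ i $ j)}"

definition Hh :: "(real^'d) set \<Rightarrow> (real^'d) set \<Rightarrow> (real^'d) set set \<Rightarrow> nat \<Rightarrow> 'd triple set" where
  "Hh \<Omega> \<Gamma>D \<T> k = Hh_sigma \<Omega> \<Gamma>D \<T> k \<times> Hh_u \<Omega> \<Gamma>D \<T> k \<times> Hh_p \<Omega> \<T> k"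

definition Wh :: "(real^'d) set \<Rightarrow> (real^'d) set \<Rightarrow> (real^'d) set set \<Rightarrow> nat \<Rightarrow> real
    \<Rightarrow> ('d vect \<times> 'd scal) set" where
  "Wh \<Omega> \<Gamma>D \<T> k r =
     {(u, p). u \<in> Hh_u \<Omega> \<Gamma>D \<T> k \<and> p \<in> Hh_p \<Omega> \<T> k \<and> H1v_norm \<Omega> u + H1_norm \<Omega> p \<le> r}"


section \<open>Discrete problem and fixed-point operator\<close>

definition saddle_solution ::
    "('y \<Rightarrow> 'y \<Rightarrow> real) \<Rightarrow> ('y \<Rightarrow> 'e \<Rightarrow> real) \<Rightarrow> ('y \<Rightarrow> real) \<Rightarrow> 'y set \<Rightarrow> 'e set \<Rightarrow> 'y \<times> 'e \<Rightarrow> bool"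
  where
  "saddle_solution a b F Y E s \<longleftrightarrow>
     fst s \<in> Y \<and> snd s \<in> E \<and>
     (\<forall>y\<in>Y. a (fst s) y + b y (snd s) = F y) \<and> (\<forall>\<eta>\<in>E. b (fst s) \<eta> = 0)"

text \<open>
  The solution chosen here is determined up to null sets wherever the linear problem is well
  posed.
\<close>

definition op_J ::
    "(('d::finite) vect \<times> 'd scal \<Rightarrow> 'd triple \<Rightarrow> 'd triple \<Rightarrow> real) \<Rightarrow> ('d triple \<Rightarrow> 'd tens \<Rightarrow> real)
     \<Rightarrow> ('d triple \<Rightarrow> real) \<Rightarrow> 'd triple set \<Rightarrow> 'd tens set
     \<Rightarrow> 'd vect \<times> 'd scal \<Rightarrow> 'd vect \<times> 'd scal" where
  "op_J a b F Y E w = snd (fst (SOME s. saddle_solution (a w) b F Y E s))"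

definition ae_eq_pair ::
    "(real^'d) set \<Rightarrow> 'd vect \<times> 'd scal \<Rightarrow> 'd vect \<times> 'd scal \<Rightarrow> bool" where
  "ae_eq_pair \<Omega> w w' \<longleftrightarrow> ae_eq \<Omega> (fst w) (fst w') \<and> ae_eq \<Omega> (snd w) (snd w')"


section \<open>Assumptions on permeability and domain constants\<close>

text \<open>
  In the Lipschitz bound the dots standing for the first argument of \<open>\<kappa>\<close> are independent
  placeholders (\<open>u1\<close> and \<open>u2\<close>), as they are when the bound is applied to \<open>\<kappa>\<close> at two different
  pairs.  A normalisation \<open>\<kappa> u 0 = 0\<close> is not included: it contradicts the ellipticity bound
  (and coercivity of \<open>form_a\<close> at \<open>(u, 0)\<close>), so it would leave nothing to be stated.
\<close>

definition permeability ::
    "(real^'d) set \<Rightarrow> (real^'d) set \<Rightarrow> real \<Rightarrow> real \<Rightarrow> ('d vect \<Rightarrow> 'd scal \<Rightarrow> 'd tens) \<Rightarrow> bool" where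
  "permeability \<Omega> \<Gamma>D \<kappa>1 \<kappa>2 \<kappa> \<longleftrightarrow>
     (\<forall>u\<in>H1D \<Omega> \<Gamma>D. \<forall>q\<in>H1 \<Omega>. \<kappa> u q \<in> Linf_space (lebesgue_on \<Omega>)) \<and>
     (\<forall>u\<in>H1D \<Omega> \<Gamma>D. \<forall>q\<in>H1 \<Omega>. AE x in lebesgue_on \<Omega>.
        \<forall>w. w \<noteq> 0 \<longrightarrow> \<kappa>1 * (norm w)\<^sup>2 \<le> w \<bullet> (\<kappa> u q x *v w)) \<and>
     (\<forall>u1\<in>H1D \<Omega> \<Gamma>D. \<forall>u2\<in>H1D \<Omega> \<Gamma>D. \<forall>q1\<in>H1 \<Omega>. \<forall>q2\<in>H1 \<Omega>.
        Linf_norm (lebesgue_on \<Omega>) (\<lambda>x. \<kappa> u1 q1 x - \<kappa> u2 q2 x)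
          \<le> ereal (\<kappa>2 * H1_norm \<Omega> (\<lambda>x. q1 x - q2 x)))"

definition poincare_constant :: "(real^'d) set \<Rightarrow> (real^'d) set \<Rightarrow> real \<Rightarrow> bool" where
  "poincare_constant \<Omega> \<Gamma>D C \<longleftrightarrow>
     (\<forall>v\<in>H1D \<Omega> \<Gamma>D. L2_norm (lebesgue_on \<Omega>) v \<le> C * L2_norm (lebesgue_on \<Omega>) (wgradv \<Omega> v))"

definition korn_constant :: "(real^'d) set \<Rightarrow> (real^'d) set \<Rightarrow> real \<Rightarrow> bool" where
  "korn_constant \<Omega> \<Gamma>D C \<longleftrightarrow>
     (\<forall>v\<in>H1D \<Omega> \<Gamma>D.
        L2_norm (lebesgue_on \<Omega>) (wgradv \<Omega> v) \<le> C * L2_norm (lebesgue_on \<Omega>) (strain \<Omega> v))"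

definition trace_constant :: "(real^'d) set \<Rightarrow> real \<Rightarrow> bool" where
  "trace_constant \<Omega> C \<longleftrightarrow>
     (\<forall>q\<in>H1 \<Omega>. bdry_trace \<Omega> q \<in> Hhalf \<Omega> \<and> Hhalf_norm \<Omega> (bdry_trace \<Omega> q) \<le> C * H1_norm \<Omega> q)"

end

theory Submission
  imports Defs "HOL-Library.Function_Algebras" "HOL-Computational_Algebra.Polynomial"
begin

text \<open>
  Modulo null sets the discrete spaces are finite-dimensional, so for a frozen permeability
  solvability follows from uniqueness, and uniqueness from coercivity.  Testing the problem with its
  solution bounds the primal part by the data, and the inf-sup condition then bounds the multiplier.
  Subtracting the problems for two frozen permeabilities and testing with the difference of the
  solutions, the Lipschitz bound on \<open>\<kappa>\<close> shows that the solution map contracts under the smallness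
  assumption; its fixed point exists because a finite-dimensional semi-inner product space is
  complete.  The forms are bilinear modulo null sets because weak derivatives are unique, which is
  the fundamental lemma of the calculus of variations.
\<close>

text \<open>Identity in the spaces is equality almost everywhere, but no quotient is formed:
  function spaces become real vector spaces pointwise, and null functions are carried along as a
  subspace modulo which linearity, kernels, dimension and limits are understood. This is why
  semi-inner products replace inner products, why solvability is phrased through a compatibility
  condition on the kernel, and why the contraction principle yields a point at distance zero from
  its image. The trace is a pointwise limit of averages, whose additivity is clear only for
  functions continuous up to the boundary; so the load functional is shown to be linear on the
  discrete space. The a priori estimate has the constant
  \<open>(Chat + \<beta> + stress_bound) / (Chat * \<beta>)\<close>, which is at most
  \<open>\<rho>\<close> because \<open>norm_a\<close> is at least 1 and at least
  \<open>stress_bound\<close>. The same comparison gives \<open>1 \<le> \<rho> * Chat\<close>, which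
  turns the smallness condition into two conditions in terms of \<open>Chat\<close>: invariance of
  the ball of radius \<open>r\<close>, and contraction.\<close>

instantiation "fun" :: (type, real_vector) real_vector
begin

definition "r *\<^sub>R f = (\<lambda>x. r *\<^sub>R f x)"

instance
  by standard (simp_all add: scaleR_fun_def fun_eq_iff algebra_simps)

end

lemma scaleR_fun_apply [simp]: "(r *\<^sub>R f) x = r *\<^sub>R f x"
  by (simp add: scaleR_fun_def)

section \<open>Finite-dimensional linear algebra\<close>

text \<open>Solvability of the normal equations, that is, existence of the orthogonal projection of
  \<open>b\<close> onto the span of the \<open>v j\<close>. Adding one vector at a time as in
  Gram-Schmidt avoids any assumption of linear independence.\<close>

lemma orthogonal_residual_exists:
  fixes v :: "'j \<Rightarrow> 'i \<Rightarrow> real"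
  assumes "finite J" "finite I"
  shows "\<exists>x. \<forall>j\<in>J. (\<Sum>i\<in>I. (b i - (\<Sum>l\<in>J. x l * v l i)) * v j i) = 0"
  using \<open>finite J\<close>
proof (induction J arbitrary: b)
  case empty
  then show ?case by simp
next
  case (insert j0 J)
  obtain x where x: "\<And>j. j \<in> J \<Longrightarrow> (\<Sum>i\<in>I. (b i - (\<Sum>l\<in>J. x l * v l i)) * v j i) = 0"
    using insert.IH[of b] by blast
  obtain y where y: "\<And>j. j \<in> J \<Longrightarrow> (\<Sum>i\<in>I. (v j0 i - (\<Sum>l\<in>J. y l * v l i)) * v j i) = 0"
    using insert.IH[of "v j0"] by blast
  define bo where "bo i = b i - (\<Sum>l\<in>J. x l * v l i)" for i
  define vo where "vo i = v j0 i - (\<Sum>l\<in>J. y l * v l i)" for i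
  \<comment> \<open>If the new vector depends on the old ones, \<open>vo\<close> vanishes on
    \<open>I\<close> and division by zero makes \<open>t = 0\<close>, which is an admissible
    coefficient.\<close>
  define t where "t = (\<Sum>i\<in>I. bo i * vo i) / (\<Sum>i\<in>I. vo i * vo i)"
  define x' where "x' l = (if l = j0 then t else x l - t * y l)" for l
  have xo: "(\<Sum>i\<in>I. bo i * v j i) = 0" and yo: "(\<Sum>i\<in>I. vo i * v j i) = 0" if "j \<in> J" for j
    using x[OF that] y[OF that] by (simp_all add: bo_def vo_def)
  have t: "(\<Sum>i\<in>I. bo i * vo i) = t * (\<Sum>i\<in>I. vo i * vo i)"
  proof (cases "(\<Sum>i\<in>I. vo i * vo i) = 0")
    case True
    then have "\<forall>i\<in>I. vo i = 0"
      using \<open>finite I\<close> by (simp add: sum_nonneg_eq_0_iff)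
    then show ?thesis by simp
  qed (simp add: t_def)
  have res: "b i - (\<Sum>l\<in>insert j0 J. x' l * v l i) = bo i - t * vo i" for i
  proof -
    have "(\<Sum>l\<in>J. x' l * v l i) = (\<Sum>l\<in>J. x l * v l i - t * (y l * v l i))"
      using insert.hyps by (intro sum.cong) (auto simp: x'_def algebra_simps)
    also have "\<dots> = (\<Sum>l\<in>J. x l * v l i) - t * (\<Sum>l\<in>J. y l * v l i)"
      by (simp add: sum_subtractf sum_distrib_left)
    finally show ?thesis
      using insert.hyps by (simp add: bo_def vo_def x'_def algebra_simps)
  qed
  have orth: "(\<Sum>i\<in>I. (bo i - t * vo i) * v j i) = 0" if "j \<in> J" for j
  proof -
    have "(\<Sum>i\<in>I. (bo i - t * vo i) * v j i) = (\<Sum>i\<in>I. bo i * v j i) - t * (\<Sum>i\<in>I. vo i * v j i)"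
      by (simp add: algebra_simps sum_subtractf sum_distrib_left)
    then show ?thesis using xo yo that by simp
  qed
  \<comment> \<open>\<open>v j0\<close> is \<open>vo\<close> plus a combination of the old vectors,
    to which the new residual is already orthogonal; so only the product with \<open>vo\<close> has
    to vanish, and \<open>t\<close> is chosen for that.\<close>
  have "(\<Sum>i\<in>I. (bo i - t * vo i) * (\<Sum>l\<in>J. y l * v l i))
      = (\<Sum>i\<in>I. \<Sum>l\<in>J. y l * ((bo i - t * vo i) * v l i))"
    by (simp add: sum_distrib_left mult_ac)
  also have "\<dots> = (\<Sum>l\<in>J. y l * (\<Sum>i\<in>I. (bo i - t * vo i) * v l i))"
    by (subst sum.swap) (simp add: sum_distrib_left)
  also have "\<dots> = 0"
    using orth by simp
  finally have z: "(\<Sum>i\<in>I. (bo i - t * vo i) * (\<Sum>l\<in>J. y l * v l i)) = 0" .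
  have "(\<Sum>i\<in>I. (bo i - t * vo i) * vo i) = 0"
    using t by (simp add: algebra_simps sum_subtractf sum_distrib_left)
  moreover have "(bo i - t * vo i) * v j0 i
      = (bo i - t * vo i) * vo i + (bo i - t * vo i) * (\<Sum>l\<in>J. y l * v l i)" for i
    by (simp add: vo_def algebra_simps)
  ultimately have "(\<Sum>i\<in>I. (bo i - t * vo i) * v j0 i) = 0"
    using z by (simp add: sum.distrib)
  with orth show ?case
    by (intro exI[of _ x']) (auto simp: res)
qed

text \<open>The Fredholm alternative by least squares. The residual \<open>c\<close> of the best
  approximation of \<open>b\<close> by the columns of \<open>A\<close> annihilates every column, so
  \<open>ker\<close> makes it orthogonal to \<open>b\<close>; then \<open>c\<close> is orthogonal to
  itself and vanishes.\<close>

lemma fredholm_finite: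
  fixes A :: "'i \<Rightarrow> 'j \<Rightarrow> real"
  assumes fin: "finite I" "finite J"
    and ker: "\<And>c. (\<And>j. j \<in> J \<Longrightarrow> (\<Sum>i\<in>I. c i * A i j) = 0) \<Longrightarrow> (\<Sum>i\<in>I. c i * b i) = 0"
  shows "\<exists>x. \<forall>i\<in>I. (\<Sum>j\<in>J. A i j * x j) = b i"
proof -
  obtain x where x: "\<And>j. j \<in> J \<Longrightarrow> (\<Sum>i\<in>I. (b i - (\<Sum>l\<in>J. x l * A i l)) * A i j) = 0"
    using orthogonal_residual_exists[OF fin(2,1), of b "\<lambda>l i. A i l"] by blast
  define c where "c i = b i - (\<Sum>l\<in>J. x l * A i l)" for i
  have c: "(\<Sum>i\<in>I. c i * A i j) = 0" if "j \<in> J" for j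
    using x[OF that] by (simp add: c_def)
  have "(\<Sum>i\<in>I. c i * (\<Sum>l\<in>J. x l * A i l)) = (\<Sum>i\<in>I. \<Sum>l\<in>J. x l * (c i * A i l))"
    by (simp add: sum_distrib_left mult_ac)
  also have "\<dots> = (\<Sum>l\<in>J. x l * (\<Sum>i\<in>I. c i * A i l))"
    by (subst sum.swap) (simp add: sum_distrib_left)
  also have "\<dots> = 0" using c by simp
  finally have "(\<Sum>i\<in>I. c i * (b i - (\<Sum>l\<in>J. x l * A i l))) = 0"
    using ker[OF c] by (simp add: right_diff_distrib sum_subtractf)
  then have "(\<Sum>i\<in>I. c i * c i) = 0"
    by (simp flip: c_def)
  then have "\<forall>i\<in>I. c i = 0"
    using fin by (simp add: sum_nonneg_eq_0_iff)
  then show ?thesis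
    by (intro exI[of _ x]) (simp add: c_def mult.commute)
qed

definition bilinear_on :: "'v::real_vector set \<Rightarrow> ('v \<Rightarrow> 'v \<Rightarrow> real) \<Rightarrow> bool" where
  "bilinear_on Z B \<longleftrightarrow>
     (\<forall>x\<in>Z. \<forall>y\<in>Z. \<forall>z\<in>Z. \<forall>c. B (c *\<^sub>R x + y) z = c * B x z + B y z
        \<and> B z (c *\<^sub>R x + y) = c * B z x + B z y)"

definition linear_functional_on :: "'v::real_vector set \<Rightarrow> ('v \<Rightarrow> real) \<Rightarrow> bool" where
  "linear_functional_on Z G \<longleftrightarrow> (\<forall>x\<in>Z. \<forall>y\<in>Z. \<forall>c. G (c *\<^sub>R x + y) = c * G x + G y)"

lemma linear_functional_onD:
  assumes "linear_functional_on Z G" "subspace Z"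
  shows "G 0 = 0" "x \<in> Z \<Longrightarrow> G (c *\<^sub>R x) = c * G x"
    "x \<in> Z \<Longrightarrow> y \<in> Z \<Longrightarrow> G (x + y) = G x + G y"
    "x \<in> Z \<Longrightarrow> y \<in> Z \<Longrightarrow> G (x - y) = G x - G y"
proof -
  have L: "G (c *\<^sub>R x + y) = c * G x + G y" if "x \<in> Z" "y \<in> Z" for x y c
    using assms that by (simp add: linear_functional_on_def)
  have z: "0 \<in> Z" using assms(2) by (rule subspace_0)
  show G0: "G 0 = 0" using L[OF z z, of 1] by simp
  show "x \<in> Z \<Longrightarrow> G (c *\<^sub>R x) = c * G x" using L[OF _ z, of x c] G0 by simp
  show "x \<in> Z \<Longrightarrow> y \<in> Z \<Longrightarrow> G (x + y) = G x + G y" using L[of x y 1] by simp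
  show "x \<in> Z \<Longrightarrow> y \<in> Z \<Longrightarrow> G (x - y) = G x - G y" using L[of y x "-1"] by simp
qed

lemma linear_functional_on_sum:
  assumes "linear_functional_on Z G" "subspace Z" "finite S" "\<And>i. i \<in> S \<Longrightarrow> h i \<in> Z"
  shows "G (\<Sum>i\<in>S. c i *\<^sub>R h i) = (\<Sum>i\<in>S. c i * G (h i))"
  using assms(3,4)
proof (induction S)
  case empty
  then show ?case using linear_functional_onD(1)[OF assms(1,2)] by simp
next
  case (insert s S)
  then have "(\<Sum>i\<in>S. c i *\<^sub>R h i) \<in> Z" "h s \<in> Z"
    using assms(2) by (auto intro!: subspace_sum subspace_scale)
  then show ?case
    using insert assms(1) by (simp add: linear_functional_on_def)
qed

lemma bilinear_on_left: "bilinear_on Z B \<Longrightarrow> z \<in> Z \<Longrightarrow> linear_functional_on Z (\<lambda>x. B x z)"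
  and bilinear_on_right: "bilinear_on Z B \<Longrightarrow> z \<in> Z \<Longrightarrow> linear_functional_on Z (B z)"
  by (simp_all add: bilinear_on_def linear_functional_on_def)

lemma span_finite_sum:
  assumes "finite S" "e \<in> span S"
  obtains c where "e = (\<Sum>s\<in>S. c s *\<^sub>R s)"
  using assms by (auto simp: span_finite)

text \<open>Modulo the two-sided kernel of \<open>B\<close> every element of \<open>Z\<close> lies
  in \<open>span S\<close>, so the equation becomes a square linear system with the matrix of
  \<open>B\<close> on \<open>S\<close>. In the applications the kernel contains all representatives
  of zero and cannot be trivial; \<open>ker\<close> is the compatibility condition that takes the
  place of injectivity.\<close>

lemma finite_bilinear_solvable:
  fixes B :: "'v::real_vector \<Rightarrow> 'v \<Rightarrow> real"
  assumes Z: "subspace Z" and B: "bilinear_on Z B" and G: "linear_functional_on Z G"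
    and S: "finite S" "S \<subseteq> Z"
    and sp: "\<And>z. z \<in> Z \<Longrightarrow> \<exists>e\<in>span S. \<forall>s\<in>Z. B s (z - e) = 0 \<and> B (z - e) s = 0"
    and ker: "\<And>t. t \<in> Z \<Longrightarrow> (\<And>s. s \<in> Z \<Longrightarrow> B s t = 0) \<Longrightarrow> G t = 0"
  shows "\<exists>s\<in>Z. \<forall>t\<in>Z. B s t = G t"
proof -
  have comb: "(\<Sum>i\<in>S. c i *\<^sub>R i) \<in> Z" for c
    using S Z by (auto intro!: subspace_sum subspace_scale)
  have spZ: "span S \<subseteq> Z" using S Z by (simp add: span_minimal)
  have Br: "B s (\<Sum>i\<in>S. c i *\<^sub>R i) = (\<Sum>i\<in>S. c i * B s i)"
    and Bl: "B (\<Sum>i\<in>S. c i *\<^sub>R i) s = (\<Sum>i\<in>S. c i * B i s)" if "s \<in> Z" for c s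
    using linear_functional_on_sum[OF bilinear_on_right[OF B that] Z S(1), of "\<lambda>i. i" c]
      linear_functional_on_sum[OF bilinear_on_left[OF B that] Z S(1), of "\<lambda>i. i" c] S by auto
  have Gs: "G (\<Sum>i\<in>S. c i *\<^sub>R i) = (\<Sum>i\<in>S. c i * G i)" for c
    using linear_functional_on_sum[OF G Z S(1), of "\<lambda>i. i" c] S by auto
  have diff: "B z t = B e t" if "z \<in> Z" "e \<in> Z" "t \<in> Z" "B (z - e) t = 0" for z e t
    using linear_functional_onD(4)[OF bilinear_on_left[OF B that(3)] Z that(1,2)] that by simp
  have diff': "B t z = B t e" if "z \<in> Z" "e \<in> Z" "t \<in> Z" "B t (z - e) = 0" for z e t
    using linear_functional_onD(4)[OF bilinear_on_right[OF B that(3)] Z that(1,2)] that by simp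
  \<comment> \<open>The unknowns multiply the first argument of \<open>B\<close>, so the transposed
    matrix appears, and its left kernel corresponds to the right kernel of \<open>B\<close>.\<close>
  have "\<exists>x. \<forall>i\<in>S. (\<Sum>j\<in>S. B j i * x j) = G i"
  proof (rule fredholm_finite[OF S(1) S(1)])
    fix c assume c: "\<And>j. j \<in> S \<Longrightarrow> (\<Sum>i\<in>S. c i * B j i) = 0"
    let ?t = "\<Sum>i\<in>S. c i *\<^sub>R i"
    have "B j ?t = 0" if "j \<in> S" for j
      using c[OF that] Br[of j] that S by auto
    then have spt: "B e ?t = 0" if "e \<in> span S" for e
    proof -
      from span_finite_sum[OF S(1) that] obtain d where d: "e = (\<Sum>s\<in>S. d s *\<^sub>R s)" .
      show ?thesis unfolding d using Bl[OF comb, of d c] \<open>\<And>j. j \<in> S \<Longrightarrow> B j ?t = 0\<close> by simp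
    qed
    have "B s ?t = 0" if s: "s \<in> Z" for s
    proof -
      obtain e where e: "e \<in> span S" "\<And>t. t \<in> Z \<Longrightarrow> B (s - e) t = 0" using sp[OF s] by blast
      have "e \<in> Z" using e(1) spZ by (rule subsetD[rotated])
      from diff[OF s this comb e(2)[OF comb]] spt[OF e(1)] show ?thesis by (rule trans)
    qed
    from ker[OF comb this] show "(\<Sum>i\<in>S. c i * G i) = 0" by (simp add: Gs)
  qed
  then obtain x where x: "\<And>i. i \<in> S \<Longrightarrow> (\<Sum>j\<in>S. B j i * x j) = G i" by blast
  let ?s = "\<Sum>i\<in>S. x i *\<^sub>R i"
  have "B ?s t = G t" if t: "t \<in> Z" for t
  proof -
    from sp[OF t] obtain e where e: "e \<in> span S" "\<And>s. s \<in> Z \<Longrightarrow> B s (t - e) = 0" by blast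
    have eZ: "e \<in> Z" using e spZ by blast
    then have "t - e \<in> Z" using t Z by (simp add: subspace_diff)
    \<comment> \<open>The remainder \<open>t - e\<close> lies in the right kernel of
      \<open>B\<close>, so \<open>G\<close> vanishes on it and both sides of the equation depend on
      \<open>e\<close> only.\<close>
    with ker[of "t - e"] e have "G (t - e) = 0" by blast
    then have Gt: "G t = G e" using linear_functional_onD(4)[OF G Z t eZ] by simp
    from span_finite_sum[OF S(1) e(1)] obtain d where d: "e = (\<Sum>s\<in>S. d s *\<^sub>R s)" .
    have "B ?s t = B ?s e" by (rule diff'[OF t eZ comb e(2)[OF comb]])
    also have "\<dots> = (\<Sum>i\<in>S. d i * B ?s i)" unfolding d by (rule Br[OF comb])
    also have "\<dots> = (\<Sum>i\<in>S. d i * G i)"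
    proof (rule sum.cong)
      fix i assume i: "i \<in> S"
      then have "B ?s i = G i" using Bl[of i x] x[OF i] S by (auto simp: mult.commute)
      then show "d i * B ?s i = d i * G i" by simp
    qed simp
    also have "\<dots> = G t" unfolding Gt d by (simp add: Gs)
    finally show ?thesis .
  qed
  then show ?thesis using comb by blast
qed

text \<open>A spanning set is easiest to name outside \<open>Z\<close>, while forms restricted to
  \<open>Z\<close> call for one inside. The elements of \<open>span S\<close> that represent some
  element of \<open>Z\<close> have a finite maximal independent subset, and its members are lifted
  to \<open>Z\<close>.\<close>

lemma subspace_finite_span_modulo:
  fixes Z N :: "'v::real_vector set"
  assumes Z: "subspace Z" and N: "subspace N" and S: "finite S"
    and sp: "\<And>z. z \<in> Z \<Longrightarrow> \<exists>e\<in>span S. z - e \<in> N"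
  obtains S' where "finite S'" "S' \<subseteq> Z" "\<And>z. z \<in> Z \<Longrightarrow> \<exists>e\<in>span S'. z - e \<in> N"
proof -
  define P where "P = {e \<in> span S. \<exists>z\<in>Z. z - e \<in> N}"
  obtain B where B: "B \<subseteq> P" "independent B" "P \<subseteq> span B"
    by (rule maximal_independent_subset)
  then have "finite B" using independent_span_bound[OF S B(2)] by (auto simp: P_def)
  have "\<forall>b\<in>B. \<exists>z\<in>Z. z - b \<in> N" using B by (auto simp: P_def)
  then obtain h where h: "\<And>b. b \<in> B \<Longrightarrow> h b \<in> Z \<and> h b - b \<in> N" by metis
  have "\<exists>e\<in>span (h ` B). z - e \<in> N" if z: "z \<in> Z" for z
  proof -
    obtain e where e: "e \<in> span S" "z - e \<in> N" using sp z by blast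
    then have "e \<in> span B" using z B by (auto simp: P_def)
    from span_finite_sum[OF \<open>finite B\<close> this] obtain c where c: "e = (\<Sum>b\<in>B. c b *\<^sub>R b)" .
    have "(\<Sum>b\<in>B. c b *\<^sub>R (h b - b)) \<in> N"
      using h N by (auto intro!: subspace_sum subspace_scale)
    then have "(z - e) - (\<Sum>b\<in>B. c b *\<^sub>R (h b - b)) \<in> N" using e N by (simp add: subspace_diff)
    moreover have "(z - e) - (\<Sum>b\<in>B. c b *\<^sub>R (h b - b)) = z - (\<Sum>b\<in>B. c b *\<^sub>R h b)"
      unfolding c by (simp add: scaleR_diff_right sum_subtractf)
    moreover have "(\<Sum>b\<in>B. c b *\<^sub>R h b) \<in> span (h ` B)"
      by (intro span_sum span_scale span_base imageI)
    ultimately show ?thesis by metis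
  qed
  then show ?thesis using that[of "h ` B"] \<open>finite B\<close> h by blast
qed

section \<open>Finite-dimensional semi-inner product spaces\<close>

text \<open>Only semidefinite, since a nonzero function may vanish almost everywhere.\<close>

definition semi_inner_on :: "'v::real_vector set \<Rightarrow> ('v \<Rightarrow> 'v \<Rightarrow> real) \<Rightarrow> bool" where
  "semi_inner_on Z B \<longleftrightarrow> subspace Z \<and> bilinear_on Z B \<and> (\<forall>x\<in>Z. \<forall>y\<in>Z. B x y = B y x) \<and> (\<forall>x\<in>Z. 0 \<le> B x x)"

lemma semi_inner_expand:
  assumes "semi_inner_on Z B" "x \<in> Z" "y \<in> Z"
  shows "B (t *\<^sub>R x + y) (t *\<^sub>R x + y) = t\<^sup>2 * B x x + 2 * t * B x y + B y y"
proof -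
  have Z: "subspace Z" and b: "bilinear_on Z B" and s: "B x y = B y x"
    using assms by (auto simp: semi_inner_on_def)
  have "t *\<^sub>R x + y \<in> Z" using Z assms by (simp add: subspace_add subspace_scale)
  then show ?thesis
    using b assms(2,3) s unfolding bilinear_on_def by (simp add: algebra_simps power2_eq_square)
qed

lemma semi_inner_Cauchy_Schwarz:
  assumes "semi_inner_on Z B" "x \<in> Z" "y \<in> Z"
  shows "\<bar>B x y\<bar> \<le> sqrt (B x x) * sqrt (B y y)"
proof -
  have Z: "subspace Z" and nn: "0 \<le> B x x" "0 \<le> B y y" and all: "\<And>x. x \<in> Z \<Longrightarrow> 0 \<le> B x x"
    using assms by (auto simp: semi_inner_on_def)
  have q: "0 \<le> t\<^sup>2 * B x x + 2 * t * B x y + B y y" for t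
    using all[of "t *\<^sub>R x + y"] assms Z semi_inner_expand[OF assms]
    by (simp add: subspace_add subspace_scale)
  have "(B x y)\<^sup>2 \<le> B x x * B y y"
  proof (cases "B x x = 0")
    case True
    have "B x y = 0"
    proof (rule ccontr)
      assume "B x y \<noteq> 0"
      \<comment> \<open>For \<open>B x x = 0\<close> the quadratic in \<open>t\<close> is affine;
        this \<open>t\<close> gives it the value -1.\<close>
      then show False using q[of "- (B y y + 1) / (2 * B x y)"] True by (simp add: field_simps)
    qed
    then show ?thesis using True by simp
  next
    case False
    then have p: "0 < B x x" using nn by simp
    \<comment> \<open>The quadratic at its minimiser \<open>t = - B x y / B x x\<close>, scaled to
      clear denominators.\<close>
    have "0 \<le> B x x * ((- B x y / B x x)\<^sup>2 * B x x + 2 * (- B x y / B x x) * B x y + B y y)"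
      by (intro mult_nonneg_nonneg q nn)
    also have "\<dots> = B x x * B y y - (B x y)\<^sup>2"
      using p by (simp add: field_simps power2_eq_square)
    finally show ?thesis by simp
  qed
  then have "sqrt ((B x y)\<^sup>2) \<le> sqrt (B x x * B y y)" by (rule real_sqrt_le_mono)
  then show ?thesis by (simp add: real_sqrt_mult)
qed

lemma semi_inner_triangle:
  assumes "semi_inner_on Z B" "x \<in> Z" "y \<in> Z"
  shows "sqrt (B (x + y) (x + y)) \<le> sqrt (B x x) + sqrt (B y y)"
proof -
  have nn: "0 \<le> B x x" "0 \<le> B y y" using assms by (auto simp: semi_inner_on_def)
  have "B (x + y) (x + y) \<le> (sqrt (B x x) + sqrt (B y y))\<^sup>2"
    using semi_inner_expand[OF assms, of 1] semi_inner_Cauchy_Schwarz[OF assms] nn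
    by (simp add: power2_sum)
  then show ?thesis using nn by (simp add: real_le_lsqrt)
qed

lemma semi_inner_zero:
  assumes "semi_inner_on Z B" "x \<in> Z"
  shows "B 0 x = 0" "B x 0 = 0"
proof -
  have Z: "subspace Z" and b: "bilinear_on Z B" using assms by (auto simp: semi_inner_on_def)
  show "B 0 x = 0" "B x 0 = 0"
    by (rule linear_functional_onD(1)[OF bilinear_on_left[OF b assms(2)] Z]
        linear_functional_onD(1)[OF bilinear_on_right[OF b assms(2)] Z])+
qed

lemma semi_inner_minus:
  assumes "semi_inner_on Z B" "x \<in> Z" "y \<in> Z"
  shows "B (x - y) (x - y) = B (y - x) (y - x)"
proof -
  have Z: "subspace Z" using assms by (simp add: semi_inner_on_def)
  have "0 \<in> Z" "y - x \<in> Z" using Z assms by (auto simp: subspace_0 subspace_diff)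
  then show ?thesis
    using semi_inner_zero[OF assms(1)] semi_inner_expand[OF assms(1), of "y - x" 0 "-1"] by simp
qed

text \<open>
  The inner products with a Cauchy sequence converge to a linear functional; the vector representing
  it, which exists by finite-dimensional solvability, is the limit.
\<close>

lemma semi_inner_complete:
  fixes B :: "'v::real_vector \<Rightarrow> 'v \<Rightarrow> real"
  defines "N \<equiv> \<lambda>x. sqrt (B x x)"
  assumes si: "semi_inner_on Z B" and S: "finite S" "S \<subseteq> Z"
    and sp: "\<And>z. z \<in> Z \<Longrightarrow> \<exists>e\<in>span S. B (z - e) (z - e) = 0"
    and y: "\<And>n. y n \<in> Z"
    and Cau: "\<And>\<epsilon>. 0 < \<epsilon> \<Longrightarrow> \<exists>M. \<forall>m\<ge>M. \<forall>n\<ge>M. N (y m - y n) < \<epsilon>"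
  shows "\<exists>v\<in>Z. (\<lambda>n. N (y n - v)) \<longlonglongrightarrow> 0"
proof -
  have Z: "subspace Z" and b: "bilinear_on Z B" and sym: "\<And>x y. x \<in> Z \<Longrightarrow> y \<in> Z \<Longrightarrow> B x y = B y x"
    and nn: "\<And>x. x \<in> Z \<Longrightarrow> 0 \<le> B x x"
    using si by (auto simp: semi_inner_on_def)
  have N0: "0 \<le> N x" if "x \<in> Z" for x using nn[OF that] by (simp add: N_def)
  have CS: "\<bar>B x z\<bar> \<le> N x * N z" if "x \<in> Z" "z \<in> Z" for x z
    using semi_inner_Cauchy_Schwarz[OF si that] by (simp add: N_def)
  have spZ: "span S \<subseteq> Z" using S Z by (simp add: span_minimal)
  have dZ: "x - z \<in> Z" if "x \<in> Z" "z \<in> Z" for x z using Z that by (simp add: subspace_diff)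
  have Bd: "B (x - x') z = B x z - B x' z" if "x \<in> Z" "x' \<in> Z" "z \<in> Z" for x x' z
    using linear_functional_onD(4)[OF bilinear_on_left[OF b that(3)] Z that(1,2)] .
  have "convergent (\<lambda>n. B (y n) z)" if z: "z \<in> Z" for z
  proof (rule Cauchy_convergent, rule metric_CauchyI)
    fix e :: real assume e: "0 < e"
    \<comment> \<open>One is added because the seminorm \<open>N z\<close> may be zero.\<close>
    then have "0 < e / (N z + 1)" using N0[OF z] by (simp add: add_nonneg_pos)
    then obtain M where M: "\<And>m n. M \<le> m \<Longrightarrow> M \<le> n \<Longrightarrow> N (y m - y n) < e / (N z + 1)"
      using Cau by blast
    have "dist (B (y m) z) (B (y n) z) < e" if mn: "M \<le> m" "M \<le> n" for m n
    proof -
      have "dist (B (y m) z) (B (y n) z) = \<bar>B (y m - y n) z\<bar>"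
        using Bd y z by (simp add: dist_real_def)
      also have "\<dots> \<le> N (y m - y n) * N z" using CS dZ y z by blast
      also have "\<dots> \<le> N (y m - y n) * (N z + 1)" using N0 dZ y by (simp add: mult_left_mono)
      also have "\<dots> < e / (N z + 1) * (N z + 1)"
        using M[OF mn] N0[OF z] by (intro mult_strict_right_mono) auto
      also have "\<dots> = e" using N0[OF z] by (simp add: add_nonneg_eq_0_iff)
      finally show ?thesis .
    qed
    then show "\<exists>M. \<forall>m\<ge>M. \<forall>n\<ge>M. dist (B (y m) z) (B (y n) z) < e" by blast
  qed
  then have lim: "(\<lambda>n. B (y n) z) \<longlonglongrightarrow> lim (\<lambda>n. B (y n) z)" if "z \<in> Z" for z
    using that by (simp add: convergent_LIMSEQ_iff)
  define G where "G z = lim (\<lambda>n. B (y n) z)" for z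
  have G: "linear_functional_on Z G"
    unfolding linear_functional_on_def
  proof (intro ballI allI)
    fix u v c assume uv: "u \<in> Z" "v \<in> Z"
    have "(\<lambda>n. B (y n) (c *\<^sub>R u + v)) = (\<lambda>n. c * B (y n) u + B (y n) v)"
      using b y uv by (simp add: bilinear_on_def)
    moreover have "(\<lambda>n. c * B (y n) u + B (y n) v) \<longlonglongrightarrow> c * G u + G v"
      unfolding G_def by (intro tendsto_intros lim uv)
    ultimately show "G (c *\<^sub>R u + v) = c * G u + G v" unfolding G_def[of "c *\<^sub>R u + v"] by (simp add: limI)
  qed
  have null: "B s u = 0 \<and> B u s = 0" if "s \<in> Z" "u \<in> Z" "B u u = 0" for s u
    using CS[OF that(1,2)] CS[OF that(2,1)] that(3) by (simp add: N_def)
  have "\<exists>v\<in>Z. \<forall>t\<in>Z. B v t = G t"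
  proof (rule finite_bilinear_solvable[OF Z b G S])
    fix z assume z: "z \<in> Z"
    then obtain e where e: "e \<in> span S" "B (z - e) (z - e) = 0" using sp by blast
    then show "\<exists>e\<in>span S. \<forall>s\<in>Z. B s (z - e) = 0 \<and> B (z - e) s = 0"
      using null[of _ "z - e"] dZ[OF z] spZ by blast
  next
    fix t assume t: "t \<in> Z" "\<And>s. s \<in> Z \<Longrightarrow> B s t = 0"
    then show "G t = 0" using y by (simp add: G_def)
  qed
  then obtain v where v: "v \<in> Z" "\<And>t. t \<in> Z \<Longrightarrow> B v t = G t" by blast
  have weak: "(\<lambda>m. B (y m - v) t) \<longlonglongrightarrow> 0" if t: "t \<in> Z" for t
  proof -
    have "(\<lambda>m. B (y m) t - B v t) \<longlonglongrightarrow> G t - B v t"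
      unfolding G_def by (intro tendsto_intros lim t)
    then show ?thesis using v t y Bd by simp
  qed
  have "(\<lambda>n. N (y n - v)) \<longlonglongrightarrow> 0"
  proof (rule LIMSEQ_I)
    fix e :: real assume e: "0 < e"
    then obtain M where M: "\<And>m n. M \<le> m \<Longrightarrow> M \<le> n \<Longrightarrow> N (y m - y n) < e / 2"
      using Cau[of "e/2"] by auto
    have le: "N (y n - v) \<le> e / 2" if n: "M \<le> n" for n
    proof -
      let ?d = "y n - v"
      have d: "?d \<in> Z" using dZ y v by blast
      \<comment> \<open>Passing through \<open>y m\<close> separates a Cauchy difference, small for
        all large \<open>m\<close>, from a term that tends to zero in \<open>m\<close> by weak
        convergence. This upgrades weak to strong convergence.\<close>
      have "B ?d ?d \<le> N ?d * (e / 2) + B (y m - v) ?d" if m: "M \<le> m" for m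
      proof -
        have "B ?d ?d = B (?d - (y m - v)) ?d + B (y m - v) ?d"
          using Bd[of ?d "y m - v" ?d] d dZ y v by auto
        also have "?d - (y m - v) = y n - y m" by simp
        also have "B (y n - y m) ?d \<le> N (y n - y m) * N ?d"
          using CS[of "y n - y m" ?d] d dZ y by (meson abs_le_D1)
        also have "\<dots> \<le> N ?d * (e / 2)"
          using mult_left_mono[OF less_imp_le[OF M[OF n m]] N0[OF d]] by (simp add: mult.commute)
        finally show ?thesis by simp
      qed
      then have "\<forall>\<^sub>F m in sequentially. B ?d ?d \<le> N ?d * (e / 2) + B (y m - v) ?d"
        by (auto simp: eventually_sequentially)
      moreover have "(\<lambda>m. N ?d * (e / 2) + B (y m - v) ?d) \<longlonglongrightarrow> N ?d * (e / 2) + 0"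
        by (intro tendsto_intros weak d)
      ultimately have "B ?d ?d \<le> N ?d * (e / 2)"
        using tendsto_lowerbound[of "\<lambda>m. N ?d * (e / 2) + B (y m - v) ?d" "N ?d * (e / 2) + 0" sequentially "B ?d ?d"]
        by simp
      then have "N ?d * N ?d \<le> N ?d * (e / 2)" using nn[OF d] by (simp add: N_def)
      then show ?thesis using N0[OF d] e
        by (cases "N ?d = 0") auto
    qed
    have "norm (N (y n - v) - 0) < e" if "M \<le> n" for n
      using N0[OF dZ[OF y v(1)], of n] le[OF that] e by simp
    then show "\<exists>no. \<forall>n\<ge>no. norm (N (y n - v) - 0) < e"
      by blast
  qed
  then show ?thesis using v by blast
qed

text \<open>Banach's fixed point theorem for a seminorm. Limits are determined only up to vectors of
  seminorm zero, so the conclusion is that \<open>T v\<close> and \<open>v\<close> have distance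
  zero, and \<open>W\<close> has to contain every limit in \<open>Z\<close> of its
  sequences.\<close>

lemma semi_inner_contraction_fixpoint:
  fixes B :: "'v::real_vector \<Rightarrow> 'v \<Rightarrow> real"
  defines "N \<equiv> \<lambda>x. sqrt (B x x)"
  assumes si: "semi_inner_on Z B" and S: "finite S" "S \<subseteq> Z"
    and sp: "\<And>z. z \<in> Z \<Longrightarrow> \<exists>e\<in>span S. B (z - e) (z - e) = 0"
    and W: "W \<subseteq> Z" "x0 \<in> W" and T: "\<And>x. x \<in> W \<Longrightarrow> T x \<in> W"
    and closed: "\<And>x v. (\<And>n::nat. x n \<in> W) \<Longrightarrow> v \<in> Z \<Longrightarrow> (\<lambda>n. N (x n - v)) \<longlonglongrightarrow> 0 \<Longrightarrow> v \<in> W"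
    and L: "0 \<le> L" "L < 1" and contr: "\<And>x y. x \<in> W \<Longrightarrow> y \<in> W \<Longrightarrow> N (T x - T y) \<le> L * N (x - y)"
  shows "\<exists>v\<in>W. N (T v - v) = 0"
proof -
  have Z: "subspace Z" and nn: "\<And>x. x \<in> Z \<Longrightarrow> 0 \<le> B x x"
    using si by (auto simp: semi_inner_on_def)
  have N0: "0 \<le> N x" if "x \<in> Z" for x using nn[OF that] by (simp add: N_def)
  have dZ: "x - z \<in> Z" if "x \<in> Z" "z \<in> Z" for x z using Z that by (simp add: subspace_diff)
  have tri: "N (x - z) \<le> N (x - y) + N (y - z)" if "x \<in> Z" "y \<in> Z" "z \<in> Z" for x y z
    using semi_inner_triangle[OF si, of "x - y" "y - z"] dZ that by (simp add: N_def)
  have Nm: "N (x - y) = N (y - x)" if "x \<in> Z" "y \<in> Z" for x y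
    using semi_inner_minus[OF si that] by (simp add: N_def)
  define y where "y n = (T ^^ n) x0" for n
  have yW: "y n \<in> W" for n
    by (induction n) (simp_all add: y_def W(2) T)
  then have yZ: "y n \<in> Z" for n using W by blast
  define D where "D = N (y 1 - y 0)"
  have step: "N (y (Suc n) - y n) \<le> L ^ n * D" for n
  proof (induction n)
    case 0
    then show ?case by (simp add: D_def)
  next
    case (Suc n)
    have "N (y (Suc (Suc n)) - y (Suc n)) \<le> L * N (y (Suc n) - y n)"
      using contr[OF yW yW, of "Suc n" n] by (simp add: y_def)
    also have "\<dots> \<le> L * (L ^ n * D)" using Suc L by (simp add: mult_left_mono)
    finally show ?case by simp
  qed
  have D0: "0 \<le> D" using N0 dZ yZ by (simp add: D_def)
  have tail: "N (y (n + k) - y n) \<le> L ^ n * D / (1 - L)" for n k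
  proof -
    have "N (y (n + k) - y n) \<le> (\<Sum>i<k. L ^ (n + i) * D)"
    proof (induction k)
      case 0
      show ?case using semi_inner_zero[OF si subspace_0[OF Z]] by (simp add: N_def)
    next
      case (Suc k)
      then show ?case
        using tri[OF yZ yZ yZ, of "n + Suc k" n "n + k"] step[of "n + k"] by simp
    qed
    also have "\<dots> = L ^ n * D * (\<Sum>i<k. L ^ i)" by (simp add: sum_distrib_left power_add mult_ac)
    also have "\<dots> \<le> L ^ n * D * (1 / (1 - L))"
    proof (rule mult_left_mono)
      show "(\<Sum>i<k. L ^ i) \<le> 1 / (1 - L)"
        using L by (simp add: sum_gp_strict divide_right_mono)
      show "0 \<le> L ^ n * D" using L D0 by simp
    qed
    finally show ?thesis by simp
  qed
  have lim0: "(\<lambda>n. L ^ n * D / (1 - L)) \<longlonglongrightarrow> 0"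
    using tendsto_divide[OF tendsto_mult_right[OF LIMSEQ_realpow_zero[OF L], of D] tendsto_const[of "1 - L"]] L by simp
  have "\<exists>v\<in>Z. (\<lambda>n. N (y n - v)) \<longlonglongrightarrow> 0"
    unfolding N_def
  proof (rule semi_inner_complete[OF si S sp yZ])
    fix e :: real assume e: "0 < e"
    then obtain M where M: "\<And>n. M \<le> n \<Longrightarrow> L ^ n * D / (1 - L) < e"
      using order_tendstoD(2)[OF lim0 e] by (auto simp: eventually_sequentially)
    have 1: "N (y m - y n) < e" if "M \<le> n" "n \<le> m" for m n
      using tail[of n "m - n"] M[OF that(1)] that by simp
    have "N (y m - y n) < e" if "M \<le> n" "M \<le> m" for m n
      using 1[of n m] 1[of m n] Nm[OF yZ yZ, of n m] that by (cases "n \<le> m") simp_all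
    then show "\<exists>M. \<forall>m\<ge>M. \<forall>n\<ge>M. sqrt (B (y m - y n) (y m - y n)) < e"
      unfolding N_def by blast
  qed
  then obtain v where v: "v \<in> Z" "(\<lambda>n. N (y n - v)) \<longlonglongrightarrow> 0" by blast
  have vW: "v \<in> W" by (rule closed[OF yW v])
  have TvZ: "T v \<in> Z" using T vW W by blast
  have "N (T v - v) \<le> L * N (y n - v) + N (y (Suc n) - v)" for n
  proof -
    have "N (T v - v) \<le> N (T v - T (y n)) + N (T (y n) - v)"
      using tri TvZ v W T yW by blast
    also have "N (T v - T (y n)) \<le> L * N (v - y n)" by (rule contr[OF vW yW])
    also have "N (v - y n) = N (y n - v)" by (rule Nm[OF v(1) yZ])
    finally show ?thesis by (simp add: y_def)
  qed
  moreover have "(\<lambda>n. L * N (y n - v) + N (y (Suc n) - v)) \<longlonglongrightarrow> L * 0 + 0"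
    by (intro tendsto_intros v(2) LIMSEQ_Suc)
  ultimately have "N (T v - v) \<le> 0"
    using LIMSEQ_le_const[of "\<lambda>n. L * N (y n - v) + N (y (Suc n) - v)" "L * 0 + 0" "N (T v - v)"]
    by simp
  then have "N (T v - v) = 0" using N0[OF dZ[OF TvZ v(1)]] by simp
  then show ?thesis using vW by blast
qed

section \<open>The space of square integrable functions\<close>

lemma L2_space_measurable: "f \<in> L2_space M \<Longrightarrow> f \<in> borel_measurable M"
  and L2_space_integrable: "f \<in> L2_space M \<Longrightarrow> integrable M (\<lambda>x. (norm (f x))\<^sup>2)"
  by (simp_all add: L2_space_def)

lemma L2_space_bound:
  assumes "f \<in> borel_measurable M" "integrable M h" "AE x in M. (norm (f x))\<^sup>2 \<le> h x"
  shows "f \<in> L2_space M"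
  using assms unfolding L2_space_def
  by (auto intro!: Bochner_Integration.integrable_bound[of M h "\<lambda>x. (norm (f x))\<^sup>2"] elim!: eventually_mono)

lemma subspace_L2: "subspace (L2_space M :: ('a \<Rightarrow> 'b::euclidean_space) set)"
proof (rule subspaceI)
  show "0 \<in> (L2_space M :: ('a \<Rightarrow> 'b) set)" by (simp add: L2_space_def zero_fun_def)
next
  fix f g :: "'a \<Rightarrow> 'b" assume fg: "f \<in> L2_space M" "g \<in> L2_space M"
  have [measurable]: "f \<in> borel_measurable M" "g \<in> borel_measurable M"
    using fg by (simp_all add: L2_space_measurable)
  have "(norm (f x + g x))\<^sup>2 \<le> 2 * (norm (f x))\<^sup>2 + 2 * (norm (g x))\<^sup>2" for x
  proof -
    have "(norm (f x + g x))\<^sup>2 \<le> (norm (f x) + norm (g x))\<^sup>2"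
      by (intro power_mono norm_triangle_ineq) simp
    also have "\<dots> \<le> 2 * (norm (f x))\<^sup>2 + 2 * (norm (g x))\<^sup>2"
      using sum_squares_bound[of "norm (f x)" "norm (g x)"] by (simp add: power2_sum)
    finally show ?thesis .
  qed
  then have "(\<lambda>x. f x + g x) \<in> L2_space M"
    by (intro L2_space_bound[where h="\<lambda>x. 2 * (norm (f x))\<^sup>2 + 2 * (norm (g x))\<^sup>2"])
      (auto intro!: Bochner_Integration.integrable_add integrable_mult_right L2_space_integrable fg)
  then show "f + g \<in> L2_space M" by (simp add: plus_fun_def)
next
  fix c and f :: "'a \<Rightarrow> 'b" assume f: "f \<in> L2_space M"
  have "(\<lambda>x. c *\<^sub>R f x) \<in> L2_space M"
    using L2_space_measurable[OF f]
    by (intro L2_space_bound[where h="\<lambda>x. c\<^sup>2 * (norm (f x))\<^sup>2"])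
      (auto simp: power_mult_distrib intro!: integrable_mult_right L2_space_integrable f)
  then show "c *\<^sub>R f \<in> L2_space M" by (simp add: scaleR_fun_def)
qed

lemma L2_space_add: "f \<in> L2_space M \<Longrightarrow> g \<in> L2_space M \<Longrightarrow> (\<lambda>x. f x + g x) \<in> L2_space M"
  using subspace_add[OF subspace_L2, of f M g] by (simp add: plus_fun_def)

lemma L2_space_diff: "f \<in> L2_space M \<Longrightarrow> g \<in> L2_space M \<Longrightarrow> (\<lambda>x. f x - g x) \<in> L2_space M"
  using subspace_diff[OF subspace_L2, of f M g] by (simp add: fun_diff_def)

lemma L2_space_dominated:
  assumes "f \<in> borel_measurable M" "g \<in> L2_space M" "AE x in M. norm (f x) \<le> c * norm (g x)"
  shows "f \<in> L2_space M"
proof (rule L2_space_bound[OF assms(1)])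
  show "integrable M (\<lambda>x. c\<^sup>2 * (norm (g x))\<^sup>2)"
    by (intro integrable_mult_right L2_space_integrable assms)
  show "AE x in M. (norm (f x))\<^sup>2 \<le> c\<^sup>2 * (norm (g x))\<^sup>2"
    using assms(3)
  proof eventually_elim
    case (elim x)
    then show ?case using power_mono[OF elim, of 2] by (simp add: power_mult_distrib)
  qed
qed

lemma L2_space_bounded_linear:
  fixes h :: "'b::euclidean_space \<Rightarrow> 'c::euclidean_space"
  assumes "bounded_linear h" "f \<in> L2_space M"
  shows "(\<lambda>x. h (f x)) \<in> L2_space M"
proof -
  obtain K where "\<And>x. norm (h x) \<le> norm x * K" using bounded_linear.bounded[OF assms(1)] by blast
  moreover have "(\<lambda>x. h (f x)) \<in> borel_measurable M"
    by (rule borel_measurable_continuous_on[OF linear_continuous_on[OF assms(1)] L2_space_measurable[OF assms(2)]])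
  ultimately show ?thesis
    using assms by (intro L2_space_dominated[OF _ assms(2), where c=K]) (auto simp: mult.commute)
qed

lemma L2_inner_integrable:
  assumes "f \<in> L2_space M" "g \<in> L2_space M"
  shows "integrable M (\<lambda>x. f x \<bullet> g x)"
proof (rule Bochner_Integration.integrable_bound)
  show "integrable M (\<lambda>x. (norm (f x))\<^sup>2 + (norm (g x))\<^sup>2)"
    by (intro Bochner_Integration.integrable_add L2_space_integrable assms)
  show "(\<lambda>x. f x \<bullet> g x) \<in> borel_measurable M"
    using assms by (intro borel_measurable_inner L2_space_measurable)
  have "norm (f x \<bullet> g x) \<le> norm ((norm (f x))\<^sup>2 + (norm (g x))\<^sup>2)" for x
  proof -
    have "\<bar>f x \<bullet> g x\<bar> \<le> norm (f x) * norm (g x)" by (rule Cauchy_Schwarz_ineq2)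
    moreover have "0 \<le> (norm (f x) - norm (g x))\<^sup>2" by simp
    moreover have "0 \<le> norm (f x) * norm (g x)" by simp
    ultimately show ?thesis by (simp add: power2_diff)
  qed
  then show "AE x in M. norm (f x \<bullet> g x) \<le> norm ((norm (f x))\<^sup>2 + (norm (g x))\<^sup>2)" by simp
qed

lemma semi_inner_L2: "semi_inner_on (L2_space M) (L2_inner M :: ('a \<Rightarrow> 'b::euclidean_space) \<Rightarrow> _)"
  unfolding semi_inner_on_def bilinear_on_def
proof (intro conjI ballI allI subspace_L2)
  fix f g h :: "'a \<Rightarrow> 'b" and c :: real
  assume L: "f \<in> L2_space M" "g \<in> L2_space M" "h \<in> L2_space M"
  note int = L2_inner_integrable
  show "L2_inner M (c *\<^sub>R f + g) h = c * L2_inner M f h + L2_inner M g h"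
    using int[OF L(1,3)] int[OF L(2,3)] by (simp add: L2_inner_def inner_add_left)
  show "L2_inner M h (c *\<^sub>R f + g) = c * L2_inner M h f + L2_inner M h g"
    using int[OF L(3,1)] int[OF L(3,2)] by (simp add: L2_inner_def inner_add_right)
next
  fix f g :: "'a \<Rightarrow> 'b" 
  show "L2_inner M f g = L2_inner M g f" by (simp add: L2_inner_def inner_commute)
  show "0 \<le> L2_inner M f f" by (simp add: L2_inner_def)
qed

lemma L2_norm_inner: "L2_norm M f = sqrt (L2_inner M f f)"
  and L2_norm_square: "(L2_norm M f)\<^sup>2 = L2_inner M f f"
  by (simp_all add: L2_norm_def L2_inner_def power2_norm_eq_inner)

lemma L2_norm_nonneg [simp]: "0 \<le> L2_norm M f"
  by (simp add: L2_norm_def)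

lemma L2_Cauchy_Schwarz:
  "f \<in> L2_space M \<Longrightarrow> g \<in> L2_space M \<Longrightarrow> \<bar>L2_inner M f g\<bar> \<le> L2_norm M f * L2_norm M g"
  unfolding L2_norm_inner by (rule semi_inner_Cauchy_Schwarz[OF semi_inner_L2])

lemma L2_inner_bound:
  assumes "f \<in> L2_space M" "g \<in> L2_space M" "L2_norm M f \<le> c" "L2_norm M g \<le> d"
  shows "\<bar>L2_inner M f g\<bar> \<le> c * d"
proof -
  have "0 \<le> c" using assms(3) L2_norm_nonneg order_trans by blast
  then have "L2_norm M f * L2_norm M g \<le> c * d" using assms by (intro mult_mono) auto
  then show ?thesis using L2_Cauchy_Schwarz[OF assms(1,2)] by linarith
qed

lemma L2_norm_triangle:
  "f \<in> L2_space M \<Longrightarrow> g \<in> L2_space M \<Longrightarrow> L2_norm M (\<lambda>x. f x + g x) \<le> L2_norm M f + L2_norm M g"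
  using semi_inner_triangle[OF semi_inner_L2, of f M g] by (simp add: L2_norm_inner plus_fun_def)

lemma L2_norm_triangle_diff:
  "f \<in> L2_space M \<Longrightarrow> g \<in> L2_space M \<Longrightarrow> L2_norm M (\<lambda>x. f x - g x) \<le> L2_norm M f + L2_norm M g"
  using L2_norm_triangle[of f M "\<lambda>x. - g x"] subspace_neg[OF subspace_L2, of g M]
  by (simp add: fun_Compl_def L2_norm_def)

lemma L2_norm_mono:
  assumes "f \<in> L2_space M" "g \<in> L2_space M" "0 \<le> c" "AE x in M. norm (f x) \<le> c * norm (g x)"
  shows "L2_norm M f \<le> c * L2_norm M g"
proof -
  have "(\<integral>x. (norm (f x))\<^sup>2 \<partial>M) \<le> (\<integral>x. c\<^sup>2 * (norm (g x))\<^sup>2 \<partial>M)"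
  proof (intro integral_mono_AE integrable_mult_right L2_space_integrable assms)
    show "AE x in M. (norm (f x))\<^sup>2 \<le> c\<^sup>2 * (norm (g x))\<^sup>2"
      using assms(4)
    proof eventually_elim
      case (elim x)
      then show ?case using power_mono[OF elim, of 2] by (simp add: power_mult_distrib)
    qed
  qed
  then have "L2_norm M f \<le> sqrt (c\<^sup>2 * (\<integral>x. (norm (g x))\<^sup>2 \<partial>M))" by (simp add: L2_norm_def)
  then show ?thesis using assms(3) by (simp add: L2_norm_def real_sqrt_mult)
qed

lemma L2_norm_eq_0:
  assumes "f \<in> L2_space M" "L2_norm M f = 0"
  shows "AE x in M. f x = 0"
proof -
  have "(\<integral>x. (norm (f x))\<^sup>2 \<partial>M) = 0" using assms(2) by (simp add: L2_norm_def)
  then have "AE x in M. (norm (f x))\<^sup>2 = 0"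
    using integral_nonneg_eq_0_iff_AE[OF L2_space_integrable[OF assms(1)]] by simp
  then show ?thesis by simp
qed

lemma L2_inner_cong_AE:
  assumes "f \<in> L2_space M" "g \<in> L2_space M" "f' \<in> L2_space M" "g' \<in> L2_space M"
    and "AE x in M. f x = f' x" "AE x in M. g x = g' x"
  shows "L2_inner M f g = L2_inner M f' g'"
  unfolding L2_inner_def using assms
  by (intro integral_cong_AE borel_measurable_inner L2_space_measurable) auto

lemma L2_norm_AE_0:
  assumes "AE x in M. f x = 0" shows "L2_norm M f = 0"
proof -
  have "(\<integral>x. (norm (f x))\<^sup>2 \<partial>M) = 0"
    by (rule integral_eq_zero_AE) (use assms in auto)
  then show ?thesis by (simp add: L2_norm_def)
qed

lemma L2_space_components:
  fixes f :: "'a \<Rightarrow> 'b::euclidean_space"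
  shows "f \<in> L2_space M \<longleftrightarrow> (\<forall>e\<in>Basis. (\<lambda>x. f x \<bullet> e) \<in> L2_space M)"
proof
  assume "f \<in> L2_space M"
  then show "\<forall>e\<in>Basis. (\<lambda>x. f x \<bullet> e) \<in> L2_space M"
    using L2_space_bounded_linear[OF bounded_linear_inner_left] by blast
next
  assume r: "\<forall>e\<in>Basis. (\<lambda>x. f x \<bullet> e) \<in> L2_space M"
  have "(\<lambda>x. (f x \<bullet> e) *\<^sub>R e) \<in> L2_space M" if "e \<in> Basis" for e
    using L2_space_bounded_linear[OF bounded_linear_scaleR_left[of e]] r that by blast
  then have "(\<Sum>e\<in>Basis. (\<lambda>x. (f x \<bullet> e) *\<^sub>R e)) \<in> L2_space M"
    by (intro subspace_sum[OF subspace_L2])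
  moreover have "(\<Sum>e\<in>Basis. (\<lambda>x. (f x \<bullet> e) *\<^sub>R e)) = f"
  proof
    fix x
    have "(\<Sum>e\<in>B. (\<lambda>x. (f x \<bullet> e) *\<^sub>R e)) x = (\<Sum>e\<in>B. (f x \<bullet> e) *\<^sub>R e)" if "finite B" for B
      using that by (induction B) auto
    then show "(\<Sum>e\<in>Basis. (\<lambda>x. (f x \<bullet> e) *\<^sub>R e)) x = f x"
      by (simp add: euclidean_representation)
  qed
  ultimately show "f \<in> L2_space M" by simp
qed

lemma L2_space_vec:
  fixes f :: "'a \<Rightarrow> 'b::euclidean_space ^ 'n"
  assumes "\<And>i. (\<lambda>x. f x $ i) \<in> L2_space M"
  shows "f \<in> L2_space M"
  unfolding L2_space_components[of f]
proof
  fix e :: "'b ^ 'n" assume "e \<in> Basis"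
  then obtain i b where e: "e = axis i b" "b \<in> Basis" by (auto simp: Basis_vec_def)
  then show "(\<lambda>x. f x \<bullet> e) \<in> L2_space M"
    using assms[of i] L2_space_components[of "\<lambda>x. f x $ i"] by (simp add: inner_axis)
qed

lemma L2_space_nth: "f \<in> L2_space M \<Longrightarrow> (\<lambda>x. f x $ i) \<in> L2_space M"
  by (rule L2_space_bounded_linear[OF bounded_linear_vec_nth])

lemma L2_space_imp_integrable:
  assumes "finite_measure M" "f \<in> L2_space M"
  shows "integrable M f"
proof -
  interpret finite_measure M by fact
  have "norm (f x) \<le> norm (1 + (norm (f x))\<^sup>2)" for x
  proof -
    have "0 \<le> 1 + (norm (f x))\<^sup>2" by simp
    then show ?thesis
      using sum_squares_bound[of 1 "norm (f x)"] norm_ge_zero[of "f x"]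
      unfolding real_norm_def power_one by linarith
  qed
  then show ?thesis
    by (intro Bochner_Integration.integrable_bound[OF Bochner_Integration.integrable_add[OF
          integrable_const L2_space_integrable[OF assms(2)], of 1] L2_space_measurable[OF assms(2)]] AE_I2)
qed

section \<open>Smooth bump functions\<close>

text \<open>For \<open>p = 1\<close> this is the classical function exp(-1/t), smooth and flat at 0.
  Polynomial factors in 1/t are included so that the family is closed under differentiation.\<close>

definition exp_inv :: "real poly \<Rightarrow> real \<Rightarrow> real" where
  "exp_inv p t = (if 0 < t then poly p (1 / t) * exp (- (1 / t)) else 0)"

lemma tendsto_poly_exp_minus: "((\<lambda>s. poly p s * exp (- s)) \<longlongrightarrow> 0) (at_top :: real filter)"
proof -
  have "((\<lambda>s::real. \<Sum>i\<le>degree p. coeff p i * (s ^ i / exp s)) \<longlongrightarrow> (\<Sum>i\<le>degree p. coeff p i * 0)) at_top"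
    by (intro tendsto_sum tendsto_mult tendsto_const tendsto_power_div_exp_0)
  then show ?thesis
    by (simp add: poly_altdef sum_distrib_right exp_minus divide_inverse mult.assoc)
qed

text \<open>With s = 1/t one has ds/dt = -s^2, and differentiating p(s) exp(-s) gives s^2 (p(s) -
  p'(s)) exp(-s), again of the same form. At 0 the exponential decay beats the polynomial.\<close>

lemma exp_inv_deriv: "(exp_inv p has_real_derivative exp_inv (monom 1 2 * (p - pderiv p)) t) (at t)"
proof (cases t "0 :: real" rule: linorder_cases)
  case greater
  have "((\<lambda>t. poly p (1 / t) * exp (- (1 / t))) has_real_derivative
      poly (monom 1 2 * (p - pderiv p)) (1 / t) * exp (- (1 / t))) (at t)"
    using greater
    by (auto intro!: derivative_eq_intros DERIV_chain'[OF _ poly_DERIV]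
        simp: poly_monom field_simps power2_eq_square)
  moreover have "\<forall>\<^sub>F s in nhds t. exp_inv p s = poly p (1 / s) * exp (- (1 / s))"
    using eventually_nhds_in_open[of "{0<..}" t] greater
    by (auto elim!: eventually_mono simp: exp_inv_def)
  ultimately show ?thesis
    using greater by (subst DERIV_cong_ev[OF refl _ refl]) (auto simp: exp_inv_def)
next
  case less
  moreover have "\<forall>\<^sub>F s in nhds t. exp_inv p s = 0"
    using eventually_nhds_in_open[of "{..<0}" t] less
    by (auto elim!: eventually_mono simp: exp_inv_def)
  ultimately show ?thesis
    by (subst DERIV_cong_ev[OF refl _ refl, where g="\<lambda>_. 0"]) (auto simp: exp_inv_def)
next
  case equal
  have "((\<lambda>s. exp_inv p s / s) \<longlongrightarrow> 0) (at_right 0)"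
  proof -
    \<comment> \<open>\<open>pCons 0 p\<close> is \<open>p\<close> times the variable: dividing the
      function by \<open>s\<close> multiplies it by \<open>1 / s\<close>.\<close>
    have "((\<lambda>s. poly (pCons 0 p) (1 / s) * exp (- (1 / s))) \<longlongrightarrow> 0) (at_right 0)"
      using filterlim_compose[OF tendsto_poly_exp_minus filterlim_inverse_at_top_right, of "pCons 0 p"]
      by (simp add: inverse_eq_divide)
    then show ?thesis
      by (rule Lim_transform_eventually)
        (auto simp: exp_inv_def eventually_at_right_less intro!: eventually_mono[OF eventually_at_right_less])
  qed
  moreover have "((\<lambda>s. exp_inv p s / s) \<longlongrightarrow> 0) (at_left 0)"
    by (rule Lim_transform_eventually[OF tendsto_const[of 0]])
      (auto simp: exp_inv_def eventually_at_left_field intro!: exI[of _ "-1"])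
  ultimately have "((\<lambda>s. exp_inv p s / s) \<longlongrightarrow> 0) (at 0)"
    by (simp add: filterlim_split_at)
  then show ?thesis
    using equal by (simp add: DERIV_def exp_inv_def)
qed

section \<open>Calculus of functions of class \<open>Ck\<close>\<close>

lemma Ck_partial: "Ck (Suc m) f \<Longrightarrow> Ck m (partial i f)"
  by simp

lemma Ck_continuous: "Ck m f \<Longrightarrow> continuous_on UNIV f"
  by (cases m) (auto intro!: differentiable_imp_continuous_on simp: differentiable_on_def)

lemma Ck_Suc_imp: "Ck (Suc m) f \<Longrightarrow> Ck m f"
proof (induction m arbitrary: f)
  case 0
  show ?case using Ck_continuous[OF 0] by simp
next
  case (Suc m)
  then show ?case by auto
qed

lemma partial_eq:
  assumes "(f has_derivative f') (at x)"
  shows "partial i f x = f' (axis i 1)"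
  using frechet_derivative_at[OF assms] by (simp add: partial_def)

lemma Ck_add: "Ck m f \<Longrightarrow> Ck m g \<Longrightarrow> Ck m (\<lambda>x. f x + g x)"
proof (induction m arbitrary: f g)
  case 0
  then show ?case by (simp add: continuous_on_add)
next
  case (Suc m)
  have "partial i (\<lambda>x. f x + g x) = (\<lambda>x. partial i f x + partial i g x)" for i
  proof
    fix x
    have "((\<lambda>x. f x + g x) has_derivative
        (\<lambda>h. frechet_derivative f (at x) h + frechet_derivative g (at x) h)) (at x)"
      using Suc.prems by (intro has_derivative_add) (auto simp flip: frechet_derivative_works)
    from partial_eq[OF this] show "partial i (\<lambda>x. f x + g x) x = partial i f x + partial i g x"
      by (simp add: partial_def)
  qed
  then show ?case using Suc by auto
qed

lemma Ck_mult: "Ck m f \<Longrightarrow> Ck m g \<Longrightarrow> Ck m (\<lambda>x. f x * g x)"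
proof (induction m arbitrary: f g)
  case 0
  then show ?case by (simp add: continuous_on_mult)
next
  case (Suc m)
  have "partial i (\<lambda>x. f x * g x) = (\<lambda>x. f x * partial i g x + partial i f x * g x)" for i
  proof
    fix x
    have "((\<lambda>x. f x * g x) has_derivative
        (\<lambda>h. f x * frechet_derivative g (at x) h + frechet_derivative f (at x) h * g x)) (at x)"
      using Suc.prems by (intro has_derivative_mult) (auto simp flip: frechet_derivative_works)
    from partial_eq[OF this] show "partial i (\<lambda>x. f x * g x) x = f x * partial i g x + partial i f x * g x"
      by (simp add: partial_def)
  qed
  moreover have "Ck m (\<lambda>x. f x * partial i g x + partial i f x * g x)" for i
    using Suc.prems by (intro Ck_add Suc.IH Ck_Suc_imp[of m f] Ck_Suc_imp[of m g]) auto
  ultimately show ?case using Suc.prems by (auto intro!: differentiable_mult)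
qed

lemma Ck_const: "Ck m (\<lambda>x. c)"
proof (induction m arbitrary: c)
  case 0
  then show ?case by simp
next
  case (Suc m)
  have "partial i (\<lambda>x. c) = (\<lambda>x. 0)" for i :: "'a"
    using partial_eq[OF has_derivative_const] by auto
  then show ?case using Suc by simp
qed

lemma Ck_prod: "finite I \<Longrightarrow> (\<And>i. i \<in> I \<Longrightarrow> Ck m (f i)) \<Longrightarrow> Ck m (\<lambda>x. \<Prod>i\<in>I. f i x)"
  by (induction I rule: finite_induct) (auto intro: Ck_const Ck_mult)

text \<open>The polynomial varies in the induction, since every derivative replaces \<open>p\<close>
  by another one.\<close>

lemma Ck_exp_inv: "Ck m (\<lambda>x. exp_inv p (c * x $ i + d))"
proof (induction m arbitrary: p)
  case 0
  have "continuous_on UNIV (exp_inv p)"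
    by (rule DERIV_continuous_on[OF has_field_derivative_at_within[OF exp_inv_deriv]])
  moreover have "continuous_on UNIV (\<lambda>x :: real^'a. c * x $ i + d)"
    by (intro continuous_intros)
  ultimately have "continuous_on UNIV (\<lambda>x :: real^'a. exp_inv p (c * x $ i + d))"
    by (rule continuous_on_compose2) simp
  then show ?case by simp
next
  case (Suc m)
  let ?q = "monom 1 2 * (p - pderiv p)"
  have d: "((\<lambda>x. exp_inv p (c * x $ i + d)) has_derivative
       (\<lambda>h. exp_inv ?q (c * x $ i + d) * (c * h $ i))) (at x)" for x
  proof -
    have "((\<lambda>x. c * x $ i + d) has_derivative (\<lambda>h. c * h $ i)) (at x)"
      by (auto intro!: derivative_eq_intros bounded_linear_imp_has_derivative bounded_linear_vec_nth)
    from has_derivative_compose[OF this has_field_derivative_imp_has_derivative[OF exp_inv_deriv[of p]]]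
    show ?thesis by simp
  qed
  have "partial j (\<lambda>x. exp_inv p (c * x $ i + d))
      = (\<lambda>x. (c * axis j 1 $ i) * exp_inv ?q (c * x $ i + d))" for j
    using partial_eq[OF d] by (auto simp: mult_ac)
  moreover have "Ck m (\<lambda>x. (c * axis j 1 $ i) * exp_inv ?q (c * x $ i + d))" for j
    by (intro Ck_mult Ck_const Suc)
  ultimately show ?case
    using d by (auto simp: differentiable_def)
qed

text \<open>Here \<open>n\<close> measures steepness, not size: inside the box the factors are
  exp(-1/(n (x_i - a_i))) and exp(-1/(n (b_i - x_i))), so the support stays in one closed box while
  the values tend to 1 inside it. All values lie between 0 and 1, which suits dominated
  convergence.\<close>

definition bump :: "nat \<Rightarrow> real^'d \<Rightarrow> real^'d \<Rightarrow> real^'d \<Rightarrow> real" where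
  "bump n a b x = (\<Prod>i\<in>UNIV. exp_inv 1 (real n * x $ i + - (real n * a $ i))
     * exp_inv 1 (- real n * x $ i + real n * b $ i))"

lemma Ck_bump: "Ck m (bump n a b)"
  unfolding bump_def by (intro Ck_prod Ck_mult Ck_exp_inv) simp

lemma bump_zero: "x \<notin> box a b \<Longrightarrow> bump n a b x = 0"
proof -
  assume "x \<notin> box a b"
  then obtain i where i: "x $ i \<le> a $ i \<or> b $ i \<le> x $ i" by (auto simp: mem_box_cart not_less)
  then have "exp_inv 1 (real n * x $ i + - (real n * a $ i)) * exp_inv 1 (- real n * x $ i + real n * b $ i) = 0"
    by (auto simp: exp_inv_def not_less mult_left_mono zero_less_mult_iff simp flip: right_diff_distrib)
  then show ?thesis unfolding bump_def by (meson UNIV_I finite prod_zero)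
qed

lemma exp_inv_1: "exp_inv 1 t \<in> {0..1}"
  by (auto simp: exp_inv_def)

lemma bump_bounded: "\<bar>bump n a b x\<bar> \<le> 1"
proof -
  have "0 \<le> bump n a b x" "bump n a b x \<le> 1"
    unfolding bump_def using exp_inv_1
    by (auto intro!: prod_nonneg prod_le_1 mult_nonneg_nonneg mult_le_one)
  then show ?thesis by simp
qed

lemma exp_inv_1_limit: 
  assumes "0 < t" shows "(\<lambda>n. exp_inv 1 (real n * t)) \<longlonglongrightarrow> 1"
proof -
  have "(\<lambda>n. exp (- (inverse (real n) * (1 / t)))) \<longlonglongrightarrow> exp (- (0 * (1 / t)))"
    by (intro tendsto_intros lim_inverse_n)
  moreover have "\<forall>\<^sub>F n in sequentially. exp (- (inverse (real n) * (1 / t))) = exp_inv 1 (real n * t)"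
    using eventually_gt_at_top[of 0] by eventually_elim (use assms in \<open>auto simp: exp_inv_def field_simps\<close>)
  ultimately show ?thesis using Lim_transform_eventually by fastforce
qed

lemma bump_limit: "(\<lambda>n. bump n a b x) \<longlonglongrightarrow> indicat_real (box a b) x"
proof (cases "x \<in> box a b")
  case True
  then have i: "0 < x $ i - a $ i" "0 < b $ i - x $ i" for i by (auto simp: mem_box_cart)
  have "(\<lambda>n. bump n a b x) \<longlonglongrightarrow> (\<Prod>i\<in>(UNIV::'a set). 1 * 1)"
    unfolding bump_def
  proof (intro tendsto_prod tendsto_mult)
    fix i
    show "(\<lambda>n. exp_inv 1 (real n * x $ i + - (real n * a $ i))) \<longlonglongrightarrow> 1"
      using exp_inv_1_limit[OF i(1)] by (simp add: right_diff_distrib)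
    show "(\<lambda>n. exp_inv 1 (- real n * x $ i + real n * b $ i)) \<longlonglongrightarrow> 1"
      using exp_inv_1_limit[OF i(2)] by (simp add: right_diff_distrib add.commute)
  qed
  then show ?thesis using True by simp
next
  case False
  then show ?thesis by (simp add: bump_zero)
qed

lemma bump_test_function:
  assumes "cbox a b \<subseteq> \<Omega>"
  shows "bump n a b \<in> test_functions \<Omega>"
proof -
  have "{x. bump n a b x \<noteq> 0} \<subseteq> cbox a b" using bump_zero box_subset_cbox by fastforce
  then have s: "closure {x. bump n a b x \<noteq> 0} \<subseteq> cbox a b" by (intro closure_minimal closed_cbox)
  then have "compact (closure {x. bump n a b x \<noteq> 0})"
    by (meson bounded_cbox bounded_subset closed_closure compact_eq_bounded_closed)
  then show ?thesis using s assms Ck_bump unfolding test_functions_def by blast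
qed

section \<open>The fundamental lemma of the calculus of variations\<close>

text \<open>Dynkin's argument: the sets over which \<open>f\<close> integrates to zero are stable
  under complements and countable disjoint unions, and the boxes form an intersection-stable
  generator of the Borel sets. Vanishing integrals over all Borel sets identify \<open>f\<close>
  with the density 0.\<close>

lemma AE_zero_if_box_integrals_zero:
  fixes f :: "'a::euclidean_space \<Rightarrow> real"
  assumes f: "integrable lborel f" and box: "\<And>a b. (LINT x:box a b|lborel. f x) = 0"
  shows "AE x in lborel. f x = 0"
proof (rule density_unique_real[OF f integrable_zero])
  fix A :: "'a set" assume A: "A \<in> sets lborel"
  let ?G = "range (\<lambda>(a, b). box a b :: 'a set)"
  have borel: "sigma_sets UNIV ?G = sets borel"
    by (subst borel_eq_box) simp
  have int: "set_integrable lborel A f" if "A \<in> sets borel" for A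
    using f that unfolding set_integrable_def by (intro integrable_mult_indicator) auto
  \<comment> \<open>Stability under complements rests on the integral over the whole space, which is
    a limit over growing cubes.\<close>
  have univ: "(LINT x:UNIV|lborel. f x) = 0"
  proof -
    let ?B = "\<lambda>n::nat. box (- (real n *\<^sub>R One)) (real n *\<^sub>R One) :: 'a set"
    have "incseq ?B"
      unfolding incseq_def by (intro allI impI subset_box_imp) auto
    moreover have "(\<Union>n. ?B n) = UNIV" by (rule UN_box_eq_UNIV)
    ultimately have "(\<lambda>n. LINT x:?B n|lborel. f x) \<longlonglongrightarrow> (LINT x:UNIV|lborel. f x)"
      using set_integral_cont_up[of ?B lborel f] int[of UNIV] by simp
    then show ?thesis using box by (simp add: LIMSEQ_const_iff)
  qed
  have "Int_stable ?G"
    unfolding Int_stable_def by (auto simp: box_Int_box)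
  moreover have "?G \<subseteq> Pow UNIV" by simp
  moreover have "A \<in> sigma_sets UNIV ?G" using A borel by simp
  ultimately have "(LINT x:A|lborel. f x) = 0"
  proof (induction A rule: sigma_sets_induct_disjoint)
    case (basic A)
    then show ?case using box by auto
  next
    case empty
    then show ?case by (simp add: set_lebesgue_integral_def)
  next
    case (compl A)
    then have A: "A \<in> sets borel" using borel by simp
    have "(LINT x:A \<union> (UNIV - A)|lborel. f x) = (LINT x:A|lborel. f x) + (LINT x:UNIV - A|lborel. f x)"
      using A by (intro set_integral_Un int) auto
    then show ?case using univ compl by simp
  next
    case (union A)
    then have A: "A i \<in> sets borel" for i using borel by auto
    have "(LINT x:(\<Union>i. A i)|lborel. f x) = (\<Sum>i. LINT x:A i|lborel. f x)"
      using A union(1) by (intro lebesgue_integral_countable_add int) (auto simp: disjoint_family_on_def)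
    then show ?case using union by simp
  qed
  then show "(LINT x:A|lborel. f x) = (LINT x:A|lborel. 0)" by (simp add: set_lebesgue_integral_def)
qed

locale bounded_open =
  fixes \<Omega> :: "(real^'d) set"
  assumes open_Om: "open \<Omega>" and bounded_Om: "bounded \<Omega>"
begin

abbreviation "M \<equiv> lebesgue_on \<Omega>"

lemma sets_Om [simp]: "\<Omega> \<in> sets lebesgue"
  using open_Om by (simp add: sets_completionI_sets)

lemma finite_measure_M: "finite_measure M"
  by (rule finite_measure_lebesgue_on[OF bounded_set_imp_lmeasurable[OF bounded_Om sets_Om]])

lemma L2_integrable: "f \<in> L2_space M \<Longrightarrow> integrable M f"
  by (rule L2_space_imp_integrable[OF finite_measure_M])

lemma AE_M_iff: "(AE x in M. P x) \<longleftrightarrow> (AE x in lebesgue. x \<in> \<Omega> \<longrightarrow> P x)"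
  by (rule AE_restrict_space_iff) simp

lemma continuous_L2:
  fixes f :: "real^'d \<Rightarrow> 'b::euclidean_space"
  assumes "continuous_on (closure \<Omega>) f"
  shows "f \<in> L2_space M"
proof -
  have "bounded (f ` closure \<Omega>)"
    using assms bounded_Om by (intro compact_imp_bounded compact_continuous_image) (auto simp: compact_closure)
  then obtain B where B: "\<And>x. x \<in> closure \<Omega> \<Longrightarrow> norm (f x) \<le> B"
    unfolding bounded_iff by blast
  have "f \<in> borel_measurable M"
    by (rule continuous_imp_measurable_on_sets_lebesgue[OF continuous_on_subset[OF assms closure_subset] sets_Om])
  then show ?thesis
  proof (rule L2_space_bound)
    show "integrable M (\<lambda>x. B\<^sup>2)" by (rule finite_measure.integrable_const[OF finite_measure_M])
    show "AE x in M. (norm (f x))\<^sup>2 \<le> B\<^sup>2"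
      unfolding AE_M_iff using B closure_subset[of \<Omega>] by (intro AE_I2 impI power_mono) auto
  qed
qed

lemma test_function_L2:
  assumes "\<phi> \<in> test_functions \<Omega>" shows "\<phi> \<in> L2_space M" "partial i \<phi> \<in> L2_space M"
proof -
  have C: "Ck m \<phi>" for m using assms by (simp add: test_functions_def)
  have "continuous_on UNIV \<phi>" "continuous_on UNIV (partial i \<phi>)"
    using Ck_continuous[OF C[of 0]] Ck_continuous[OF Ck_partial[OF C[of 1, unfolded One_nat_def]]] by blast+
  then show "\<phi> \<in> L2_space M" "partial i \<phi> \<in> L2_space M"
    by (auto intro!: continuous_L2 continuous_on_subset[of UNIV])
qed

text \<open>Bumps converge boundedly to indicators of boxes, so \<open>g\<close> has integral zero
  over every open box whose closure lies in \<open>\<Omega>\<close>. Within one such closed box this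
  forces \<open>g\<close> to vanish almost everywhere, and countably many of them cover
  \<open>\<Omega>\<close>.\<close>

lemma fundamental_lemma:
  assumes g: "integrable M g" and test: "\<And>\<phi>. \<phi> \<in> test_functions \<Omega> \<Longrightarrow> (\<integral>x. g x * \<phi> x \<partial>M) = 0"
  shows "AE x in M. g x = 0"
proof -
  define G where "G x = indicator \<Omega> x * g x" for x
  have G: "integrable lebesgue G"
    using g by (simp add: integrable_restrict_space G_def[abs_def])
  have boxM: "(\<integral>x. indicat_real (box a b) x * G x \<partial>lebesgue) = 0" if ab: "cbox a b \<subseteq> \<Omega>" for a b
  proof -
    have meas: "bump n a b \<in> borel_measurable M" for n
      by (rule continuous_imp_measurable_on_sets_lebesgue[OF continuous_on_subset[OF Ck_continuous[OF Ck_bump[of 0 n a b]]]]) auto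
    have gm: "g \<in> borel_measurable M" using g by (rule borel_measurable_integrable)
    have "(\<lambda>n. \<integral>x. g x * bump n a b x \<partial>M) \<longlonglongrightarrow> (\<integral>x. g x * indicat_real (box a b) x \<partial>M)"
    proof (rule integral_dominated_convergence[where w="\<lambda>x. norm (g x)"])
      show "(\<lambda>x. g x * indicat_real (box a b) x) \<in> borel_measurable M"
        by (intro borel_measurable_times gm measurable_restrict_space1 borel_measurable_indicator) simp
      show "(\<lambda>x. g x * bump n a b x) \<in> borel_measurable M" for n
        using gm meas by (rule borel_measurable_times)
      show "AE x in M. (\<lambda>n. g x * bump n a b x) \<longlonglongrightarrow> g x * indicat_real (box a b) x"
        by (intro AE_I2 tendsto_mult tendsto_const bump_limit)
      show "AE x in M. norm (g x * bump n a b x) \<le> norm (g x)" for n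
        using bump_bounded[of n a b] by (intro AE_I2) (simp add: abs_mult mult_left_le)
    qed (use g in auto)
    moreover have "(\<integral>x. g x * bump n a b x \<partial>M) = 0" for n
      by (rule test[OF bump_test_function[OF ab]])
    ultimately have "(\<integral>x. g x * indicat_real (box a b) x \<partial>M) = 0"
      by (simp add: LIMSEQ_const_iff)
    then show ?thesis
      by (simp add: integral_restrict_space G_def mult_ac)
  qed
  have cell: "AE x in lebesgue. x \<in> cbox A B \<longrightarrow> G x = 0" if AB: "cbox A B \<subseteq> \<Omega>" for A B
  proof -
    \<comment> \<open>Cutting off to a fixed cell makes the integral over any box, even one that
      leaves \<open>\<Omega>\<close>, an integral over a box inside the cell.\<close>
    define F where "F x = indicat_real (box A B) x * G x" for x
    have F: "integrable lebesgue F"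
      using integrable_mult_indicator[OF _ G, of "box A B"] by (simp add: F_def[abs_def])
    \<comment> \<open>\<open>F\<close> is only Lebesgue measurable, whereas the generator argument
      is about Borel sets; a Borel function equal to \<open>F\<close> almost everywhere
      mediates.\<close>
    obtain F' where F': "F' \<in> borel_measurable lborel" "AE x in lborel. F x = F' x"
      using completion_ex_borel_measurable_real[OF borel_measurable_integrable[OF F]] by blast
    have ae: "AE x in lebesgue. F x = F' x" using F'(2) by (rule AE_completion)
    have F'm: "F' \<in> borel_measurable lebesgue" using F'(1) by (rule measurable_completion)
    have "integrable lebesgue F'"
      by (rule Bochner_Integration.integrable_cong_AE_imp[OF F F'm]) (use ae in auto)
    then have int: "integrable lborel F'" using integrable_completion[OF F'(1)] by simp
    have "AE x in lborel. F' x = 0"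
    proof (rule AE_zero_if_box_integrals_zero[OF int])
      fix a b :: "real^'d"
      obtain c d where cd: "box a b \<inter> box A B = box c d" "cbox a b \<inter> cbox A B = cbox c d"
        using box_Int_box[of a b A B] Int_interval[of a b A B] by blast
      have "(LINT x:box a b|lborel. F' x) = (\<integral>x. indicat_real (box a b) x * F' x \<partial>lebesgue)"
        using F'(1) by (subst integral_completion) (auto simp: set_lebesgue_integral_def)
      also have "\<dots> = (\<integral>x. indicat_real (box c d) x * G x \<partial>lebesgue)"
      proof (rule integral_cong_AE)
        show "(\<lambda>x. indicat_real (box a b) x * F' x) \<in> borel_measurable lebesgue"
          "(\<lambda>x. indicat_real (box c d) x * G x) \<in> borel_measurable lebesgue"
          using F'm borel_measurable_integrable[OF G]
          by (auto intro!: borel_measurable_times borel_measurable_indicator)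
        show "AE x in lebesgue. indicat_real (box a b) x * F' x = indicat_real (box c d) x * G x"
          using ae by eventually_elim (auto simp: F_def simp flip: cd(1) split: split_indicator)
      qed
      also have "\<dots> = 0" using cd AB by (intro boxM) auto
      finally show "(LINT x:box a b|lborel. F' x) = 0" .
    qed
    from AE_completion[OF this] ae have "AE x in lebesgue. F x = 0" by eventually_elim simp
    \<comment> \<open>\<open>F\<close> is cut off to the open box; the faces of the closed one form
      a null set.\<close>
    moreover have "AE x in lebesgue. x \<notin> cbox A B - box A B"
      using negligible_frontier_interval[of A B] by (intro AE_not_in) (simp add: negligible_iff_null_sets)
    ultimately show ?thesis by eventually_elim (auto simp: F_def)
  qed
  obtain \<D> where \<D>: "countable \<D>" "\<D> \<subseteq> Pow \<Omega>" "\<And>X. X \<in> \<D> \<Longrightarrow> \<exists>a b. X = cbox a b" "\<Union>\<D> = \<Omega>"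
    using open_countable_Union_open_cbox[OF open_Om] by blast
  have "AE x in lebesgue. \<forall>X\<in>\<D>. x \<in> X \<longrightarrow> G x = 0"
    unfolding AE_ball_countable[OF \<D>(1)] using \<D>(2,3) cell by blast
  then have "AE x in lebesgue. x \<in> \<Omega> \<longrightarrow> g x = 0"
  proof eventually_elim
    case (elim x)
    show ?case
    proof
      assume x: "x \<in> \<Omega>"
      then obtain X where "X \<in> \<D>" "x \<in> X" using \<D>(4) by blast
      then have "G x = 0" using elim by blast
      then show "g x = 0" using x by (simp add: G_def)
    qed
  qed
  then show ?thesis by (simp add: AE_M_iff)
qed

lemma L2_eq_if_test_integrals_eq:
  assumes "g \<in> L2_space M" "h \<in> L2_space M"
    and "\<And>\<phi>. \<phi> \<in> test_functions \<Omega> \<Longrightarrow> (\<integral>x. g x * \<phi> x \<partial>M) = (\<integral>x. h x * \<phi> x \<partial>M)"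
  shows "AE x in M. g x = h x"
proof -
  have "AE x in M. g x - h x = 0"
  proof (rule fundamental_lemma)
    show "integrable M (\<lambda>x. g x - h x)"
      by (intro Bochner_Integration.integrable_diff L2_integrable assms)
    fix \<phi> assume \<phi>: "\<phi> \<in> test_functions \<Omega>"
    show "(\<integral>x. (g x - h x) * \<phi> x \<partial>M) = 0"
      using L2_inner_integrable[OF assms(1) test_function_L2(1)[OF \<phi>]]
        L2_inner_integrable[OF assms(2) test_function_L2(1)[OF \<phi>]] assms(3)[OF \<phi>]
      by (simp add: left_diff_distrib)
  qed
  then show ?thesis by simp
qed

end

section \<open>Linear operators into square integrable functions\<close>

definition AE_null :: "'m measure \<Rightarrow> ('m \<Rightarrow> 'b::real_vector) set" where
  "AE_null M = {f. AE x in M. f x = 0}"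

lemma subspace_lincombI:
  assumes "0 \<in> S" "\<And>c x y. x \<in> S \<Longrightarrow> y \<in> S \<Longrightarrow> c *\<^sub>R x + y \<in> S"
  shows "subspace S"
proof (rule subspaceI)
  show "0 \<in> S" by fact
  show "x + y \<in> S" if "x \<in> S" "y \<in> S" for x y using assms(2)[OF that, of 1] by simp
  show "c *\<^sub>R x \<in> S" if "x \<in> S" for x c using assms(2)[OF that assms(1), of c] by simp
qed

lemma subspace_AE_null: "subspace (AE_null M)"
  by (rule subspace_lincombI) (auto simp: AE_null_def)

text \<open>
  Linearity is only required up to null sets, since weak derivatives are chosen representatives;
  \<open>N\<close> is the set of arguments that represent zero.
\<close>

definition L2_operator ::
    "'m measure \<Rightarrow> 'y::real_vector set \<Rightarrow> 'y set \<Rightarrow> ('y \<Rightarrow> 'm \<Rightarrow> 'b::euclidean_space) \<Rightarrow> bool" where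
  "L2_operator M N Y A \<longleftrightarrow>
     (\<forall>y\<in>Y. A y \<in> L2_space M) \<and>
     (\<forall>x\<in>Y. \<forall>y\<in>Y. \<forall>c. AE t in M. A (c *\<^sub>R x + y) t = c *\<^sub>R A x t + A y t) \<and>
     (\<forall>y\<in>Y. y \<in> N \<longrightarrow> (AE t in M. A y t = 0))"

lemma L2_operator_L2: "L2_operator M N Y A \<Longrightarrow> y \<in> Y \<Longrightarrow> A y \<in> L2_space M"
  and L2_operator_linear:
    "L2_operator M N Y A \<Longrightarrow> x \<in> Y \<Longrightarrow> y \<in> Y \<Longrightarrow> AE t in M. A (c *\<^sub>R x + y) t = c *\<^sub>R A x t + A y t"
  and L2_operator_null: "L2_operator M N Y A \<Longrightarrow> y \<in> Y \<Longrightarrow> y \<in> N \<Longrightarrow> AE t in M. A y t = 0"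
  by (simp_all add: L2_operator_def)

lemma L2_operator_id: "Y \<subseteq> L2_space M \<Longrightarrow> L2_operator M (AE_null M) Y (\<lambda>f. f)"
  by (auto simp: L2_operator_def AE_null_def)

text \<open>Transports an operator along a linear map, such as a projection of a product space or a
  component of a vector field, provided that representatives of zero are mapped to representatives
  of zero.\<close>

lemma L2_operator_compose:
  assumes "L2_operator M N Y A" "linear T" "T ` Z \<subseteq> Y" "T ` N' \<subseteq> N"
  shows "L2_operator M N' Z (\<lambda>z. A (T z))"
  using assms unfolding L2_operator_def
  by (auto simp: linear_add linear_scale image_subset_iff)

lemma L2_operator_bounded_linear:
  assumes A: "L2_operator M N Y A" and h: "bounded_linear h"
  shows "L2_operator M N Y (\<lambda>y t. h (A y t))"
proof -
  interpret bounded_linear h by (rule h)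
  show ?thesis
    unfolding L2_operator_def
  proof (intro conjI ballI allI impI)
    show "(\<lambda>t. h (A y t)) \<in> L2_space M" if "y \<in> Y" for y
      by (rule L2_space_bounded_linear[OF h L2_operator_L2[OF A that]])
    show "AE t in M. h (A (c *\<^sub>R x + y) t) = c *\<^sub>R h (A x t) + h (A y t)" if "x \<in> Y" "y \<in> Y" for x y c
      using L2_operator_linear[OF A that, where c=c] by eventually_elim (simp add: add scaleR)
    show "AE t in M. h (A y t) = 0" if "y \<in> Y" "y \<in> N" for y
      using L2_operator_null[OF A that] by eventually_elim (simp add: zero)
  qed
qed

lemma L2_operator_add:
  assumes A: "L2_operator M N Y A" and B: "L2_operator M N Y B"
  shows "L2_operator M N Y (\<lambda>y t. A y t + B y t)"
  unfolding L2_operator_def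
proof (intro conjI ballI allI impI)
  show "(\<lambda>t. A y t + B y t) \<in> L2_space M" if "y \<in> Y" for y
    using L2_operator_L2[OF A that] L2_operator_L2[OF B that] by (rule L2_space_add)
  show "AE t in M. A (c *\<^sub>R x + y) t + B (c *\<^sub>R x + y) t = c *\<^sub>R (A x t + B x t) + (A y t + B y t)"
    if "x \<in> Y" "y \<in> Y" for x y c
    using L2_operator_linear[OF A that, where c=c] L2_operator_linear[OF B that, where c=c]
    by eventually_elim (simp add: algebra_simps)
  show "AE t in M. A y t + B y t = 0" if "y \<in> Y" "y \<in> N" for y
    using L2_operator_null[OF A that] L2_operator_null[OF B that] by eventually_elim simp
qed

lemma L2_operator_diff:
  assumes "L2_operator M N Y A" "L2_operator M N Y B"
  shows "L2_operator M N Y (\<lambda>y t. A y t - B y t)"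
  using L2_operator_add[OF assms(1) L2_operator_bounded_linear[OF assms(2) bounded_linear_minus[OF bounded_linear_ident]]]
  by simp

lemma L2_operator_vec:
  fixes A :: "'n::finite \<Rightarrow> 'y::real_vector \<Rightarrow> 'm \<Rightarrow> 'b::euclidean_space"
  assumes A: "\<And>i. L2_operator M N Y (A i)"
  shows "L2_operator M N Y (\<lambda>y t. \<chi> i. A i y t)"
  unfolding L2_operator_def
proof (intro conjI ballI allI impI)
  show "(\<lambda>t. \<chi> i. A i y t) \<in> L2_space M" if "y \<in> Y" for y
    by (rule L2_space_vec) (simp add: L2_operator_L2[OF A that])
  show "AE t in M. (\<chi> i. A i (c *\<^sub>R x + y) t) = c *\<^sub>R (\<chi> i. A i x t) + (\<chi> i. A i y t)"
    if "x \<in> Y" "y \<in> Y" for x y c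
  proof -
    have "AE t in M. \<forall>i. A i (c *\<^sub>R x + y) t = c *\<^sub>R A i x t + A i y t"
      using L2_operator_linear[OF A that, where c=c] by (simp add: AE_all_countable)
    then show ?thesis by eventually_elim (simp add: vec_eq_iff)
  qed
  show "AE t in M. (\<chi> i. A i y t) = 0" if "y \<in> Y" "y \<in> N" for y
  proof -
    have "AE t in M. \<forall>i. A i y t = 0"
      using L2_operator_null[OF A that] by (simp add: AE_all_countable)
    then show ?thesis by eventually_elim (simp add: vec_eq_iff)
  qed
qed

text \<open>The norm of a matrix is the Frobenius norm, so Cauchy-Schwarz in each row
  suffices.\<close>

lemma norm_matrix_vector_mult_le:
  fixes A :: "real^'n^'m"
  shows "norm (A *v x) \<le> norm A * norm x"
proof -
  have "norm (A *v x) = L2_set (\<lambda>i. \<bar>A $ i \<bullet> x\<bar>) UNIV"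
    by (simp add: norm_vec_def matrix_vector_mul_component)
  also have "\<dots> \<le> L2_set (\<lambda>i. norm x * norm (A $ i)) UNIV"
    by (intro L2_set_mono) (auto simp: Cauchy_Schwarz_ineq2 mult.commute[of "norm x"])
  also have "\<dots> = norm x * norm A"
    by (simp add: L2_set_right_distrib norm_vec_def)
  finally show ?thesis by (simp add: mult.commute)
qed

lemma Linf_space_bounded:
  assumes "K \<in> Linf_space M"
  obtains C where "AE x in M. norm (K x) \<le> C"
proof -
  have "Linf_norm M K < \<infinity>" using assms by (simp add: Linf_space_def)
  then obtain C :: real where "Linf_norm M K \<le> ereal C"
    using less_PInf_Ex_of_nat[of "Linf_norm M K"] less_imp_le by auto
  moreover have "AE x in M. ereal (norm (K x)) \<le> Linf_norm M K"
    unfolding Linf_norm_def by (rule esssup_AE)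
  ultimately have "AE x in M. norm (K x) \<le> C"
    by (auto elim!: eventually_mono dest: order_trans)
  then show ?thesis by (rule that)
qed

lemma L2_space_matrix_mult:
  fixes K :: "'m \<Rightarrow> real^'n^'k"
  assumes K: "K \<in> Linf_space M" and f: "f \<in> L2_space M"
  shows "(\<lambda>x. K x *v f x) \<in> L2_space M"
proof -
  obtain C where C: "AE x in M. norm (K x) \<le> C" by (rule Linf_space_bounded[OF K])
  have [measurable]: "K \<in> borel_measurable M" "f \<in> borel_measurable M"
    using K f by (simp_all add: Linf_space_def L2_space_measurable)
  have "(\<lambda>x. K x *v f x) \<in> borel_measurable M"
  proof (rule borel_measurable_continuous_Pair[where H="\<lambda>A v. A *v v"])
    show "continuous_on UNIV (\<lambda>x::(real^'n^'k) \<times> (real^'n). fst x *v snd x)"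
      unfolding matrix_vector_mult_def
      by (intro continuous_on_vec_lambda continuous_intros)
  qed measurable
  then show ?thesis
  proof (rule L2_space_dominated[OF _ f])
    show "AE x in M. norm (K x *v f x) \<le> C * norm (f x)"
      using C
    proof eventually_elim
      case (elim x)
      then show ?case
        using norm_matrix_vector_mult_le[of "K x" "f x"] mult_right_mono[OF elim norm_ge_zero[of "f x"]] by linarith
    qed
  qed
qed

lemma L2_operator_matrix_mult:
  fixes K :: "'m \<Rightarrow> real^'n^'k"
  assumes A: "L2_operator M N Y A" and K: "K \<in> Linf_space M"
  shows "L2_operator M N Y (\<lambda>y x. K x *v A y x)"
  unfolding L2_operator_def
proof (intro conjI ballI allI impI)
  show "(\<lambda>x. K x *v A y x) \<in> L2_space M" if "y \<in> Y" for y
    by (rule L2_space_matrix_mult[OF K L2_operator_L2[OF A that]])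
  show "AE t in M. K t *v A (c *\<^sub>R x + y) t = c *\<^sub>R (K t *v A x t) + K t *v A y t"
    if "x \<in> Y" "y \<in> Y" for x y c
    using L2_operator_linear[OF A that, where c=c]
    by eventually_elim (simp add: matrix_vector_right_distrib matrix_vector_mult_scaleR)
  show "AE t in M. K t *v A y t = 0" if "y \<in> Y" "y \<in> N" for y
    using L2_operator_null[OF A that] by eventually_elim simp
qed

lemma bilinear_on_add: "bilinear_on Y B \<Longrightarrow> bilinear_on Y C \<Longrightarrow> bilinear_on Y (\<lambda>x y. B x y + C x y)"
  and bilinear_on_scale: "bilinear_on Y B \<Longrightarrow> bilinear_on Y (\<lambda>x y. k * B x y)"
  and bilinear_on_subset: "bilinear_on Y B \<Longrightarrow> Z \<subseteq> Y \<Longrightarrow> bilinear_on Z B"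
  by (auto simp: bilinear_on_def algebra_simps)

lemma bilinear_onD:
  assumes "bilinear_on Z B" "x \<in> Z" "y \<in> Z" "z \<in> Z"
  shows "B (c *\<^sub>R x + y) z = c * B x z + B y z" "B z (c *\<^sub>R x + y) = c * B z x + B z y"
  using assms by (simp_all add: bilinear_on_def)

lemma bilinear_L2: "bilinear_on (L2_space M) (L2_inner M)"
  using semi_inner_L2[of M] unfolding semi_inner_on_def by blast

text \<open>The integral does not see null sets: linearity of the operators almost everywhere
  becomes exact bilinearity of the form.\<close>

lemma L2_operator_inner_bilinear:
  assumes Y: "subspace Y" and A: "L2_operator M N Y A" and B: "L2_operator M N Y B"
  shows "bilinear_on Y (\<lambda>x y. L2_inner M (A x) (B y))"
  unfolding bilinear_on_def
proof (intro ballI allI conjI)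
  fix x y z c assume xyz: "x \<in> Y" "y \<in> Y" "z \<in> Y"
  have cxy: "c *\<^sub>R x + y \<in> Y" using Y xyz by (simp add: subspace_add subspace_scale)
  note A2 = L2_operator_L2[OF A] and B2 = L2_operator_L2[OF B]
  have comb: "c *\<^sub>R A x + A y \<in> L2_space M" "c *\<^sub>R B x + B y \<in> L2_space M"
    using A2[OF xyz(1)] A2[OF xyz(2)] B2[OF xyz(1)] B2[OF xyz(2)]
    by (auto intro!: subspace_add[OF subspace_L2] subspace_scale[OF subspace_L2])
  have "L2_inner M (A (c *\<^sub>R x + y)) (B z) = L2_inner M (c *\<^sub>R A x + A y) (B z)"
    using L2_operator_linear[OF A xyz(1,2)] by (intro L2_inner_cong_AE A2[OF cxy] B2[OF xyz(3)] comb) auto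
  also have "\<dots> = c * L2_inner M (A x) (B z) + L2_inner M (A y) (B z)"
    by (intro bilinear_onD(1)[OF bilinear_L2] A2 B2 xyz)
  finally show "L2_inner M (A (c *\<^sub>R x + y)) (B z) = c * L2_inner M (A x) (B z) + L2_inner M (A y) (B z)" .
  have "L2_inner M (A z) (B (c *\<^sub>R x + y)) = L2_inner M (A z) (c *\<^sub>R B x + B y)"
    using L2_operator_linear[OF B xyz(1,2)] by (intro L2_inner_cong_AE A2[OF xyz(3)] B2[OF cxy] comb) auto
  also have "\<dots> = c * L2_inner M (A z) (B x) + L2_inner M (A z) (B y)"
    by (intro bilinear_onD(2)[OF bilinear_L2] A2 B2 xyz)
  finally show "L2_inner M (A z) (B (c *\<^sub>R x + y)) = c * L2_inner M (A z) (B x) + L2_inner M (A z) (B y)" .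
qed

lemma L2_inner_null:
  assumes "AE x in M. f x = 0 \<or> g x = 0"
  shows "L2_inner M f g = 0"
  unfolding L2_inner_def by (rule integral_eq_zero_AE) (use assms in \<open>auto elim: eventually_mono\<close>)

lemma L2_operator_inner_null:
  assumes "L2_operator M N Y A" "L2_operator M N Y B" "x \<in> Y" "y \<in> Y" "x \<in> N \<or> y \<in> N"
  shows "L2_inner M (A x) (B y) = 0"
  using assms(5) L2_operator_null[OF assms(1,3)] L2_operator_null[OF assms(2,4)]
  by (intro L2_inner_null) (auto elim: eventually_mono)

lemma lincomb_L2: "f \<in> L2_space M \<Longrightarrow> g \<in> L2_space M \<Longrightarrow> c *\<^sub>R f + g \<in> L2_space M"
  by (intro subspace_add[OF subspace_L2] subspace_scale[OF subspace_L2])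

section \<open>Weak derivatives and Sobolev spaces\<close>

text \<open>Covers the weak gradient and the weak divergence at once: \<open>R\<close> is the
  defining integral identity and \<open>D\<close> a chosen solution of it. Uniqueness up to null
  sets makes an arbitrary choice linear almost everywhere, because the combination of chosen
  derivatives is also a derivative of the combination.\<close>

lemma weak_derivative_operator:
  fixes M :: "'m measure" and R :: "('m \<Rightarrow> 'b::euclidean_space) \<Rightarrow> ('m \<Rightarrow> 'c::euclidean_space) \<Rightarrow> bool"
  defines "S \<equiv> {f \<in> L2_space M. \<exists>G\<in>L2_space M. R f G}"
  defines "D \<equiv> \<lambda>f. SOME G. G \<in> L2_space M \<and> R f G"
  assumes lincomb: "\<And>f g G H c. f \<in> L2_space M \<Longrightarrow> g \<in> L2_space M \<Longrightarrow> G \<in> L2_space M \<Longrightarrow> H \<in> L2_space M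
      \<Longrightarrow> R f G \<Longrightarrow> R g H \<Longrightarrow> R (c *\<^sub>R f + g) (c *\<^sub>R G + H)"
    and null: "\<And>f. f \<in> AE_null M \<Longrightarrow> R f 0"
    and unique: "\<And>f G H. G \<in> L2_space M \<Longrightarrow> H \<in> L2_space M \<Longrightarrow> R f G \<Longrightarrow> R f H \<Longrightarrow> AE x in M. G x = H x"
  shows "subspace S" "L2_operator M (AE_null M) S D"
proof -
  note L2_0 = subspace_0[OF subspace_L2]
  have D: "f \<in> L2_space M" "D f \<in> L2_space M" "R f (D f)" if "f \<in> S" for f
  proof -
    show "f \<in> L2_space M" using that by (simp add: S_def)
    have "\<exists>G. G \<in> L2_space M \<and> R f G" using that by (auto simp: S_def)
    from someI_ex[OF this] show "D f \<in> L2_space M" "R f (D f)" by (simp_all add: D_def)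
  qed
  have S: "c *\<^sub>R f + g \<in> S" if "f \<in> S" "g \<in> S" for f g c
    unfolding S_def by (intro CollectI conjI bexI[of _ "c *\<^sub>R D f + D g"] lincomb lincomb_L2 D that)
  have "0 \<in> S"
    unfolding S_def by (intro CollectI conjI bexI[of _ 0] null[OF subspace_0[OF subspace_AE_null]] L2_0)
  then show "subspace S" by (rule subspace_lincombI) (rule S)
  show "L2_operator M (AE_null M) S D"
    unfolding L2_operator_def
  proof (intro conjI ballI allI impI)
    show "D f \<in> L2_space M" if "f \<in> S" for f using that by (rule D)
    show "AE t in M. D (c *\<^sub>R f + g) t = c *\<^sub>R D f t + D g t" if fg: "f \<in> S" "g \<in> S" for f g c
      using unique[OF D(2)[OF S[OF fg]] lincomb_L2[OF D(2)[OF fg(1)] D(2)[OF fg(2)]] D(3)[OF S[OF fg]]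
        lincomb[OF D(1)[OF fg(1)] D(1)[OF fg(2)] D(2)[OF fg(1)] D(2)[OF fg(2)] D(3)[OF fg(1)] D(3)[OF fg(2)]]]
      by simp
    show "AE t in M. D f t = 0" if "f \<in> S" "f \<in> AE_null M" for f
      using unique[OF D(2)[OF that(1)] L2_0 D(3)[OF that(1)] null[OF that(2)]] by simp
  qed
qed

context bounded_open
begin

lemma integrable_test_partial:
  "q \<in> L2_space M \<Longrightarrow> \<phi> \<in> test_functions \<Omega> \<Longrightarrow> integrable M (\<lambda>x. q x * partial i \<phi> x)"
  using L2_inner_integrable[of q M "partial i \<phi>"] test_function_L2(2) by simp

lemma integrable_test:
  "q \<in> L2_space M \<Longrightarrow> \<phi> \<in> test_functions \<Omega> \<Longrightarrow> integrable M (\<lambda>x. q x * \<phi> x)"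
  using L2_inner_integrable[of q M \<phi>] test_function_L2(1) by simp

lemma integrable_test_div:
  "\<tau> \<in> L2_space M \<Longrightarrow> \<phi> \<in> test_functions \<Omega> \<Longrightarrow>
     integrable M (\<lambda>x. \<Sum>j\<in>UNIV. \<tau> x $ i $ j * partial j \<phi> x)"
  by (intro Bochner_Integration.integrable_sum integrable_test_partial L2_space_nth)

lemma L2_vector_eq_if_test_integrals_eq:
  fixes G H :: "'d vect"
  assumes "G \<in> L2_space M" "H \<in> L2_space M"
    and eq: "\<And>\<phi> i. \<phi> \<in> test_functions \<Omega> \<Longrightarrow> (\<integral>x. G x $ i * \<phi> x \<partial>M) = (\<integral>x. H x $ i * \<phi> x \<partial>M)"
  shows "AE x in M. G x = H x"
proof -
  have "AE x in M. G x $ i = H x $ i" for i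
    by (rule L2_eq_if_test_integrals_eq[OF L2_space_nth[OF assms(1)] L2_space_nth[OF assms(2)] eq])
  then have "AE x in M. \<forall>i. G x $ i = H x $ i" by (simp add: AE_all_countable)
  then show ?thesis by eventually_elim (simp add: vec_eq_iff)
qed

lemma is_weak_grad_lincomb:
  assumes "q \<in> L2_space M" "q' \<in> L2_space M" "G \<in> L2_space M" "G' \<in> L2_space M"
    and "is_weak_grad \<Omega> q G" "is_weak_grad \<Omega> q' G'"
  shows "is_weak_grad \<Omega> (c *\<^sub>R q + q') (c *\<^sub>R G + G')"
  unfolding is_weak_grad_def
proof (intro ballI allI)
  fix \<phi> i assume \<phi>: "\<phi> \<in> test_functions \<Omega>"
  have "(\<integral>x. (c *\<^sub>R q + q') x * partial i \<phi> x \<partial>M)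
      = c * (\<integral>x. q x * partial i \<phi> x \<partial>M) + (\<integral>x. q' x * partial i \<phi> x \<partial>M)"
    using integrable_test_partial[OF assms(1) \<phi>] integrable_test_partial[OF assms(2) \<phi>]
    by (simp add: distrib_right mult.assoc)
  also have "\<dots> = - (\<integral>x. (c *\<^sub>R G + G') x $ i * \<phi> x \<partial>M)"
    using integrable_test[OF L2_space_nth[OF assms(3)] \<phi>] integrable_test[OF L2_space_nth[OF assms(4)] \<phi>]
      assms(5,6) \<phi> by (simp add: is_weak_grad_def distrib_right mult.assoc)
  finally show "(\<integral>x. (c *\<^sub>R q + q') x * partial i \<phi> x \<partial>M) = - (\<integral>x. (c *\<^sub>R G + G') x $ i * \<phi> x \<partial>M)" .
qed

lemma is_weak_div_lincomb:
  assumes "\<tau> \<in> L2_space M" "\<tau>' \<in> L2_space M" "D \<in> L2_space M" "D' \<in> L2_space M"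
    and "is_weak_div \<Omega> \<tau> D" "is_weak_div \<Omega> \<tau>' D'"
  shows "is_weak_div \<Omega> (c *\<^sub>R \<tau> + \<tau>') (c *\<^sub>R D + D')"
  unfolding is_weak_div_def
proof (intro ballI allI)
  fix \<phi> i assume \<phi>: "\<phi> \<in> test_functions \<Omega>"
  have "(\<integral>x. (\<Sum>j\<in>UNIV. (c *\<^sub>R \<tau> + \<tau>') x $ i $ j * partial j \<phi> x) \<partial>M)
      = (\<integral>x. c * (\<Sum>j\<in>UNIV. \<tau> x $ i $ j * partial j \<phi> x) + (\<Sum>j\<in>UNIV. \<tau>' x $ i $ j * partial j \<phi> x) \<partial>M)"
    by (intro Bochner_Integration.integral_cong) (simp_all add: distrib_right mult.assoc sum.distrib sum_distrib_left)
  also have "\<dots> = c * (\<integral>x. (\<Sum>j\<in>UNIV. \<tau> x $ i $ j * partial j \<phi> x) \<partial>M)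
      + (\<integral>x. (\<Sum>j\<in>UNIV. \<tau>' x $ i $ j * partial j \<phi> x) \<partial>M)"
    using integrable_test_div[OF assms(1) \<phi>] integrable_test_div[OF assms(2) \<phi>] by simp
  also have "\<dots> = - (\<integral>x. (c *\<^sub>R D + D') x $ i * \<phi> x \<partial>M)"
    using integrable_test[OF L2_space_nth[OF assms(3)] \<phi>] integrable_test[OF L2_space_nth[OF assms(4)] \<phi>]
      assms(5,6) \<phi> by (simp add: is_weak_div_def distrib_right mult.assoc)
  finally show "(\<integral>x. (\<Sum>j\<in>UNIV. (c *\<^sub>R \<tau> + \<tau>') x $ i $ j * partial j \<phi> x) \<partial>M)
      = - (\<integral>x. (c *\<^sub>R D + D') x $ i * \<phi> x \<partial>M)" .
qed

lemma is_weak_grad_null: "q \<in> AE_null M \<Longrightarrow> is_weak_grad \<Omega> q 0"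
  unfolding is_weak_grad_def AE_null_def
  by (auto intro!: integral_eq_zero_AE elim: eventually_mono)

lemma is_weak_div_null: 
  assumes "\<tau> \<in> AE_null M" shows "is_weak_div \<Omega> \<tau> 0"
  unfolding is_weak_div_def
proof (intro ballI allI)
  fix \<phi> i
  have "AE x in M. (\<Sum>j\<in>UNIV. \<tau> x $ i $ j * partial j \<phi> x) = 0"
    using assms unfolding AE_null_def by (auto elim: eventually_mono)
  from integral_eq_zero_AE[OF this]
  show "(\<integral>x. (\<Sum>j\<in>UNIV. \<tau> x $ i $ j * partial j \<phi> x) \<partial>M) = - (\<integral>x. 0 x $ i * \<phi> x \<partial>M)" by simp
qed

lemma H1_L2: "H1 \<Omega> \<subseteq> L2_space M"
  by (auto simp: H1_def)

lemma Hdiv_L2: "Hdiv \<Omega> \<subseteq> L2_space M"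
  by (auto simp: Hdiv_def)

lemma subspace_H1: "subspace (H1 \<Omega>)"
  and L2_operator_wgrad: "L2_operator M (AE_null M) (H1 \<Omega>) (wgrad \<Omega>)"
proof -
  have unique: "AE x in M. G x = H x"
    if "G \<in> L2_space M" "H \<in> L2_space M" "is_weak_grad \<Omega> f G" "is_weak_grad \<Omega> f H" for f G H
  proof (rule L2_vector_eq_if_test_integrals_eq[OF that(1,2)])
    fix \<phi> i assume \<phi>: "\<phi> \<in> test_functions \<Omega>"
    note eq = bspec[OF _ \<phi>, THEN spec, of _ i]
    have "- (\<integral>x. G x $ i * \<phi> x \<partial>M) = - (\<integral>x. H x $ i * \<phi> x \<partial>M)"
      by (rule trans[OF eq[OF that(3)[unfolded is_weak_grad_def], symmetric] eq[OF that(4)[unfolded is_weak_grad_def]]])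
    then show "(\<integral>x. G x $ i * \<phi> x \<partial>M) = (\<integral>x. H x $ i * \<phi> x \<partial>M)" by simp
  qed
  note operator = weak_derivative_operator[OF is_weak_grad_lincomb is_weak_grad_null unique]
  show "subspace (H1 \<Omega>)" unfolding H1_def by (rule operator(1))
  show "L2_operator M (AE_null M) (H1 \<Omega>) (wgrad \<Omega>)"
    unfolding H1_def wgrad_def[abs_def] by (rule operator(2))
qed

lemma subspace_Hdiv: "subspace (Hdiv \<Omega>)"
  and L2_operator_wdiv: "L2_operator M (AE_null M) (Hdiv \<Omega>) (wdiv \<Omega>)"
proof -
  have unique: "AE x in M. G x = H x"
    if "G \<in> L2_space M" "H \<in> L2_space M" "is_weak_div \<Omega> f G" "is_weak_div \<Omega> f H" for f G H
  proof (rule L2_vector_eq_if_test_integrals_eq[OF that(1,2)])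
    fix \<phi> i assume \<phi>: "\<phi> \<in> test_functions \<Omega>"
    note eq = bspec[OF _ \<phi>, THEN spec, of _ i]
    have "- (\<integral>x. G x $ i * \<phi> x \<partial>M) = - (\<integral>x. H x $ i * \<phi> x \<partial>M)"
      by (rule trans[OF eq[OF that(3)[unfolded is_weak_div_def], symmetric] eq[OF that(4)[unfolded is_weak_div_def]]])
    then show "(\<integral>x. G x $ i * \<phi> x \<partial>M) = (\<integral>x. H x $ i * \<phi> x \<partial>M)" by simp
  qed
  note operator = weak_derivative_operator[OF is_weak_div_lincomb is_weak_div_null unique]
  show "subspace (Hdiv \<Omega>)" unfolding Hdiv_def by (rule operator(1))
  show "L2_operator M (AE_null M) (Hdiv \<Omega>) (wdiv \<Omega>)"
    unfolding Hdiv_def wdiv_def[abs_def] by (rule operator(2))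
qed

lemma linear_component: "linear (\<lambda>(v :: 'a \<Rightarrow> 'b::real_vector^'n) y. v y $ i)"
  by (rule linearI) (simp_all add: fun_eq_iff)

lemma subspace_H1v: "subspace (H1v \<Omega>)"
proof -
  have "H1v \<Omega> = (\<Inter>i. (\<lambda>v y. v y $ i) -` H1 \<Omega>)" by (auto simp: H1v_def)
  then show ?thesis
    using subspace_H1 linear_component by (auto intro!: subspace_Inter linear_subspace_vimage)
qed

lemma H1v_L2: "H1v \<Omega> \<subseteq> L2_space M"
  using H1_L2 by (auto simp: H1v_def intro!: L2_space_vec)

lemma L2_operator_wgradv: "L2_operator M (AE_null M) (H1v \<Omega>) (wgradv \<Omega>)"
proof -
  have "L2_operator M (AE_null M) (H1v \<Omega>) (\<lambda>v. wgrad \<Omega> (\<lambda>y. v y $ i))" for i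
    by (rule L2_operator_compose[OF L2_operator_wgrad linear_component])
      (auto simp: H1v_def AE_null_def elim: eventually_mono)
  from L2_operator_vec[OF this] show ?thesis by (simp add: wgradv_def[abs_def])
qed

lemma integrable_ball:
  fixes f :: "real^'d \<Rightarrow> 'b::euclidean_space"
  assumes "integrable M f" shows "integrable (lebesgue_on (\<Omega> \<inter> ball x r)) f"
proof -
  have "integrable lebesgue (\<lambda>y. indicat_real \<Omega> y *\<^sub>R f y)"
    using assms by (simp add: integrable_restrict_space)
  from integrable_mult_indicator[OF _ this, of "ball x r"] show ?thesis
    by (simp add: integrable_restrict_space sets.Int indicator_inter_arith mult.commute)
qed

lemma boundary_average_lincomb:
  assumes "f \<in> L2_space M" "g \<in> L2_space M"
  shows "boundary_average \<Omega> (c *\<^sub>R f + g) x r = c *\<^sub>R boundary_average \<Omega> f x r + boundary_average \<Omega> g x r"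
  using integrable_ball[OF L2_integrable[OF assms(1)], of x r] integrable_ball[OF L2_integrable[OF assms(2)], of x r]
  by (simp add: boundary_average_def scaleR_add_right)

lemma vanishes_on_lincomb:
  assumes "v \<in> L2_space M" "w \<in> L2_space M" "vanishes_on \<Omega> \<Gamma> v" "vanishes_on \<Omega> \<Gamma> w"
  shows "vanishes_on \<Omega> \<Gamma> (c *\<^sub>R v + w)"
  using assms(3,4) unfolding vanishes_on_def
proof eventually_elim
  case (elim x)
  show ?case
  proof
    assume "x \<in> \<Gamma>"
    with elim have "((\<lambda>r. c *\<^sub>R boundary_average \<Omega> v x r + boundary_average \<Omega> w x r) \<longlongrightarrow> c *\<^sub>R 0 + 0) (at_right 0)"
      by (intro tendsto_intros) auto
    then show "(boundary_average \<Omega> (c *\<^sub>R v + w) x \<longlongrightarrow> 0) (at_right 0)"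
      by (simp add: boundary_average_lincomb[OF assms(1,2), abs_def])
  qed
qed

lemma subspace_H1D: "subspace (H1D \<Omega> \<Gamma>D)"
proof (rule subspace_lincombI)
  have "boundary_average \<Omega> 0 x = (\<lambda>_. 0 :: real^'d)" for x by (simp add: boundary_average_def fun_eq_iff)
  then show "0 \<in> H1D \<Omega> \<Gamma>D" using subspace_0[OF subspace_H1v] by (simp add: H1D_def vanishes_on_def)
  show "c *\<^sub>R v + w \<in> H1D \<Omega> \<Gamma>D" if "v \<in> H1D \<Omega> \<Gamma>D" "w \<in> H1D \<Omega> \<Gamma>D" for c v w
    using that H1v_L2 unfolding H1D_def
    by (auto intro!: vanishes_on_lincomb subspace_add[OF subspace_H1v] subspace_scale[OF subspace_H1v])
qed

lemma H1D_H1v: "H1D \<Omega> \<Gamma>D \<subseteq> H1v \<Omega>"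
  by (auto simp: H1D_def)

lemma HdivN_Hdiv: "HdivN \<Omega> \<Gamma>D \<subseteq> Hdiv \<Omega>"
  by (auto simp: HdivN_def)

lemma L2_operator_left_linear:
  assumes Y: "subspace Y" and A: "L2_operator M N Y A" and w: "w \<in> L2_space M"
  shows "linear_functional_on Y (\<lambda>x. L2_inner M (A x) w)"
  unfolding linear_functional_on_def
proof (intro ballI allI)
  fix x y c assume xy: "x \<in> Y" "y \<in> Y"
  have cxy: "c *\<^sub>R x + y \<in> Y" using Y xy by (simp add: subspace_add subspace_scale)
  note A2 = L2_operator_L2[OF A]
  have "L2_inner M (A (c *\<^sub>R x + y)) w = L2_inner M (c *\<^sub>R A x + A y) w"
    using L2_operator_linear[OF A xy] by (intro L2_inner_cong_AE A2[OF cxy] w lincomb_L2 A2[OF xy(1)] A2[OF xy(2)]) auto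
  also have "\<dots> = c * L2_inner M (A x) w + L2_inner M (A y) w"
    by (intro bilinear_onD(1)[OF bilinear_L2] A2 xy w)
  finally show "L2_inner M (A (c *\<^sub>R x + y)) w = c * L2_inner M (A x) w + L2_inner M (A y) w" .
qed

text \<open>The vanishing normal trace is a family of equations in the tensor, one for each
  \<open>w\<close>; their left-hand sides are linear because \<open>wdiv\<close> is linear up to
  null sets.\<close>

lemma subspace_HdivN: "subspace (HdivN \<Omega> \<Gamma>D)"
proof (rule subspace_lincombI)
  have lin: "linear_functional_on (Hdiv \<Omega>) (\<lambda>\<tau>. L2_inner M \<tau> (wgradv \<Omega> w))"
    "linear_functional_on (Hdiv \<Omega>) (\<lambda>\<tau>. L2_inner M (wdiv \<Omega> \<tau>) w)" if "w \<in> H1D \<Omega> \<Gamma>D" for w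
  proof -
    have w: "w \<in> H1v \<Omega>" using that H1D_H1v by blast
    show "linear_functional_on (Hdiv \<Omega>) (\<lambda>\<tau>. L2_inner M \<tau> (wgradv \<Omega> w))"
      by (rule L2_operator_left_linear[OF subspace_Hdiv L2_operator_id[OF Hdiv_L2]
            L2_operator_L2[OF L2_operator_wgradv w]])
    show "linear_functional_on (Hdiv \<Omega>) (\<lambda>\<tau>. L2_inner M (wdiv \<Omega> \<tau>) w)"
      by (rule L2_operator_left_linear[OF subspace_Hdiv L2_operator_wdiv subsetD[OF H1v_L2 w]])
  qed
  show "0 \<in> HdivN \<Omega> \<Gamma>D"
    using subspace_0[OF subspace_Hdiv] linear_functional_onD(1)[OF lin(1) subspace_Hdiv]
      linear_functional_onD(1)[OF lin(2) subspace_Hdiv] by (auto simp: HdivN_def)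
  show "c *\<^sub>R \<sigma> + \<tau> \<in> HdivN \<Omega> \<Gamma>D" if st: "\<sigma> \<in> HdivN \<Omega> \<Gamma>D" "\<tau> \<in> HdivN \<Omega> \<Gamma>D" for c \<sigma> \<tau>
  proof -
    have H: "\<sigma> \<in> Hdiv \<Omega>" "\<tau> \<in> Hdiv \<Omega>" using st HdivN_Hdiv by auto
    have "L2_inner M (c *\<^sub>R \<sigma> + \<tau>) (wgradv \<Omega> w) + L2_inner M (wdiv \<Omega> (c *\<^sub>R \<sigma> + \<tau>)) w = 0"
      if w: "w \<in> H1D \<Omega> \<Gamma>D" for w
    proof -
      have "L2_inner M (c *\<^sub>R \<sigma> + \<tau>) (wgradv \<Omega> w) + L2_inner M (wdiv \<Omega> (c *\<^sub>R \<sigma> + \<tau>)) w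
        = c * (L2_inner M \<sigma> (wgradv \<Omega> w) + L2_inner M (wdiv \<Omega> \<sigma>) w)
          + (L2_inner M \<tau> (wgradv \<Omega> w) + L2_inner M (wdiv \<Omega> \<tau>) w)"
        using lin[OF w] H unfolding linear_functional_on_def by (simp add: algebra_simps)
      then show ?thesis using st w by (simp add: HdivN_def)
    qed
    moreover have "c *\<^sub>R \<sigma> + \<tau> \<in> Hdiv \<Omega>"
      using H by (intro subspace_add[OF subspace_Hdiv] subspace_scale[OF subspace_Hdiv])
    ultimately show ?thesis by (simp add: HdivN_def)
  qed
qed

lemma subspace_H_space: "subspace (H_space \<Omega> \<Gamma>D)"
  unfolding H_space_def by (intro subspace_Times subspace_HdivN subspace_H1D subspace_H1)

end

section \<open>Traces of continuous functions\<close>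

context bounded_open
begin

text \<open>An average over \<open>\<Omega> \<inter> ball x r\<close> deviates from
  \<open>f x\<close> by at most the oscillation of \<open>f\<close> there. This works at boundary
  points too, because the ball meets the open set \<open>\<Omega>\<close> in a set of positive
  measure.\<close>

lemma boundary_average_continuous:
  fixes f :: "real^'d \<Rightarrow> 'b::euclidean_space"
  assumes f: "continuous_on (closure \<Omega>) f" and x: "x \<in> closure \<Omega>"
  shows "(boundary_average \<Omega> f x \<longlongrightarrow> f x) (at_right 0)"
proof (rule tendstoI)
  fix e :: real assume e: "0 < e"
  from f x obtain s where s: "0 < s" "\<And>y. y \<in> closure \<Omega> \<Longrightarrow> dist y x < s \<Longrightarrow> dist (f y) (f x) < e / 2"
    unfolding continuous_on_iff using e by (meson half_gt_zero)
  have "dist (boundary_average \<Omega> f x r) (f x) < e" if r: "0 < r" "r < s" for r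
  proof -
    let ?B = "\<Omega> \<inter> ball x r"
    define m where "m = measure lebesgue ?B"
    obtain y where "y \<in> \<Omega>" "dist y x < r" using x r by (auto simp: closure_approachable)
    then have "?B \<noteq> {}" by (auto simp: dist_commute)
    then have "\<not> negligible ?B" using open_Om by (intro open_not_negligible) auto
    moreover have B: "?B \<in> lmeasurable"
      using bounded_Om open_Om by (intro lmeasurable_open) (auto intro: bounded_subset)
    ultimately have m: "0 < m" unfolding m_def using negligible_iff_measure0[OF B]
      by (metis measure_nonneg order_less_le)
    interpret B: finite_measure "lebesgue_on ?B" by (rule finite_measure_lebesgue_on[OF B])
    have mB: "measure (lebesgue_on ?B) (space (lebesgue_on ?B)) = m"
      using B by (simp add: m_def measure_restrict_space)
    have int: "integrable (lebesgue_on ?B) f"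
      by (rule integrable_ball[OF L2_integrable[OF continuous_L2[OF f]]])
    have intd: "integrable (lebesgue_on ?B) (\<lambda>y. f y - f x)"
      using int by (intro Bochner_Integration.integrable_diff B.integrable_const)
    have "(\<integral>y. f y - f x \<partial>lebesgue_on ?B) = (\<integral>y. f y \<partial>lebesgue_on ?B) - m *\<^sub>R f x"
      using int mB by simp
    then have eq: "boundary_average \<Omega> f x r - f x = (1 / m) *\<^sub>R (\<integral>y. f y - f x \<partial>lebesgue_on ?B)"
      using m by (simp add: boundary_average_def scaleR_diff_right flip: m_def)
    have "norm (\<integral>y. f y - f x \<partial>lebesgue_on ?B) \<le> (\<integral>y. norm (f y - f x) \<partial>lebesgue_on ?B)"
      by (rule integral_norm_bound)
    also have "\<dots> \<le> (\<integral>y. e / 2 \<partial>lebesgue_on ?B)"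
    proof (rule integral_mono)
      show "norm (f y - f x) \<le> e / 2" if "y \<in> space (lebesgue_on ?B)" for y
      proof -
        have "y \<in> closure \<Omega>" "dist y x < s" using that r closure_subset[of \<Omega>] by (auto simp: dist_commute)
        from s(2)[OF this] show ?thesis by (simp add: dist_norm)
      qed
    qed (use intd in auto)
    also have "\<dots> = m * (e / 2)" using mB by simp
    finally have "norm (\<integral>y. f y - f x \<partial>lebesgue_on ?B) \<le> m * (e / 2)" .
    then have "norm (boundary_average \<Omega> f x r - f x) \<le> e / 2"
      unfolding eq using m by (simp add: field_simps)
    then show ?thesis using e by (simp add: dist_norm)
  qed
  then show "\<forall>\<^sub>F r in at_right 0. dist (boundary_average \<Omega> f x r) (f x) < e"
    using s(1) unfolding eventually_at_right_field by blast
qed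

text \<open>An identity of functions on the whole space is wanted, because the boundary functional
  \<open>z\<close> is linear with respect to pointwise operations on representatives. Off the
  closure, averages over small balls are taken over the empty set and equal 0.\<close>

lemma bdry_trace_continuous:
  assumes q: "continuous_on (closure \<Omega>) q"
  shows "bdry_trace \<Omega> q = (\<lambda>x. if x \<in> closure \<Omega> then q x else 0)"
proof
  fix x
  show "bdry_trace \<Omega> q x = (if x \<in> closure \<Omega> then q x else 0)"
  proof (cases "x \<in> closure \<Omega>")
    case True
    then show ?thesis
      unfolding bdry_trace_def by (simp add: tendsto_Lim[OF _ boundary_average_continuous[OF q True]])
  next
    case False
    then obtain s where s: "0 < s" "ball x s \<inter> closure \<Omega> = {}"
      using open_contains_ball[of "- closure \<Omega>"] False by (metis ComplI closed_closure disjoint_eq_subset_Compl open_Compl)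
    have "boundary_average \<Omega> q x r = 0" if "r < s" for r
    proof -
      have "\<Omega> \<inter> ball x r = {}" using s(2) subset_ball[of r s x] that closure_subset[of \<Omega>] by auto
      then show ?thesis by (simp add: boundary_average_def)
    qed
    then have "\<forall>\<^sub>F r in at_right 0. 0 = boundary_average \<Omega> q x r"
      using s(1) unfolding eventually_at_right_field by metis
    then have "(boundary_average \<Omega> q x \<longlongrightarrow> 0) (at_right 0)"
      by (rule Lim_transform_eventually[OF tendsto_const])
    then show ?thesis using False by (simp add: bdry_trace_def tendsto_Lim)
  qed
qed

end

lemma Hhalf_norm_nonneg [simp]: "0 \<le> Hhalf_norm \<Omega> \<xi>"
  by (simp add: Hhalf_norm_def)

text \<open>A real supremum bounds its members only if the set is bounded above, which is where
  boundedness of the functional enters.\<close>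

lemma Hmhalf_quotient_le:
  assumes z: "z \<in> Hmhalf \<Omega>" and \<xi>: "\<xi> \<in> Hhalf \<Omega>"
  shows "\<bar>z \<xi>\<bar> / Hhalf_norm \<Omega> \<xi> \<le> Hmhalf_norm \<Omega> z"
proof -
  obtain C where C: "\<And>\<xi>. \<xi> \<in> Hhalf \<Omega> \<Longrightarrow> \<bar>z \<xi>\<bar> \<le> C * Hhalf_norm \<Omega> \<xi>"
    using z unfolding Hmhalf_def by blast
  \<comment> \<open>\<open>max C 0\<close> also covers quotients by norm 0, which are 0 by
    convention, in case \<open>C\<close> is negative.\<close>
  have "\<bar>z \<zeta>\<bar> / Hhalf_norm \<Omega> \<zeta> \<le> max C 0" if "\<zeta> \<in> Hhalf \<Omega>" for \<zeta>
  proof (cases "Hhalf_norm \<Omega> \<zeta> = 0")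
    case False
    then have "0 < Hhalf_norm \<Omega> \<zeta>" using Hhalf_norm_nonneg[of \<Omega> \<zeta>] by linarith
    then have "\<bar>z \<zeta>\<bar> / Hhalf_norm \<Omega> \<zeta> \<le> C" using C[OF that] by (simp add: pos_divide_le_eq)
    then show ?thesis by simp
  qed simp
  then have "bdd_above ((\<lambda>\<xi>. \<bar>z \<xi>\<bar> / Hhalf_norm \<Omega> \<xi>) ` Hhalf \<Omega>)" by (rule bdd_aboveI2)
  then show ?thesis unfolding Hmhalf_norm_def by (intro cSUP_upper \<xi>)
qed

lemma Hmhalf_bound:
  assumes z: "z \<in> Hmhalf \<Omega>" and \<xi>: "\<xi> \<in> Hhalf \<Omega>"
  shows "\<bar>z \<xi>\<bar> \<le> Hmhalf_norm \<Omega> z * Hhalf_norm \<Omega> \<xi>"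
proof (cases "Hhalf_norm \<Omega> \<xi> = 0")
  case True
  \<comment> \<open>The dual norm says nothing about elements of norm 0, whose quotient is 0 by
    convention; boundedness of \<open>z\<close> forces its value to be 0 there.\<close>
  obtain C where C: "\<And>\<xi>. \<xi> \<in> Hhalf \<Omega> \<Longrightarrow> \<bar>z \<xi>\<bar> \<le> C * Hhalf_norm \<Omega> \<xi>"
    using z unfolding Hmhalf_def by blast
  from C[OF \<xi>] True show ?thesis by simp
next
  case False
  then have "0 < Hhalf_norm \<Omega> \<xi>" using Hhalf_norm_nonneg[of \<Omega> \<xi>] by linarith
  then show ?thesis using Hmhalf_quotient_le[OF assms] by (simp add: pos_divide_le_eq)
qed

lemma Hmhalf_norm_nonneg:
  assumes "z \<in> Hmhalf \<Omega>" "\<xi> \<in> Hhalf \<Omega>"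
  shows "0 \<le> Hmhalf_norm \<Omega> z"
  using Hmhalf_quotient_le[OF assms] by (rule order_trans[rotated]) simp

section \<open>Bounds for the compliance tensor\<close>

lemma mat_1_inner: "mat 1 \<bullet> (A :: real^'n^'n) = trace A" 
  by (simp add: inner_vec_def mat_def trace_def if_distrib if_distribR cong: if_cong)

lemma norm_mat_1: "norm (mat 1 :: real^'n^'n) = sqrt (real CARD('n))"
  using mat_1_inner[of "mat 1 :: real^'n^'n"] by (simp add: norm_eq_sqrt_inner trace_I)

lemma abs_trace_le: "\<bar>trace (A :: real^'n^'n)\<bar> \<le> sqrt (real CARD('n)) * norm A"
  using Cauchy_Schwarz_ineq2[of "mat 1" A] by (simp add: mat_1_inner norm_mat_1)

lemma linear_trace: "linear (trace :: real^'n^'n \<Rightarrow> real)"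
  by (rule linearI) (simp_all add: trace_def sum.distrib sum_distrib_left)

lemma norm_transpose: "norm (transpose A) = norm (A :: real^'n^'m)"
proof -
  have "transpose A \<bullet> transpose A = A \<bullet> A"
    unfolding inner_vec_def transpose_def by (simp add: sum.swap[of _ "UNIV :: 'n set"])
  then show ?thesis by (simp add: norm_eq_sqrt_inner)
qed

lemma linear_compliance: "linear (compliance lam mu :: real^'n^'n \<Rightarrow> _)"
  unfolding compliance_def
  by (rule linearI) (simp_all add: linear_add[OF linear_trace] linear_scale[OF linear_trace]
      scaleR_add_right scaleR_add_left scaleR_diff_right distrib_left mult.left_commute)

lemma bounded_linear_compliance: "bounded_linear (compliance lam mu :: real^'n^'n \<Rightarrow> _)"
  using linear_compliance by (simp add: linear_conv_bounded_linear)

text \<open>Subtracting the trace part never lengthens the scaled tensor: with a = 1/(2 mu) and s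
  the trace coefficient, |C^-1 A|^2 = a^2 |A|^2 - (tr A)^2 s (2a - s d), and s d \<le> a.\<close>

lemma norm_compliance_le:
  fixes A :: "real^'n^'n"
  assumes "0 < lam" "0 < mu"
  shows "norm (compliance lam mu A) \<le> 1 / (2 * mu) * norm A"
proof -
  define a where "a = 1 / (2 * mu)"
  define d where "d = real CARD('n)"
  define s where "s = lam / (2 * mu * (d * lam + 2 * mu))"
  have d: "0 < d" by (simp add: d_def)
  have pos: "0 < d * lam + 2 * mu" using d assms by (simp add: add_pos_pos)
  have a: "0 < a" and s: "0 < s" using assms pos by (simp_all add: a_def s_def)
  have "s * d = a * (d * lam / (d * lam + 2 * mu))" using assms pos by (simp add: s_def a_def field_simps)
  also have "\<dots> \<le> a * 1" using a assms pos by (intro mult_left_mono) auto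
  finally have sd: "s * d \<le> 2 * a" using a by simp
  define k where "k = s * trace A"
  have C: "compliance lam mu A = a *\<^sub>R A - k *\<^sub>R mat 1"
    by (simp add: compliance_def a_def s_def d_def k_def)
  have "(a *\<^sub>R A - k *\<^sub>R mat 1) \<bullet> (a *\<^sub>R A - k *\<^sub>R mat 1)
      = a\<^sup>2 * (A \<bullet> A) - 2 * a * k * (mat 1 \<bullet> A) + k\<^sup>2 * (mat 1 \<bullet> (mat 1 :: real^'n^'n))"
    by (simp add: inner_diff_left inner_diff_right inner_commute[of A "mat 1"] power2_eq_square) algebra
  also have "\<dots> = a\<^sup>2 * (A \<bullet> A) - (trace A)\<^sup>2 * (s * (2 * a - s * d))"
    by (simp add: mat_1_inner trace_I k_def flip: d_def) algebra
  also have "\<dots> \<le> a\<^sup>2 * (A \<bullet> A)"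
    using s sd by simp
  finally have "compliance lam mu A \<bullet> compliance lam mu A \<le> a\<^sup>2 * (A \<bullet> A)" by (simp only: C)
  then have "norm (compliance lam mu A) \<le> sqrt (a\<^sup>2 * (A \<bullet> A))"
    by (simp add: norm_eq_sqrt_inner)
  then show ?thesis using a by (simp add: real_sqrt_mult norm_eq_sqrt_inner a_def)
qed

section \<open>The forms on the product space\<close>

lemma L2_inner_commute: "L2_inner M f g = L2_inner M g f"
  by (simp add: L2_inner_def inner_commute)

text \<open>The common pattern of the three norms of the product space: a function measured together
  with one weak derivative.\<close>

lemma semi_inner_graph:
  assumes "subspace Y" "L2_operator M N Y A" "L2_operator M N Y B"
  shows "semi_inner_on Y (\<lambda>x y. L2_inner M (A x) (A y) + L2_inner M (B x) (B y))"
  unfolding semi_inner_on_def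
proof (intro conjI ballI assms(1))
  show "bilinear_on Y (\<lambda>x y. L2_inner M (A x) (A y) + L2_inner M (B x) (B y))"
    using assms by (intro bilinear_on_add L2_operator_inner_bilinear)
qed (simp_all add: L2_inner_commute flip: L2_norm_square)

lemma semi_inner_add:
  assumes "semi_inner_on Y B" "semi_inner_on Y C"
  shows "semi_inner_on Y (\<lambda>x y. B x y + C x y)"
  using assms bilinear_on_add unfolding semi_inner_on_def by auto

lemma le_sqrt_sum_squares: "x \<le> sqrt (x\<^sup>2 + y\<^sup>2)" "y \<le> sqrt (x\<^sup>2 + y\<^sup>2)"
  by (rule real_le_rsqrt; simp)+

locale mixed_domain = bounded_open \<Omega> for \<Omega> :: "(real^'d) set" +
  fixes \<Gamma>D :: "(real^'d) set"
begin

abbreviation "Y \<equiv> H_space \<Omega> \<Gamma>D"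

definition null_triples :: "'d triple set" where
  "null_triples = AE_null M \<times> AE_null M \<times> AE_null M"

abbreviation Y_operator :: "('d triple \<Rightarrow> real^'d \<Rightarrow> 'b::euclidean_space) \<Rightarrow> bool" where
  "Y_operator \<equiv> L2_operator M null_triples Y"

lemmas subspace_Y = subspace_H_space[of \<Gamma>D]

lemma subspace_null_triples: "subspace null_triples"
  unfolding null_triples_def by (intro subspace_Times subspace_AE_null)

lemma Y_iff: "y \<in> Y \<longleftrightarrow> fst y \<in> HdivN \<Omega> \<Gamma>D \<and> fst (snd y) \<in> H1D \<Omega> \<Gamma>D \<and> snd (snd y) \<in> H1 \<Omega>"
  by (cases y) (auto simp: H_space_def)

lemma linear_projections: "linear fst" "linear (\<lambda>y. fst (snd y))" "linear (\<lambda>y. snd (snd y))"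
  by (rule linearI; simp)+

lemma Y_operator_stress: "Y_operator fst"
  and Y_operator_div: "Y_operator (\<lambda>y. wdiv \<Omega> (fst y))"
  and Y_operator_disp: "Y_operator (\<lambda>y. fst (snd y))"
  and Y_operator_disp_grad: "Y_operator (\<lambda>y. wgradv \<Omega> (fst (snd y)))"
  and Y_operator_pres: "Y_operator (\<lambda>y. snd (snd y))"
  and Y_operator_pres_grad: "Y_operator (\<lambda>y. wgrad \<Omega> (snd (snd y)))"
proof -
  have s: "fst ` Y \<subseteq> Hdiv \<Omega>" "fst ` null_triples \<subseteq> AE_null M"
    using HdivN_Hdiv[of \<Gamma>D] by (auto simp: H_space_def null_triples_def)
  have u: "(\<lambda>y. fst (snd y)) ` Y \<subseteq> H1v \<Omega>" "(\<lambda>y. fst (snd y)) ` null_triples \<subseteq> AE_null M"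
    using H1D_H1v[of \<Gamma>D] by (auto simp: H_space_def null_triples_def)
  have p: "(\<lambda>y. snd (snd y)) ` Y \<subseteq> H1 \<Omega>" "(\<lambda>y. snd (snd y)) ` null_triples \<subseteq> AE_null M"
    by (auto simp: H_space_def null_triples_def)
  show "Y_operator fst"
    by (rule L2_operator_compose[OF L2_operator_id[OF Hdiv_L2] linear_projections(1) s])
  show "Y_operator (\<lambda>y. wdiv \<Omega> (fst y))"
    by (rule L2_operator_compose[OF L2_operator_wdiv linear_projections(1) s])
  show "Y_operator (\<lambda>y. fst (snd y))"
    by (rule L2_operator_compose[OF L2_operator_id[OF H1v_L2] linear_projections(2) u])
  show "Y_operator (\<lambda>y. wgradv \<Omega> (fst (snd y)))"
    by (rule L2_operator_compose[OF L2_operator_wgradv linear_projections(2) u])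
  show "Y_operator (\<lambda>y. snd (snd y))"
    by (rule L2_operator_compose[OF L2_operator_id[OF H1_L2] linear_projections(3) p])
  show "Y_operator (\<lambda>y. wgrad \<Omega> (snd (snd y)))"
    by (rule L2_operator_compose[OF L2_operator_wgrad linear_projections(3) p])
qed

lemma bounded_linear_sym: "bounded_linear (\<lambda>A :: real^'d^'d. (1/2) *\<^sub>R (A + transpose A))"
  unfolding linear_conv_bounded_linear[symmetric]
  by (rule linearI) (simp_all add: transpose_def vec_eq_iff algebra_simps)

lemma Y_operator_strain: "Y_operator (\<lambda>y. strain \<Omega> (fst (snd y)))"
  using L2_operator_bounded_linear[OF Y_operator_disp_grad bounded_linear_sym]
  by (simp add: strain_def[abs_def])

lemma Y_operator_compliance: "Y_operator (\<lambda>y x. compliance lam mu (fst y x))"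
  by (rule L2_operator_bounded_linear[OF Y_operator_stress bounded_linear_compliance])

lemma Y_operator_trace: "Y_operator (\<lambda>y x. trace (fst y x))"
  using L2_operator_bounded_linear[OF Y_operator_stress] linear_trace
  by (simp add: linear_conv_bounded_linear)

lemma Y_operator_pres_compliance:
  "Y_operator (\<lambda>y x. compliance lam mu ((\<alpha> * snd (snd y) x) *\<^sub>R (mat 1 :: real^'d^'d)))"
proof -
  have "bounded_linear (\<lambda>t :: real. compliance lam mu ((\<alpha> * t) *\<^sub>R (mat 1 :: real^'d^'d)))"
    by (rule bounded_linear_compose[OF bounded_linear_compliance])
      (auto intro: bounded_linear_scaleR_left bounded_linear_compose[OF bounded_linear_scaleR_left bounded_linear_mult_right])
  then show ?thesis by (rule L2_operator_bounded_linear[OF Y_operator_pres])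
qed

text \<open>The residual of the constitutive law; the \<open>\<delta>1\<close> term of the form is
  the product of two such residuals.\<close>

definition residual :: "real \<Rightarrow> real \<Rightarrow> real \<Rightarrow> 'd triple \<Rightarrow> 'd tens" where
  "residual lam mu \<alpha> y x =
     compliance lam mu (fst y x + (\<alpha> * snd (snd y) x) *\<^sub>R mat 1) - strain \<Omega> (fst (snd y)) x"

lemma residual_eq:
  "residual lam mu \<alpha> = (\<lambda>y x. compliance lam mu (fst y x) + compliance lam mu ((\<alpha> * snd (snd y) x) *\<^sub>R mat 1)
     - strain \<Omega> (fst (snd y)) x)"
  by (simp add: residual_def fun_eq_iff linear_add[OF linear_compliance])

lemma Y_operator_residual: "Y_operator (residual lam mu \<alpha>)"
  unfolding residual_eq
  by (intro L2_operator_diff L2_operator_add Y_operator_compliance Y_operator_pres_compliance Y_operator_strain)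

text \<open>Factors are reordered so that each term pairs an operator of \<open>y\<close> with an
  operator of \<open>y'\<close>, the shape in which bilinearity, vanishing on null triples and
  bounds can be read off term by term.\<close>

lemma form_a_eq:
  "form_a \<Omega> lam mu \<alpha> c0 \<delta>1 \<delta>2 K y y' =
     L2_inner M (\<lambda>x. compliance lam mu (fst y x)) (fst y')
     + \<alpha> / (real CARD('d) * lam + 2 * mu) * L2_inner M (snd (snd y)) (\<lambda>x. trace (fst y' x))
     + L2_inner M (fst (snd y)) (wdiv \<Omega> (fst y'))
     + (c0 + real CARD('d) * \<alpha>\<^sup>2 / (real CARD('d) * lam + 2 * mu)) * L2_inner M (snd (snd y)) (snd (snd y'))
     + L2_inner M (\<lambda>x. K x *v wgrad \<Omega> (snd (snd y)) x) (wgrad \<Omega> (snd (snd y')))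
     + \<alpha> / (real CARD('d) * lam + 2 * mu) * L2_inner M (\<lambda>x. trace (fst y x)) (snd (snd y'))
     + L2_inner M (wdiv \<Omega> (fst y)) (fst (snd y'))
     + \<delta>1 * L2_inner M (residual lam mu \<alpha> y) (residual lam mu \<alpha> y')
     + \<delta>2 * L2_inner M (wdiv \<Omega> (fst y)) (wdiv \<Omega> (fst y'))"
proof -
  obtain \<sigma> u p \<tau> v q where y: "y = (\<sigma>, u, p)" "y' = (\<tau>, v, q)" by (metis prod.exhaust)
  show ?thesis
    unfolding y form_a.simps residual_def[abs_def] fst_conv snd_conv
    by (simp only: L2_inner_commute[of M q "\<lambda>x. trace (\<sigma> x)"] L2_inner_commute[of M v "wdiv \<Omega> \<sigma>"]
        L2_inner_commute[of M "wdiv \<Omega> \<tau>" "wdiv \<Omega> \<sigma>"])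
qed

lemmas Y_inner_bilinear = L2_operator_inner_bilinear[OF subspace_Y]

lemma form_a_bilinear:
  assumes K: "K \<in> Linf_space M"
  shows "bilinear_on Y (form_a \<Omega> lam mu \<alpha> c0 \<delta>1 \<delta>2 K)"
  unfolding form_a_eq[abs_def]
  by (intro bilinear_on_add bilinear_on_scale
      Y_inner_bilinear[OF Y_operator_compliance Y_operator_stress]
      Y_inner_bilinear[OF Y_operator_pres Y_operator_trace]
      Y_inner_bilinear[OF Y_operator_disp Y_operator_div]
      Y_inner_bilinear[OF Y_operator_pres Y_operator_pres]
      Y_inner_bilinear[OF L2_operator_matrix_mult[OF Y_operator_pres_grad K] Y_operator_pres_grad]
      Y_inner_bilinear[OF Y_operator_trace Y_operator_pres]
      Y_inner_bilinear[OF Y_operator_div Y_operator_disp]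
      Y_inner_bilinear[OF Y_operator_residual Y_operator_residual]
      Y_inner_bilinear[OF Y_operator_div Y_operator_div])

lemma form_a_null:
  assumes K: "K \<in> Linf_space M" and y: "y \<in> Y" "y' \<in> Y" "y \<in> null_triples \<or> y' \<in> null_triples"
  shows "form_a \<Omega> lam mu \<alpha> c0 \<delta>1 \<delta>2 K y y' = 0"
  unfolding form_a_eq
  by (simp add: L2_operator_inner_null[OF Y_operator_compliance Y_operator_stress y]
      L2_operator_inner_null[OF Y_operator_pres Y_operator_trace y]
      L2_operator_inner_null[OF Y_operator_disp Y_operator_div y]
      L2_operator_inner_null[OF Y_operator_pres Y_operator_pres y]
      L2_operator_inner_null[OF L2_operator_matrix_mult[OF Y_operator_pres_grad K] Y_operator_pres_grad y]
      L2_operator_inner_null[OF Y_operator_trace Y_operator_pres y]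
      L2_operator_inner_null[OF Y_operator_div Y_operator_disp y]
      L2_operator_inner_null[OF Y_operator_residual Y_operator_residual y]
      L2_operator_inner_null[OF Y_operator_div Y_operator_div y])

lemma form_b_eq: "form_b \<Omega> y \<eta> = L2_inner M (fst y) \<eta>"
  by (cases y) simp

section \<open>Semi-inner products and norms on the product space\<close>

definition ip_sigma :: "'d triple \<Rightarrow> 'd triple \<Rightarrow> real" where
  "ip_sigma y y' = L2_inner M (fst y) (fst y') + L2_inner M (wdiv \<Omega> (fst y)) (wdiv \<Omega> (fst y'))"

definition ip_u :: "'d triple \<Rightarrow> 'd triple \<Rightarrow> real" where
  "ip_u y y' = L2_inner M (fst (snd y)) (fst (snd y'))
     + L2_inner M (wgradv \<Omega> (fst (snd y))) (wgradv \<Omega> (fst (snd y')))"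

definition ip_p :: "'d triple \<Rightarrow> 'd triple \<Rightarrow> real" where
  "ip_p y y' = L2_inner M (snd (snd y)) (snd (snd y'))
     + L2_inner M (wgrad \<Omega> (snd (snd y))) (wgrad \<Omega> (snd (snd y')))"

text \<open>\<open>H_norm\<close> is a sum of three norms and not induced by an inner product.
  \<open>ip_H\<close> induces their Euclidean combination, to which the contraction principle
  applies; it lies between each single norm and \<open>H_norm\<close>.\<close>

definition ip_H :: "'d triple \<Rightarrow> 'd triple \<Rightarrow> real" where
  "ip_H y y' = ip_sigma y y' + ip_u y y' + ip_p y y'"

lemma semi_inner_parts: "semi_inner_on Y ip_sigma" "semi_inner_on Y ip_u" "semi_inner_on Y ip_p"
  unfolding ip_sigma_def[abs_def] ip_u_def[abs_def] ip_p_def[abs_def]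
  by (rule semi_inner_graph[OF subspace_Y Y_operator_stress Y_operator_div]
      semi_inner_graph[OF subspace_Y Y_operator_disp Y_operator_disp_grad]
      semi_inner_graph[OF subspace_Y Y_operator_pres Y_operator_pres_grad])+

lemma semi_inner_H: "semi_inner_on Y ip_H"
  unfolding ip_H_def[abs_def] by (intro semi_inner_add semi_inner_parts)

lemma norm_parts:
  "Hdiv_norm \<Omega> (fst y) = sqrt (ip_sigma y y)" "H1v_norm \<Omega> (fst (snd y)) = sqrt (ip_u y y)"
  "H1_norm \<Omega> (snd (snd y)) = sqrt (ip_p y y)"
  by (simp_all add: Hdiv_norm_def H1v_norm_def H1_norm_def ip_sigma_def ip_u_def ip_p_def L2_norm_square)

lemma H_norm_parts: "H_norm \<Omega> y = Hdiv_norm \<Omega> (fst y) + H1v_norm \<Omega> (fst (snd y)) + H1_norm \<Omega> (snd (snd y))"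
  by (cases y) simp

lemma part_norms_nonneg [simp]: "0 \<le> Hdiv_norm \<Omega> \<tau>" "0 \<le> H1v_norm \<Omega> v" "0 \<le> H1_norm \<Omega> q"
  by (simp_all add: Hdiv_norm_def H1v_norm_def H1_norm_def)

lemma H_norm_nonneg [simp]: "0 \<le> H_norm \<Omega> y"
  by (simp add: H_norm_parts)

lemma part_norms_le: 
  "Hdiv_norm \<Omega> (fst y) \<le> H_norm \<Omega> y" "H1v_norm \<Omega> (fst (snd y)) \<le> H_norm \<Omega> y"
  "H1_norm \<Omega> (snd (snd y)) \<le> H_norm \<Omega> y"
  by (simp_all add: H_norm_parts)

lemma L2_norms_le:
  "L2_norm M \<tau> \<le> Hdiv_norm \<Omega> \<tau>" "L2_norm M (wdiv \<Omega> \<tau>) \<le> Hdiv_norm \<Omega> \<tau>"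
  "L2_norm M v \<le> H1v_norm \<Omega> v" "L2_norm M (wgradv \<Omega> v) \<le> H1v_norm \<Omega> v"
  "L2_norm M q \<le> H1_norm \<Omega> q" "L2_norm M (wgrad \<Omega> q) \<le> H1_norm \<Omega> q"
  unfolding Hdiv_norm_def H1v_norm_def H1_norm_def by (rule le_sqrt_sum_squares)+

lemma L2_norms_le_H_norm:
  "L2_norm M (fst y) \<le> H_norm \<Omega> y" "L2_norm M (wdiv \<Omega> (fst y)) \<le> H_norm \<Omega> y"
  "L2_norm M (fst (snd y)) \<le> H_norm \<Omega> y" "L2_norm M (wgradv \<Omega> (fst (snd y))) \<le> H_norm \<Omega> y"
  "L2_norm M (snd (snd y)) \<le> H_norm \<Omega> y" "L2_norm M (wgrad \<Omega> (snd (snd y))) \<le> H_norm \<Omega> y"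
  using L2_norms_le(1,2)[of "fst y"] L2_norms_le(3,4)[of "fst (snd y)"] L2_norms_le(5,6)[of "snd (snd y)"]
    part_norms_le[of y] by linarith+

lemma ip_H_nonneg: "y \<in> Y \<Longrightarrow> 0 \<le> ip_sigma y y" "y \<in> Y \<Longrightarrow> 0 \<le> ip_u y y" "y \<in> Y \<Longrightarrow> 0 \<le> ip_p y y"
  using semi_inner_parts by (auto simp: semi_inner_on_def)

lemma sqrt_ip_H_le: "y \<in> Y \<Longrightarrow> sqrt (ip_H y y) \<le> H_norm \<Omega> y"
  unfolding H_norm_parts norm_parts ip_H_def
  using sqrt_add_le_add_sqrt[of "ip_sigma y y + ip_u y y" "ip_p y y"]
    sqrt_add_le_add_sqrt[of "ip_sigma y y" "ip_u y y"] ip_H_nonneg[of y] by simp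

lemma part_norms_le_ip:
  assumes "y \<in> Y"
  shows "H1v_norm \<Omega> (fst (snd y)) \<le> sqrt (ip_H y y)" "H1_norm \<Omega> (snd (snd y)) \<le> sqrt (ip_H y y)"
  using ip_H_nonneg[OF assms] by (auto simp: norm_parts ip_H_def)

lemma part_norms_triangle:
  assumes "y \<in> Y" "y' \<in> Y"
  shows "H1v_norm \<Omega> (fst (snd (y + y'))) \<le> H1v_norm \<Omega> (fst (snd y)) + H1v_norm \<Omega> (fst (snd y'))"
    "H1_norm \<Omega> (snd (snd (y + y'))) \<le> H1_norm \<Omega> (snd (snd y)) + H1_norm \<Omega> (snd (snd y'))"
  unfolding norm_parts
  by (rule semi_inner_triangle[OF semi_inner_parts(2) assms] semi_inner_triangle[OF semi_inner_parts(3) assms])+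

lemma H_norm_eq_0_imp_null:
  assumes "y \<in> Y" "H_norm \<Omega> y = 0"
  shows "y \<in> null_triples"
proof -
  have z: "L2_norm M (fst y) = 0" "L2_norm M (fst (snd y)) = 0" "L2_norm M (snd (snd y)) = 0"
    using L2_norms_le_H_norm[of y] assms(2) by (simp_all add: order.antisym)
  show ?thesis
    using L2_norm_eq_0[OF L2_operator_L2[OF Y_operator_stress assms(1)] z(1)]
      L2_norm_eq_0[OF L2_operator_L2[OF Y_operator_disp assms(1)] z(2)]
      L2_norm_eq_0[OF L2_operator_L2[OF Y_operator_pres assms(1)] z(3)]
    by (cases y) (simp add: null_triples_def AE_null_def)
qed

lemma null_imp_H_norm_eq_0:
  assumes "y \<in> Y" "y \<in> null_triples"
  shows "H_norm \<Omega> y = 0"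
  using L2_norm_AE_0[OF L2_operator_null[OF Y_operator_stress assms]]
    L2_norm_AE_0[OF L2_operator_null[OF Y_operator_div assms]]
    L2_norm_AE_0[OF L2_operator_null[OF Y_operator_disp assms]]
    L2_norm_AE_0[OF L2_operator_null[OF Y_operator_disp_grad assms]]
    L2_norm_AE_0[OF L2_operator_null[OF Y_operator_pres assms]]
    L2_norm_AE_0[OF L2_operator_null[OF Y_operator_pres_grad assms]]
  by (simp add: H_norm_parts Hdiv_norm_def H1v_norm_def H1_norm_def)

lemma zero_norms [simp]:
  "H_norm \<Omega> 0 = 0" "Hdiv_norm \<Omega> 0 = 0" "H1v_norm \<Omega> 0 = 0" "H1_norm \<Omega> 0 = 0"
proof -
  show 0: "H_norm \<Omega> 0 = 0"
    by (rule null_imp_H_norm_eq_0[OF subspace_0[OF subspace_Y] subspace_0[OF subspace_null_triples]])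
  show "Hdiv_norm \<Omega> 0 = 0" "H1v_norm \<Omega> 0 = 0" "H1_norm \<Omega> 0 = 0"
    using part_norms_le[of 0] part_norms_nonneg(1)[of 0] part_norms_nonneg(2)[of 0] part_norms_nonneg(3)[of 0]
    unfolding 0 fst_zero snd_zero by linarith+
qed

section \<open>Boundedness of the forms\<close>

lemma L2_norm_compliance_le:
  assumes "0 < lam" "0 < mu" "y \<in> Y"
  shows "L2_norm M (\<lambda>x. compliance lam mu (fst y x)) \<le> 1 / (2 * mu) * H_norm \<Omega> y"
proof -
  note L2 = L2_operator_L2[OF _ assms(3)]
  have "L2_norm M (\<lambda>x. compliance lam mu (fst y x)) \<le> 1 / (2 * mu) * L2_norm M (fst y)"
    using assms by (intro L2_norm_mono L2[OF Y_operator_compliance] L2[OF Y_operator_stress] AE_I2 norm_compliance_le) auto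
  also have "\<dots> \<le> 1 / (2 * mu) * H_norm \<Omega> y"
    using assms L2_norms_le_H_norm(1)[of y] by (intro mult_left_mono) auto
  finally show ?thesis .
qed

text \<open>The three summands of the constant stem from the strain, from the compliance of the
  stress, and from the compliance of the pressure tensor, in which the identity matrix has Frobenius
  norm sqrt d.\<close>

lemma residual_norm_le:
  assumes "0 < lam" "0 < mu" "0 \<le> \<alpha>" and y: "y \<in> Y"
  shows "L2_norm M (residual lam mu \<alpha> y)
    \<le> (1 + 1 / (2 * mu) + \<alpha> * sqrt (real CARD('d)) / (2 * mu)) * H_norm \<Omega> y"
proof -
  note L2 = L2_operator_L2[OF _ y]
  note 1 = L2_norm_compliance_le[OF assms(1,2,4)]
  have "norm (compliance lam mu ((\<alpha> * t) *\<^sub>R (mat 1 :: real^'d^'d)))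
      \<le> \<alpha> * sqrt (real CARD('d)) / (2 * mu) * norm t" for t :: real
    using norm_compliance_le[OF assms(1,2), of "(\<alpha> * t) *\<^sub>R (mat 1 :: real^'d^'d)"] assms(3)
    by (simp add: norm_mat_1 abs_mult mult_ac)
  then have "L2_norm M (\<lambda>x. compliance lam mu ((\<alpha> * snd (snd y) x) *\<^sub>R (mat 1 :: real^'d^'d)))
      \<le> \<alpha> * sqrt (real CARD('d)) / (2 * mu) * L2_norm M (snd (snd y))"
    using assms by (intro L2_norm_mono L2[OF Y_operator_pres_compliance] L2[OF Y_operator_pres] AE_I2) auto
  also have "\<dots> \<le> \<alpha> * sqrt (real CARD('d)) / (2 * mu) * H_norm \<Omega> y"
    using assms L2_norms_le_H_norm(5)[of y] by (intro mult_left_mono) auto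
  finally have 2: "L2_norm M (\<lambda>x. compliance lam mu ((\<alpha> * snd (snd y) x) *\<^sub>R (mat 1 :: real^'d^'d)))
      \<le> \<alpha> * sqrt (real CARD('d)) / (2 * mu) * H_norm \<Omega> y" .
  have "norm ((1/2) *\<^sub>R (A + transpose A)) \<le> 1 * norm A" for A :: "real^'d^'d"
    using norm_triangle_ineq[of A "transpose A"] by (simp add: norm_transpose)
  then have "L2_norm M (strain \<Omega> (fst (snd y))) \<le> 1 * L2_norm M (wgradv \<Omega> (fst (snd y)))"
    by (intro L2_norm_mono L2[OF Y_operator_strain] L2[OF Y_operator_disp_grad] AE_I2)
      (simp_all add: strain_def)
  then have 3: "L2_norm M (strain \<Omega> (fst (snd y))) \<le> H_norm \<Omega> y"
    using L2_norms_le_H_norm(4)[of y] by simp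
  have c: "(\<lambda>x. compliance lam mu (fst y x)) \<in> L2_space M"
    "(\<lambda>x. compliance lam mu ((\<alpha> * snd (snd y) x) *\<^sub>R (mat 1 :: real^'d^'d))) \<in> L2_space M"
    "strain \<Omega> (fst (snd y)) \<in> L2_space M"
    by (rule L2[OF Y_operator_compliance] L2[OF Y_operator_pres_compliance] L2[OF Y_operator_strain])+
  have "L2_norm M (residual lam mu \<alpha> y) \<le> 1 / (2 * mu) * H_norm \<Omega> y
      + \<alpha> * sqrt (real CARD('d)) / (2 * mu) * H_norm \<Omega> y + H_norm \<Omega> y"
    unfolding residual_eq
    using L2_norm_triangle_diff[OF L2_space_add[OF c(1,2)] c(3)] L2_norm_triangle[OF c(1,2)] 1 2 3 by linarith
  then show ?thesis by (simp add: algebra_simps)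
qed

text \<open>With zero displacement and pressure in the second argument five terms survive; each
  contributes one summand of the constant, and none of them contains \<open>K\<close>.\<close>

lemma form_a_stress_bound:
  assumes "0 < lam" "0 < mu" "0 \<le> \<alpha>" "0 \<le> c0" "0 \<le> \<delta>1" "0 \<le> \<delta>2" and K: "K \<in> Linf_space M"
    and y: "y \<in> Y" and \<tau>: "(\<tau>, 0, 0) \<in> Y"
  shows "\<bar>form_a \<Omega> lam mu \<alpha> c0 \<delta>1 \<delta>2 K y (\<tau>, 0, 0)\<bar>
    \<le> (1 / (2 * mu) + \<alpha> * sqrt (real CARD('d)) / (2 * mu) + 1 + \<delta>2
        + \<delta>1 * (1 + 1 / (2 * mu) + \<alpha> * sqrt (real CARD('d)) / (2 * mu))\<^sup>2) * H_norm \<Omega> y * H_norm \<Omega> (\<tau>, 0, 0)"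
proof -
  define t :: "'d triple" where "t = (\<tau>, 0, 0)"
  define S where "S = H_norm \<Omega> y"
  define T where "T = H_norm \<Omega> t"
  define m where "m = 1 + 1 / (2 * mu) + \<alpha> * sqrt (real CARD('d)) / (2 * mu)"
  have t: "t \<in> Y" using \<tau> by (simp add: t_def)
  have ST: "0 \<le> S" "0 \<le> T" by (simp_all add: S_def T_def)
  have m0: "0 \<le> m" using assms by (simp add: m_def)
  note Ly = L2_operator_L2[OF _ y] and Lt = L2_operator_L2[OF _ t]
  note le_y = L2_norms_le_H_norm[of y, folded S_def] and le_t = L2_norms_le_H_norm[of t, folded T_def]
  have 1: "\<bar>L2_inner M (\<lambda>x. compliance lam mu (fst y x)) (fst t)\<bar> \<le> 1 / (2 * mu) * S * T"
    unfolding S_def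
    by (intro L2_inner_bound L2_norm_compliance_le assms Ly[OF Y_operator_compliance] Lt[OF Y_operator_stress] le_t)
  have "L2_norm M (\<lambda>x. trace (fst t x)) \<le> sqrt (real CARD('d)) * L2_norm M (fst t)"
    by (intro L2_norm_mono Lt[OF Y_operator_trace] Lt[OF Y_operator_stress] AE_I2) (auto simp: abs_trace_le)
  also have "\<dots> \<le> sqrt (real CARD('d)) * T" using le_t(1) by (intro mult_left_mono) auto
  finally have "\<bar>L2_inner M (snd (snd y)) (\<lambda>x. trace (fst t x))\<bar> \<le> S * (sqrt (real CARD('d)) * T)"
    by (intro L2_inner_bound Ly[OF Y_operator_pres] Lt[OF Y_operator_trace] le_y)
  moreover define e where "e = \<alpha> / (real CARD('d) * lam + 2 * mu)"
  \<comment> \<open>The denominator is at least \<open>2 * mu\<close>, which makes the bound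
    independent of \<open>lam\<close>.\<close>
  moreover have e: "0 \<le> e" "e \<le> \<alpha> / (2 * mu)"
    unfolding e_def using assms by (auto intro!: divide_left_mono mult_pos_pos add_pos_pos)
  ultimately have "e * \<bar>L2_inner M (snd (snd y)) (\<lambda>x. trace (fst t x))\<bar>
      \<le> \<alpha> / (2 * mu) * (S * (sqrt (real CARD('d)) * T))"
    using ST by (intro mult_mono) auto
  then have 2: "\<bar>e * L2_inner M (snd (snd y)) (\<lambda>x. trace (fst t x))\<bar>
      \<le> \<alpha> * sqrt (real CARD('d)) / (2 * mu) * S * T"
    using e(1) by (simp add: abs_mult mult_ac)
  have 3: "\<bar>L2_inner M (fst (snd y)) (wdiv \<Omega> (fst t))\<bar> \<le> S * T"
    by (intro L2_inner_bound Ly[OF Y_operator_disp] Lt[OF Y_operator_div] le_y le_t)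
  have z: "L2_inner M f (0 :: real^'d \<Rightarrow> 'z::euclidean_space) = 0" for f by (simp add: L2_inner_def)
  have n: "(0, 0, 0) \<in> null_triples" "(0, 0, 0) \<in> Y"
    using subspace_0[OF subspace_null_triples] subspace_0[OF subspace_Y] by (simp_all flip: zero_prod_def)
  \<comment> \<open>\<open>wgrad \<Omega> 0\<close> is a chosen representative and is known to
    vanish only almost everywhere, so this term is removed by the null argument and not by
    rewriting.\<close>
  have 5: "L2_inner M (\<lambda>x. K x *v wgrad \<Omega> (snd (snd y)) x) (wgrad \<Omega> 0) = 0"
    using L2_operator_inner_null[OF L2_operator_matrix_mult[OF Y_operator_pres_grad K] Y_operator_pres_grad y n(2)] n(1)
    by simp
  have 8: "\<bar>L2_inner M (residual lam mu \<alpha> y) (residual lam mu \<alpha> t)\<bar> \<le> (m * S) * (m * T)"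
    unfolding m_def S_def T_def
    by (intro L2_inner_bound Ly[OF Y_operator_residual] Lt[OF Y_operator_residual] residual_norm_le assms t)
  have 8: "\<bar>\<delta>1 * L2_inner M (residual lam mu \<alpha> y) (residual lam mu \<alpha> t)\<bar> \<le> \<delta>1 * m\<^sup>2 * S * T"
    using mult_left_mono[OF 8 assms(5)] assms(5) by (simp add: abs_mult power2_eq_square mult_ac)
  have 9: "\<bar>L2_inner M (wdiv \<Omega> (fst y)) (wdiv \<Omega> (fst t))\<bar> \<le> S * T"
    by (intro L2_inner_bound Ly[OF Y_operator_div] Lt[OF Y_operator_div] le_y le_t)
  have 9: "\<bar>\<delta>2 * L2_inner M (wdiv \<Omega> (fst y)) (wdiv \<Omega> (fst t))\<bar> \<le> \<delta>2 * S * T"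
    using mult_left_mono[OF 9 assms(6)] assms(6) by (simp add: abs_mult mult_ac)
  have "form_a \<Omega> lam mu \<alpha> c0 \<delta>1 \<delta>2 K y t = L2_inner M (\<lambda>x. compliance lam mu (fst y x)) (fst t)
     + e * L2_inner M (snd (snd y)) (\<lambda>x. trace (fst t x))
     + L2_inner M (fst (snd y)) (wdiv \<Omega> (fst t))
     + \<delta>1 * L2_inner M (residual lam mu \<alpha> y) (residual lam mu \<alpha> t)
     + \<delta>2 * L2_inner M (wdiv \<Omega> (fst y)) (wdiv \<Omega> (fst t))"
    unfolding form_a_eq e_def by (simp add: t_def z 5)
  then have "\<bar>form_a \<Omega> lam mu \<alpha> c0 \<delta>1 \<delta>2 K y t\<bar> \<le> 1 / (2 * mu) * S * T + \<alpha> * sqrt (real CARD('d)) / (2 * mu) * S * T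
      + S * T + \<delta>1 * m\<^sup>2 * S * T + \<delta>2 * S * T"
    using 1 2 3 8 9 by linarith
  also have "\<dots> = (1 / (2 * mu) + \<alpha> * sqrt (real CARD('d)) / (2 * mu) + 1 + \<delta>2 + \<delta>1 * m\<^sup>2) * S * T"
    by (simp add: algebra_simps)
  finally show ?thesis by (simp only: t_def m_def S_def T_def)
qed

text \<open>All other terms of the two forms cancel, so the difference sees the pressure gradients
  only.\<close>

lemma form_a_diff_bound:
  assumes K: "K1 \<in> Linf_space M" "K2 \<in> Linf_space M" "AE x in M. norm (K1 x - K2 x) \<le> C" and C: "0 \<le> C"
    and y: "y \<in> Y" "y' \<in> Y"
  shows "\<bar>form_a \<Omega> lam mu \<alpha> c0 \<delta>1 \<delta>2 K1 y y' - form_a \<Omega> lam mu \<alpha> c0 \<delta>1 \<delta>2 K2 y y'\<bar>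
    \<le> C * H1_norm \<Omega> (snd (snd y)) * H1_norm \<Omega> (snd (snd y'))"
proof -
  let ?p = "wgrad \<Omega> (snd (snd y))" and ?q = "wgrad \<Omega> (snd (snd y'))"
  have L: "?p \<in> L2_space M" "?q \<in> L2_space M" 
    by (rule L2_operator_L2[OF Y_operator_pres_grad y(1)] L2_operator_L2[OF Y_operator_pres_grad y(2)])+
  have L1: "(\<lambda>x. K1 x *v ?p x) \<in> L2_space M" and L2: "(\<lambda>x. K2 x *v ?p x) \<in> L2_space M"
    by (rule L2_space_matrix_mult[OF K(1) L(1)] L2_space_matrix_mult[OF K(2) L(1)])+
  have Ld: "(\<lambda>x. K1 x *v ?p x - K2 x *v ?p x) \<in> L2_space M" by (rule L2_space_diff[OF L1 L2])
  have "L2_norm M (\<lambda>x. K1 x *v ?p x - K2 x *v ?p x) \<le> C * L2_norm M ?p"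
  proof (rule L2_norm_mono[OF Ld L(1) C])
    show "AE x in M. norm (K1 x *v ?p x - K2 x *v ?p x) \<le> C * norm (?p x)"
      using K(3)
    proof eventually_elim
      case (elim x)
      then show ?case
        using norm_matrix_vector_mult_le[of "K1 x - K2 x" "?p x"] mult_right_mono[OF elim norm_ge_zero[of "?p x"]]
        by (simp add: matrix_vector_mult_diff_rdistrib)
    qed
  qed
  then have "\<bar>L2_inner M (\<lambda>x. K1 x *v ?p x - K2 x *v ?p x) ?q\<bar> \<le> (C * L2_norm M ?p) * L2_norm M ?q"
    by (rule order_trans[OF L2_Cauchy_Schwarz[OF Ld L(2)] mult_right_mono[OF _ L2_norm_nonneg]])
  also have "\<dots> \<le> C * H1_norm \<Omega> (snd (snd y)) * H1_norm \<Omega> (snd (snd y'))"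
    using C by (intro mult_mono L2_norms_le) auto
  also have "L2_inner M (\<lambda>x. K1 x *v ?p x - K2 x *v ?p x) ?q
      = L2_inner M (\<lambda>x. K1 x *v ?p x) ?q - L2_inner M (\<lambda>x. K2 x *v ?p x) ?q"
    unfolding L2_inner_def
    using L2_inner_integrable[OF L1 L(2)] L2_inner_integrable[OF L2 L(2)] by (simp add: inner_diff_left)
  finally show ?thesis unfolding form_a_eq by simp
qed

lemma form_F_bound:
  assumes y: "y \<in> Y" and d: "f \<in> L2_space M" "g \<in> L2_space M" "z \<in> Hmhalf \<Omega>"
    and Ctr: "0 < Ctr" "trace_constant \<Omega> Ctr" and \<delta>2: "0 \<le> \<delta>2"
  shows "\<bar>form_F \<Omega> \<delta>2 f g z y\<bar>
    \<le> (1 + \<delta>2 + Ctr) * (L2_norm M f + L2_norm M g + Hmhalf_norm \<Omega> z) * H_norm \<Omega> y"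
proof -
  let ?S = "H_norm \<Omega> y" and ?q = "snd (snd y)"
  have q: "?q \<in> H1 \<Omega>" using y by (simp add: Y_iff)
  have tr: "bdry_trace \<Omega> ?q \<in> Hhalf \<Omega>" "Hhalf_norm \<Omega> (bdry_trace \<Omega> ?q) \<le> Ctr * H1_norm \<Omega> ?q"
    using Ctr q by (auto simp: trace_constant_def)
  have z0: "0 \<le> Hmhalf_norm \<Omega> z" by (rule Hmhalf_norm_nonneg[OF d(3) tr(1)])
  have 1: "\<bar>L2_inner M f (fst (snd y))\<bar> \<le> L2_norm M f * ?S"
    by (intro L2_inner_bound d order.refl L2_operator_L2[OF Y_operator_disp y] L2_norms_le_H_norm)
  have 2: "\<bar>L2_inner M f (wdiv \<Omega> (fst y))\<bar> \<le> L2_norm M f * ?S"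
    by (intro L2_inner_bound d order.refl L2_operator_L2[OF Y_operator_div y] L2_norms_le_H_norm)
  have 2: "\<bar>\<delta>2 * L2_inner M f (wdiv \<Omega> (fst y))\<bar> \<le> \<delta>2 * (L2_norm M f * ?S)"
    using mult_left_mono[OF 2 \<delta>2] \<delta>2 by (simp add: abs_mult)
  have 3: "\<bar>L2_inner M g ?q\<bar> \<le> L2_norm M g * ?S"
    by (intro L2_inner_bound d order.refl L2_operator_L2[OF Y_operator_pres y] L2_norms_le_H_norm)
  have "Hhalf_norm \<Omega> (bdry_trace \<Omega> ?q) \<le> Ctr * ?S"
    using tr(2) mult_left_mono[OF part_norms_le(3)[of y], of Ctr] Ctr(1) by linarith
  then have 4: "\<bar>z (bdry_trace \<Omega> ?q)\<bar> \<le> Hmhalf_norm \<Omega> z * (Ctr * ?S)"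
    by (rule order_trans[OF Hmhalf_bound[OF d(3) tr(1)] mult_left_mono[OF _ z0]])
  have "form_F \<Omega> \<delta>2 f g z y = - L2_inner M f (fst (snd y)) - \<delta>2 * L2_inner M f (wdiv \<Omega> (fst y))
      + L2_inner M g ?q + z (bdry_trace \<Omega> ?q)"
    by (cases y) simp
  then have "\<bar>form_F \<Omega> \<delta>2 f g z y\<bar>
      \<le> L2_norm M f * ?S + \<delta>2 * (L2_norm M f * ?S) + L2_norm M g * ?S + Hmhalf_norm \<Omega> z * (Ctr * ?S)"
    using 1 2 3 4 by linarith
  also have "\<dots> = (L2_norm M f * (1 + \<delta>2) + L2_norm M g * 1 + Hmhalf_norm \<Omega> z * Ctr) * ?S"
    by (simp add: algebra_simps)
  \<comment> \<open>Each datum comes with its own factor, \<open>1 + \<delta>2\<close>, 1 and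
    \<open>Ctr\<close>; these are enlarged to a common one.\<close>
  also have "\<dots> \<le> (L2_norm M f * (1 + \<delta>2 + Ctr) + L2_norm M g * (1 + \<delta>2 + Ctr)
      + Hmhalf_norm \<Omega> z * (1 + \<delta>2 + Ctr)) * ?S"
  proof (rule mult_right_mono)
    have "L2_norm M f * (1 + \<delta>2) \<le> L2_norm M f * (1 + \<delta>2 + Ctr)"
      "L2_norm M g * 1 \<le> L2_norm M g * (1 + \<delta>2 + Ctr)"
      "Hmhalf_norm \<Omega> z * Ctr \<le> Hmhalf_norm \<Omega> z * (1 + \<delta>2 + Ctr)"
      using z0 \<delta>2 Ctr(1) by (intro mult_left_mono; simp)+
    then show "L2_norm M f * (1 + \<delta>2) + L2_norm M g * 1 + Hmhalf_norm \<Omega> z * Ctr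
        \<le> L2_norm M f * (1 + \<delta>2 + Ctr) + L2_norm M g * (1 + \<delta>2 + Ctr) + Hmhalf_norm \<Omega> z * (1 + \<delta>2 + Ctr)"
      by linarith
  qed simp
  also have "\<dots> = (1 + \<delta>2 + Ctr) * (L2_norm M f + L2_norm M g + Hmhalf_norm \<Omega> z) * ?S"
    by (simp add: algebra_simps)
  finally show ?thesis .
qed

text \<open>Where averages fail to converge, \<open>bdry_trace\<close> has an unspecified value and
  need not be additive. Continuity up to the boundary excludes this: the trace is then a
  restriction, extended by zero, and the linearity of \<open>z\<close> applies to it.\<close>

lemma form_F_linear:
  assumes Z: "subspace Z" "Z \<subseteq> Y" "\<And>y. y \<in> Z \<Longrightarrow> continuous_on (closure \<Omega>) (snd (snd y))"
    and d: "f \<in> L2_space M" "g \<in> L2_space M" "z \<in> Hmhalf \<Omega>" and tr: "trace_constant \<Omega> Ctr"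
  shows "linear_functional_on Z (form_F \<Omega> \<delta>2 f g z)"
  unfolding linear_functional_on_def
proof (intro ballI allI)
  fix x y c assume xy: "x \<in> Z" "y \<in> Z"
  then have Y: "x \<in> Y" "y \<in> Y" using Z by auto
  have cx: "c *\<^sub>R x \<in> Z" and cxy: "c *\<^sub>R x + y \<in> Z"
    using Z(1) xy by (simp_all add: subspace_add subspace_scale)
  have F: "form_F \<Omega> \<delta>2 f g z y = - L2_inner M (fst (snd y)) f - \<delta>2 * L2_inner M (wdiv \<Omega> (fst y)) f
      + L2_inner M (snd (snd y)) g + z (bdry_trace \<Omega> (snd (snd y)))" for y
    by (cases y) (simp add: L2_inner_commute[of M f] L2_inner_commute[of M g])
  note lin = L2_operator_left_linear[OF subspace_Y, unfolded linear_functional_on_def, rule_format, OF _ _ Y]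
  have tr_eq: "bdry_trace \<Omega> (snd (snd y)) = (\<lambda>x. if x \<in> closure \<Omega> then snd (snd y) x else 0)" if "y \<in> Z" for y
    by (rule bdry_trace_continuous[OF Z(3)[OF that]])
  have tr_in: "bdry_trace \<Omega> (snd (snd y)) \<in> Hhalf \<Omega>" if "y \<in> Z" for y
    using tr that Z(2) Y_iff[of y] by (auto simp: trace_constant_def)
  have eq1: "bdry_trace \<Omega> (snd (snd (c *\<^sub>R x))) = (\<lambda>t. c * bdry_trace \<Omega> (snd (snd x)) t)"
    unfolding tr_eq[OF cx] tr_eq[OF xy(1)] by (auto simp: fun_eq_iff)
  have eq2: "bdry_trace \<Omega> (snd (snd (c *\<^sub>R x + y)))
      = (\<lambda>t. bdry_trace \<Omega> (snd (snd (c *\<^sub>R x))) t + bdry_trace \<Omega> (snd (snd y)) t)"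
    unfolding tr_eq[OF cxy] tr_eq[OF cx] tr_eq[OF xy(2)] by (auto simp: fun_eq_iff)
  have "z (bdry_trace \<Omega> (snd (snd (c *\<^sub>R x + y))))
      = z (bdry_trace \<Omega> (snd (snd (c *\<^sub>R x)))) + z (bdry_trace \<Omega> (snd (snd y)))"
    unfolding eq2 using d(3) tr_in[OF cx] tr_in[OF xy(2)] by (simp add: Hmhalf_def)
  also have "z (bdry_trace \<Omega> (snd (snd (c *\<^sub>R x)))) = c * z (bdry_trace \<Omega> (snd (snd x)))"
    unfolding eq1 using d(3) tr_in[OF xy(1)] by (simp add: Hmhalf_def)
  finally have zl: "z (bdry_trace \<Omega> (snd (snd (c *\<^sub>R x + y))))
      = c * z (bdry_trace \<Omega> (snd (snd x))) + z (bdry_trace \<Omega> (snd (snd y)))" .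
  show "form_F \<Omega> \<delta>2 f g z (c *\<^sub>R x + y) = c * form_F \<Omega> \<delta>2 f g z x + form_F \<Omega> \<delta>2 f g z y"
    unfolding F zl lin[OF Y_operator_disp d(1)] lin[OF Y_operator_div d(1)] lin[OF Y_operator_pres d(2)]
    by (simp add: algebra_simps)
qed

end

section \<open>Discrete spaces\<close>

text \<open>\<open>S\<close> may lie outside \<open>A\<close>, which allows discontinuous spanning
  functions for spaces of continuous ones; \<open>N\<close> collects the representatives of
  zero.\<close>

definition finite_dim_modulo :: "'v::real_vector set \<Rightarrow> 'v set \<Rightarrow> bool" where
  "finite_dim_modulo N A \<longleftrightarrow> (\<exists>S. finite S \<and> (\<forall>z\<in>A. \<exists>e\<in>span S. z - e \<in> N))"

lemma finite_dim_modulo_mono: "finite_dim_modulo N A \<Longrightarrow> B \<subseteq> A \<Longrightarrow> finite_dim_modulo N B"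
  unfolding finite_dim_modulo_def by blast

lemma finite_dim_modulo_Times:
  assumes "finite_dim_modulo N A" "finite_dim_modulo N' B"
  shows "finite_dim_modulo (N \<times> N') (A \<times> B)"
proof -
  obtain S S' where S: "finite S" "\<And>z. z \<in> A \<Longrightarrow> \<exists>e\<in>span S. z - e \<in> N"
    and S': "finite S'" "\<And>z. z \<in> B \<Longrightarrow> \<exists>e\<in>span S'. z - e \<in> N'"
    using assms unfolding finite_dim_modulo_def by blast
  let ?i = "\<lambda>x :: 'a. (x, 0 :: 'b)" and ?j = "\<lambda>y :: 'b. (0 :: 'a, y)"
  have lin: "linear ?i" "linear ?j" by (rule linearI; simp)+
  have "\<exists>e\<in>span (?i ` S \<union> ?j ` S'). z - e \<in> N \<times> N'" if z: "z \<in> A \<times> B" for z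
  proof -
    obtain a b where ab: "z = (a, b)" "a \<in> A" "b \<in> B" using z by blast
    obtain e where e: "e \<in> span S" "a - e \<in> N" using S(2)[OF ab(2)] by blast
    obtain e' where e': "e' \<in> span S'" "b - e' \<in> N'" using S'(2)[OF ab(3)] by blast
    have "?i e \<in> span (?i ` S \<union> ?j ` S')" "?j e' \<in> span (?i ` S \<union> ?j ` S')"
      using linear_span_image[OF lin(1), of S] linear_span_image[OF lin(2), of S'] e e'
        span_mono[of "?i ` S" "?i ` S \<union> ?j ` S'"] span_mono[of "?j ` S'" "?i ` S \<union> ?j ` S'"] by blast+
    then have "?i e + ?j e' \<in> span (?i ` S \<union> ?j ` S')" by (rule span_add)
    moreover have "z - (?i e + ?j e') \<in> N \<times> N'" using e e' ab by simp
    ultimately show ?thesis by (intro bexI[of _ "?i e + ?j e'"])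
  qed
  then show ?thesis
    unfolding finite_dim_modulo_def using S(1) S'(1) by (intro exI[of _ "?i ` S \<union> ?j ` S'"]) simp
qed

lemma poly_le_lincomb:
  assumes "P \<in> poly_le m" "Q \<in> poly_le m"
  shows "(\<lambda>x. c * P x + Q x) \<in> poly_le m"
proof -
  obtain p where p: "\<And>x. P x = (\<Sum>a | (\<Sum>i\<in>UNIV. a i) \<le> m. p a * (\<Prod>i\<in>UNIV. (x $ i) ^ a i))"
    using assms(1) unfolding poly_le_def by blast
  obtain q where q: "\<And>x. Q x = (\<Sum>a | (\<Sum>i\<in>UNIV. a i) \<le> m. q a * (\<Prod>i\<in>UNIV. (x $ i) ^ a i))"
    using assms(2) unfolding poly_le_def by blast
  have "c * P x + Q x = (\<Sum>a | (\<Sum>i\<in>UNIV. a i) \<le> m. (c * p a + q a) * (\<Prod>i\<in>UNIV. (x $ i) ^ a i))" for x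
    by (simp add: p q sum_distrib_left sum.distrib distrib_right mult.assoc)
  then show ?thesis unfolding poly_le_def by (intro CollectI exI[of _ "\<lambda>a. c * p a + q a"] allI)
qed

lemma piecewise_poly_lincomb:
  assumes "piecewise_poly \<T> m f" "piecewise_poly \<T> m g"
  shows "piecewise_poly \<T> m (\<lambda>x. c * f x + g x)"
  unfolding piecewise_poly_def
proof
  fix K assume "K \<in> \<T>"
  then obtain P Q where "P \<in> poly_le m" "Q \<in> poly_le m" "\<And>x. x \<in> interior K \<Longrightarrow> f x = P x"
      "\<And>x. x \<in> interior K \<Longrightarrow> g x = Q x"
    using assms unfolding piecewise_poly_def by meson
  then show "\<exists>P\<in>poly_le m. \<forall>x\<in>interior K. c * f x + g x = P x"
    using poly_le_lincomb[of P m Q c] by (intro bexI[of _ "\<lambda>x. c * P x + Q x"]) auto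
qed

lemma piecewise_poly_zero: "piecewise_poly \<T> m (\<lambda>x :: real^'d. 0)"
proof -
  have "(\<lambda>x :: real^'d. 0) \<in> poly_le m" unfolding poly_le_def by (intro CollectI exI[of _ "\<lambda>_. 0"]) simp
  then show ?thesis unfolding piecewise_poly_def by (intro ballI bexI[of _ "\<lambda>x. 0"]) simp_all
qed

context mixed_domain
begin

lemma subspace_Hh_sigma: "subspace (Hh_sigma \<Omega> \<Gamma>D \<T> k)"
proof (rule subspace_lincombI)
  show "0 \<in> Hh_sigma \<Omega> \<Gamma>D \<T> k"
    using subspace_0[OF subspace_HdivN] by (simp add: Hh_sigma_def piecewise_poly_zero)
  show "c *\<^sub>R x + y \<in> Hh_sigma \<Omega> \<Gamma>D \<T> k" if "x \<in> Hh_sigma \<Omega> \<Gamma>D \<T> k" "y \<in> Hh_sigma \<Omega> \<Gamma>D \<T> k" for c x y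
    using that subspace_add[OF subspace_HdivN subspace_scale[OF subspace_HdivN]]
    by (simp add: Hh_sigma_def piecewise_poly_lincomb)
qed

lemma subspace_Hh_u: "subspace (Hh_u \<Omega> \<Gamma>D \<T> k)"
proof (rule subspace_lincombI)
  show "0 \<in> Hh_u \<Omega> \<Gamma>D \<T> k"
    using subspace_0[OF subspace_H1D] by (simp add: Hh_u_def piecewise_poly_zero zero_fun_def)
  show "c *\<^sub>R x + y \<in> Hh_u \<Omega> \<Gamma>D \<T> k" if "x \<in> Hh_u \<Omega> \<Gamma>D \<T> k" "y \<in> Hh_u \<Omega> \<Gamma>D \<T> k" for c x y
  proof -
    have "continuous_on (closure \<Omega>) (\<lambda>t. c *\<^sub>R x t + y t)"
      using that by (intro continuous_intros) (auto simp: Hh_u_def)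
    then have "continuous_on (closure \<Omega>) (c *\<^sub>R x + y)" by (simp add: plus_fun_def scaleR_fun_def)
    then show ?thesis
      using that subspace_add[OF subspace_H1D subspace_scale[OF subspace_H1D]]
      by (simp add: Hh_u_def piecewise_poly_lincomb)
  qed
qed

lemma subspace_Hh_p: "subspace (Hh_p \<Omega> \<T> k)"
proof (rule subspace_lincombI)
  show "0 \<in> Hh_p \<Omega> \<T> k"
    using subspace_0[OF subspace_H1] by (simp add: Hh_p_def piecewise_poly_zero zero_fun_def)
  show "c *\<^sub>R x + y \<in> Hh_p \<Omega> \<T> k" if "x \<in> Hh_p \<Omega> \<T> k" "y \<in> Hh_p \<Omega> \<T> k" for c x y
  proof -
    have "continuous_on (closure \<Omega>) (\<lambda>t. c *\<^sub>R x t + y t)"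
      using that by (intro continuous_intros) (auto simp: Hh_p_def)
    then have "continuous_on (closure \<Omega>) (c *\<^sub>R x + y)" by (simp add: plus_fun_def scaleR_fun_def)
    moreover have "piecewise_poly \<T> (k + 1) (c *\<^sub>R x + y)"
      using piecewise_poly_lincomb[of \<T> "k + 1" x y c] that by (simp add: Hh_p_def plus_fun_def scaleR_fun_def)
    ultimately show ?thesis
      using that subspace_add[OF subspace_H1 subspace_scale[OF subspace_H1]] by (simp add: Hh_p_def)
  qed
qed

lemma subspace_Qh: "subspace (Qh \<Omega> \<T> k)"
proof (rule subspace_lincombI)
  show "0 \<in> Qh \<Omega> \<T> k"
    by (simp add: Qh_def Q_space_def piecewise_poly_zero transpose_def vec_eq_iff subspace_0[OF subspace_L2])
  show "c *\<^sub>R x + y \<in> Qh \<Omega> \<T> k" if "x \<in> Qh \<Omega> \<T> k" "y \<in> Qh \<Omega> \<T> k" for c x y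
  proof -
    have "AE t in M. transpose (x t) = - x t" "AE t in M. transpose (y t) = - y t"
      using that by (auto simp: Qh_def Q_space_def)
    then have "AE t in M. transpose ((c *\<^sub>R x + y) t) = - (c *\<^sub>R x + y) t"
    proof eventually_elim
      case (elim t)
      have "transpose ((c *\<^sub>R x + y) t) = c *\<^sub>R transpose (x t) + transpose (y t)"
        by (simp add: transpose_def vec_eq_iff)
      then show ?case using elim by simp
    qed
    then show ?thesis
      using that lincomb_L2[of x M y c] by (simp add: Qh_def Q_space_def piecewise_poly_lincomb)
  qed
qed

lemma subspace_Hh: "subspace (Hh \<Omega> \<Gamma>D \<T> k)"
  unfolding Hh_def by (intro subspace_Times subspace_Hh_sigma subspace_Hh_u subspace_Hh_p)

lemma Hh_Y: "Hh \<Omega> \<Gamma>D \<T> k \<subseteq> Y"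
  by (auto simp: Hh_def H_space_def Hh_sigma_def Hh_u_def Hh_p_def)

lemma Qh_L2: "Qh \<Omega> \<T> k \<subseteq> L2_space M"
  by (auto simp: Qh_def Q_space_def)

text \<open>Cells are convex and finite in number, so their frontiers together form a null set. Two
  cells meet in a common face, and a face that contains an interior point of a cell is the whole
  cell.\<close>

lemma mesh_interiors:
  assumes mesh: "mesh \<Omega> \<T>"
  shows "AE x in M. \<exists>K\<in>\<T>. x \<in> interior K"
    "\<And>K K' x. K \<in> \<T> \<Longrightarrow> K' \<in> \<T> \<Longrightarrow> x \<in> interior K \<Longrightarrow> x \<in> interior K' \<Longrightarrow> K = K'"
proof -
  have tri: "triangulation \<T>" and U: "\<Union>\<T> = closure \<Omega>" using mesh by (auto simp: mesh_def)
  have convex: "convex K" if "K \<in> \<T>" for K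
    using mesh that by (auto simp: mesh_def intro: convex_simplex)
  have "\<Union>(frontier ` \<T>) \<in> null_sets lebesgue"
    using tri convex by (intro null_sets.finite_Union)
      (auto simp: triangulation_def negligible_convex_frontier simp flip: negligible_iff_null_sets)
  from AE_not_in[OF this] show "AE x in M. \<exists>K\<in>\<T>. x \<in> interior K"
    unfolding AE_M_iff
  proof eventually_elim
    case (elim x)
    show ?case
    proof
      assume "x \<in> \<Omega>"
      then obtain K where K: "K \<in> \<T>" "x \<in> K" using U closure_subset[of \<Omega>] by blast
      then have "x \<in> interior K"
        using elim closure_subset[of K] by (auto simp: frontier_def)
      then show "\<exists>K\<in>\<T>. x \<in> interior K" using K by blast
    qed
  qed
  show "K = K'" if "K \<in> \<T>" "K' \<in> \<T>" "x \<in> interior K" "x \<in> interior K'" for K K' x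
  proof -
    have "x \<in> K \<inter> K'" using that interior_subset by blast
    moreover have "(K \<inter> K') face_of K" "(K \<inter> K') face_of K'"
      using tri that(1,2) unfolding triangulation_def by (simp, metis Int_commute)
    ultimately have "K \<inter> K' = K" "K \<inter> K' = K'"
      using face_of_disjoint_interior[of "K \<inter> K'" K] face_of_disjoint_interior[of "K \<inter> K'" K'] that(3,4)
      by (metis IntI emptyE)+
    then show ?thesis by simp
  qed
qed

lemma finite_exponents: "finite {a :: 'd \<Rightarrow> nat. (\<Sum>i\<in>UNIV. a i) \<le> m}"
proof (rule finite_subset)
  have "a i \<le> (\<Sum>i\<in>UNIV. a i)" for a :: "'d \<Rightarrow> nat" and i by (rule member_le_sum) auto
  then show "{a :: 'd \<Rightarrow> nat. (\<Sum>i\<in>UNIV. a i) \<le> m} \<subseteq> {a. \<forall>i. (i \<in> UNIV \<longrightarrow> a i \<in> {..m}) \<and> (i \<notin> UNIV \<longrightarrow> a i = 0)}"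
    using order_trans by fastforce
  show "finite {a :: 'd \<Rightarrow> nat. \<forall>i. (i \<in> UNIV \<longrightarrow> a i \<in> {..m}) \<and> (i \<notin> UNIV \<longrightarrow> a i = 0)}"
    by (rule finite_set_of_finite_funs) auto
qed

text \<open>The spanning functions are the monomials cut off to the open cells. Values on the cell
  faces are arbitrary, which is why the representation holds only modulo null functions.\<close>

lemma piecewise_poly_finite_dim:
  assumes mesh: "mesh \<Omega> \<T>"
  shows "finite_dim_modulo (AE_null M) {f. piecewise_poly \<T> m f}"
proof -
  let ?A = "{a :: 'd \<Rightarrow> nat. (\<Sum>i\<in>UNIV. a i) \<le> m}"
  define h where "h K a x = indicat_real (interior K) x * (\<Prod>i\<in>UNIV. (x $ i) ^ a i)"
    for K :: "(real^'d) set" and a :: "'d \<Rightarrow> nat" and x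
  let ?S = "(\<lambda>(K, a). h K a) ` (\<T> \<times> ?A)"
  have fin: "finite \<T>" using mesh by (simp add: mesh_def triangulation_def)
  have "\<exists>e\<in>span ?S. f - e \<in> AE_null M" if f: "piecewise_poly \<T> m f" for f
  proof -
    have "\<forall>K\<in>\<T>. \<exists>c. \<forall>x\<in>interior K. f x = (\<Sum>a\<in>?A. c a * (\<Prod>i\<in>UNIV. (x $ i) ^ a i))"
      using f unfolding piecewise_poly_def poly_le_def by fastforce
    from bchoice[OF this] obtain c where c: "\<And>K x. K \<in> \<T> \<Longrightarrow> x \<in> interior K \<Longrightarrow>
        f x = (\<Sum>a\<in>?A. c K a * (\<Prod>i\<in>UNIV. (x $ i) ^ a i))"
      by blast
    define e where "e = (\<Sum>K\<in>\<T>. \<Sum>a\<in>?A. c K a *\<^sub>R h K a)"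
    have apply_sum: "(\<Sum>i\<in>I. F i) x = (\<Sum>i\<in>I. F i x)" for I :: "'i set" and F :: "'i \<Rightarrow> 'd scal" and x
      by (induction I rule: infinite_finite_induct) auto
    have "e \<in> span ?S"
      unfolding e_def by (intro span_sum span_scale span_base) auto
    moreover have "AE x in M. (f - e) x = 0"
      using mesh_interiors(1)[OF mesh]
    proof eventually_elim
      case (elim x)
      then obtain K where K: "K \<in> \<T>" "x \<in> interior K" by blast
      \<comment> \<open>\<open>x\<close> is interior to exactly one cell, so the other cells
        contribute nothing.\<close>
      have "(\<Sum>a\<in>?A. c K' a * h K' a x) = (if K' = K then f x else 0)" if "K' \<in> \<T>" for K'
      proof (cases "K' = K")
        case True
        then show ?thesis using c[OF K] K by (simp add: h_def)
      next
        case False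
        then have "x \<notin> interior K'" using mesh_interiors(2)[OF mesh that K(1)] K(2) by blast
        then show ?thesis using False by (simp add: h_def)
      qed
      then have "e x = f x"
        using fin K(1) by (simp add: e_def apply_sum)
      then show ?case by simp
    qed
    ultimately show ?thesis unfolding AE_null_def by blast
  qed
  then show ?thesis
    unfolding finite_dim_modulo_def using fin finite_exponents[of m]
    by (intro exI[of _ ?S]) simp
qed

lemma piecewise_poly_vector_finite_dim:
  assumes mesh: "mesh \<Omega> \<T>"
  shows "finite_dim_modulo (AE_null M)
    {f :: real^'d \<Rightarrow> 'b::euclidean_space. \<forall>b\<in>Basis. piecewise_poly \<T> m (\<lambda>x. f x \<bullet> b)}"
proof -
  from piecewise_poly_finite_dim[OF mesh, of m]
  obtain S where "finite S \<and> (\<forall>f\<in>{f. piecewise_poly \<T> m f}. \<exists>e\<in>span S. f - e \<in> AE_null M)"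
    unfolding finite_dim_modulo_def ..
  then have S: "finite S" "\<And>f. piecewise_poly \<T> m f \<Longrightarrow> \<exists>e\<in>span S. f - e \<in> AE_null M"
    by simp_all
  define T where "T b h x = h x *\<^sub>R b" for b :: 'b and h :: "'d scal" and x
  have T: "linear (T b)" for b
    by (rule linearI) (auto simp: T_def fun_eq_iff scaleR_left_distrib)
  let ?S = "\<Union>b\<in>Basis. T b ` S"
  have "\<exists>e\<in>span ?S. f - e \<in> AE_null M" if f: "\<And>b. b \<in> Basis \<Longrightarrow> piecewise_poly \<T> m (\<lambda>x. f x \<bullet> b)"
    for f :: "real^'d \<Rightarrow> 'b"
  proof -
    have "\<forall>b\<in>Basis. \<exists>e. e \<in> span S \<and> (\<lambda>x. f x \<bullet> b) - e \<in> AE_null M"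
      using S(2)[OF f] by blast
    from bchoice[OF this]
    obtain e where e: "\<And>b. b \<in> Basis \<Longrightarrow> e b \<in> span S \<and> (\<lambda>x. f x \<bullet> b) - e b \<in> AE_null M"
      by blast
    have "T b (e b) \<in> span ?S" if "b \<in> Basis" for b
      using linear_span_image[OF T, of b S] e[OF that] span_mono[of "T b ` S" ?S] that by blast
    then have "(\<Sum>b\<in>Basis. T b (e b)) \<in> span ?S" by (rule span_sum)
    moreover have "AE x in M. (f - (\<Sum>b\<in>Basis. T b (e b))) x = 0"
    proof -
      have "AE x in M. \<forall>b\<in>Basis. f x \<bullet> b = e b x"
        using e by (intro AE_finite_allI) (auto simp: AE_null_def)
      then show ?thesis
      proof eventually_elim
        case (elim x)
        have "(\<Sum>b\<in>I. T b (e b)) x = (\<Sum>b\<in>I. e b x *\<^sub>R b)" if "finite I" for I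
          using that by (induction I) (auto simp: T_def)
        then have "(\<Sum>b\<in>Basis. T b (e b)) x = (\<Sum>b\<in>Basis. (f x \<bullet> b) *\<^sub>R b)" using elim by simp
        then show ?case by (simp add: euclidean_representation)
      qed
    qed
    ultimately show ?thesis unfolding AE_null_def by blast
  qed
  then show ?thesis
    unfolding finite_dim_modulo_def using S(1) by (intro exI[of _ ?S]) simp
qed

lemma discrete_finite_dim:
  assumes mesh: "mesh \<Omega> \<T>"
  shows "finite_dim_modulo null_triples (Hh \<Omega> \<Gamma>D \<T> k)" "finite_dim_modulo (AE_null M) (Qh \<Omega> \<T> k)"
proof -
  have tens: "\<forall>b\<in>Basis. piecewise_poly \<T> m (\<lambda>x. \<tau> x \<bullet> b)"
    if "\<forall>i j. piecewise_poly \<T> m (\<lambda>x. \<tau> x $ i $ j)" for \<tau> :: "'d tens" and m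
    using that by (auto simp: Basis_vec_def inner_axis)
  have vect: "\<forall>b\<in>Basis. piecewise_poly \<T> m (\<lambda>x. v x \<bullet> b)"
    if "\<forall>i. piecewise_poly \<T> m (\<lambda>x. v x $ i)" for v :: "'d vect" and m
    using that by (auto simp: Basis_vec_def inner_axis)
  note fd = finite_dim_modulo_mono[OF piecewise_poly_vector_finite_dim[OF mesh]]
  show "finite_dim_modulo null_triples (Hh \<Omega> \<Gamma>D \<T> k)"
    unfolding null_triples_def Hh_def
  proof (intro finite_dim_modulo_Times)
    show "finite_dim_modulo (AE_null M) (Hh_sigma \<Omega> \<Gamma>D \<T> k)"
      by (rule fd[of _ "k + 1"]) (use tens in \<open>auto simp: Hh_sigma_def\<close>)
    show "finite_dim_modulo (AE_null M) (Hh_u \<Omega> \<Gamma>D \<T> k)"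
      by (rule fd[of _ "k + 1"]) (use vect in \<open>auto simp: Hh_u_def\<close>)
    show "finite_dim_modulo (AE_null M) (Hh_p \<Omega> \<T> k)"
      by (rule finite_dim_modulo_mono[OF piecewise_poly_finite_dim[OF mesh, of "k + 1"]]) (auto simp: Hh_p_def)
  qed
  show "finite_dim_modulo (AE_null M) (Qh \<Omega> \<T> k)"
    by (rule fd[of _ k]) (use tens in \<open>auto simp: Qh_def\<close>)
qed

end

lemma finite_dim_modulo_basis:
  assumes "subspace Z" "subspace N" "finite_dim_modulo N Z"
  shows "\<exists>S. finite S \<and> S \<subseteq> Z \<and> (\<forall>z\<in>Z. \<exists>e\<in>span S. z - e \<in> N)"
proof -
  obtain S where S: "finite S" "\<And>z. z \<in> Z \<Longrightarrow> \<exists>e\<in>span S. z - e \<in> N"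
    using assms(3) unfolding finite_dim_modulo_def by blast
  show ?thesis by (rule subspace_finite_span_modulo[OF assms(1,2) S]) blast+
qed

section \<open>The discrete problem\<close>

text \<open>Smallness enters as two inequalities in \<open>Chat\<close>: the first keeps solutions
  in the ball of radius \<open>r\<close>, the second makes the solution map a contraction.
  \<open>data_bound\<close> bounds the load functional, and \<open>stress_bound\<close> bounds the
  form when it is tested with stresses alone.\<close>

locale discrete_problem = mixed_domain \<Omega> \<Gamma>D for \<Omega> \<Gamma>D :: "(real^'d) set" +
  fixes \<T> :: "(real^'d) set set" and k :: nat
    and lam mu \<alpha> c0 r \<kappa>1 \<kappa>2 Ctr Chat \<beta> \<delta>1 \<delta>2 :: real
    and \<kappa> :: "'d vect \<Rightarrow> 'd scal \<Rightarrow> 'd tens"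
    and f :: "'d vect" and g :: "'d scal" and z :: "'d scal \<Rightarrow> real"
    and a :: "'d vect \<times> 'd scal \<Rightarrow> 'd triple \<Rightarrow> 'd triple \<Rightarrow> real"
    and F :: "'d triple \<Rightarrow> real" and data_bound stress_bound :: real
  assumes mesh: "mesh \<Omega> \<T>"
    and params: "0 < lam" "0 < mu" "0 \<le> \<alpha>" "0 \<le> c0" "0 < r" "0 \<le> \<delta>1" "0 \<le> \<delta>2"
    and kappa: "0 \<le> \<kappa>2" "permeability \<Omega> \<Gamma>D \<kappa>1 \<kappa>2 \<kappa>"
    and trace_const: "0 < Ctr" "trace_constant \<Omega> Ctr"
    and data: "f \<in> L2_space M" "g \<in> L2_space M" "z \<in> Hmhalf \<Omega>"
    and a_def: "a = (\<lambda>(u, p). form_a \<Omega> lam mu \<alpha> c0 \<delta>1 \<delta>2 (\<kappa> u p))"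
    and F_def: "F = form_F \<Omega> \<delta>2 f g z"
    and coercivity: "0 < Chat"
      "\<And>u p y. u \<in> H1D \<Omega> \<Gamma>D \<Longrightarrow> p \<in> H1 \<Omega> \<Longrightarrow> H1v_norm \<Omega> u + H1_norm \<Omega> p \<le> r \<Longrightarrow>
         y \<in> Y \<Longrightarrow> a (u, p) y y \<ge> Chat * (H_norm \<Omega> y)\<^sup>2"
    and inf_sup: "0 < \<beta>"
      "\<And>\<eta>. \<eta> \<in> Qh \<Omega> \<T> k \<Longrightarrow>
         (SUP y\<in>{y \<in> Hh \<Omega> \<Gamma>D \<T> k. H_norm \<Omega> y \<noteq> 0}. ereal (form_b \<Omega> y \<eta> / H_norm \<Omega> y))
           \<ge> ereal (\<beta> * L2_norm M \<eta>)"
    and data_bound_def: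
      "data_bound = (1 + \<delta>2 + Ctr) * (L2_norm M f + L2_norm M g + Hmhalf_norm \<Omega> z)"
    and stress_bound_def:
      "stress_bound = 1 / (2 * mu) + \<alpha> * sqrt (real CARD('d)) / (2 * mu) + 1 + \<delta>2
        + \<delta>1 * (1 + 1 / (2 * mu) + \<alpha> * sqrt (real CARD('d)) / (2 * mu))\<^sup>2"
    and small: "data_bound \<le> Chat * r" "\<kappa>2 * data_bound < Chat\<^sup>2"
begin

lemma H_norm_le_0_iff [simp]: "H_norm \<Omega> y \<le> 0 \<longleftrightarrow> H_norm \<Omega> y = 0"
  using H_norm_nonneg[of y] by linarith

abbreviation "X \<equiv> Hh \<Omega> \<Gamma>D \<T> k"
abbreviation "E \<equiv> Qh \<Omega> \<T> k"
abbreviation "W \<equiv> Wh \<Omega> \<Gamma>D \<T> k r"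
abbreviation "b \<equiv> form_b \<Omega>"
abbreviation "solution w s \<equiv> saddle_solution (a w) b F X E s"

lemmas subspace_X = subspace_Hh[of \<T> k] and subspace_E = subspace_Qh[of \<T> k]

lemma X_Y: "y \<in> X \<Longrightarrow> y \<in> Y" using Hh_Y by blast

lemma E_L2: "\<eta> \<in> E \<Longrightarrow> \<eta> \<in> L2_space M" using Qh_L2 by blast

lemma X_iff: "(\<sigma>, w) \<in> X \<longleftrightarrow> \<sigma> \<in> Hh_sigma \<Omega> \<Gamma>D \<T> k \<and> fst w \<in> Hh_u \<Omega> \<Gamma>D \<T> k \<and> snd w \<in> Hh_p \<Omega> \<T> k"
  by (cases w) (simp add: Hh_def)

lemma W_iff: "w \<in> W \<longleftrightarrow> fst w \<in> Hh_u \<Omega> \<Gamma>D \<T> k \<and> snd w \<in> Hh_p \<Omega> \<T> k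
    \<and> H1v_norm \<Omega> (fst w) + H1_norm \<Omega> (snd w) \<le> r"
  by (cases w) (simp add: Wh_def)

lemma W_H1: "w \<in> W \<Longrightarrow> fst w \<in> H1D \<Omega> \<Gamma>D" "w \<in> W \<Longrightarrow> snd w \<in> H1 \<Omega>"
  by (auto simp: W_iff Hh_u_def Hh_p_def)

lemma a_eq: "a w = form_a \<Omega> lam mu \<alpha> c0 \<delta>1 \<delta>2 (\<kappa> (fst w) (snd w))"
  by (simp add: a_def case_prod_beta)

lemma kappa_Linf: "w \<in> W \<Longrightarrow> \<kappa> (fst w) (snd w) \<in> Linf_space M"
  using kappa(2) W_H1[of w] by (simp add: permeability_def)

lemma a_bilinear: "w \<in> W \<Longrightarrow> bilinear_on Y (a w)"
  unfolding a_eq by (rule form_a_bilinear[OF kappa_Linf])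

lemma a_null: "w \<in> W \<Longrightarrow> y \<in> Y \<Longrightarrow> y' \<in> Y \<Longrightarrow> y \<in> null_triples \<or> y' \<in> null_triples \<Longrightarrow> a w y y' = 0"
  unfolding a_eq by (rule form_a_null[OF kappa_Linf])

lemma a_coercive: "w \<in> W \<Longrightarrow> y \<in> Y \<Longrightarrow> Chat * (H_norm \<Omega> y)\<^sup>2 \<le> a w y y"
  using coercivity(2)[of "fst w" "snd w" y] W_H1[of w] by (simp add: W_iff)

lemma a_coercive_bound:
  assumes "w \<in> W" "y \<in> Y" "a w y y \<le> C * H_norm \<Omega> y" "0 \<le> C"
  shows "Chat * H_norm \<Omega> y \<le> C"
proof (cases "H_norm \<Omega> y = 0")
  case False
  then have p: "0 < H_norm \<Omega> y" using H_norm_nonneg[of y] by linarith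
  have "(Chat * H_norm \<Omega> y) * H_norm \<Omega> y \<le> C * H_norm \<Omega> y"
    using a_coercive[OF assms(1,2)] assms(3) by (simp add: power2_eq_square mult.assoc)
  then show ?thesis using p by simp
qed (use assms(4) in simp)

lemma F_bound: "y \<in> Y \<Longrightarrow> \<bar>F y\<bar> \<le> data_bound * H_norm \<Omega> y"
  unfolding F_def data_bound_def by (rule form_F_bound[OF _ data trace_const params(7)])

lemma stress_bound_nonneg: "0 \<le> stress_bound"
  unfolding stress_bound_def using params by (intro add_nonneg_nonneg mult_nonneg_nonneg divide_nonneg_nonneg) auto

lemma data_bound_nonneg: "0 \<le> data_bound"
proof -
  have "bdry_trace \<Omega> 0 \<in> Hhalf \<Omega>"
    using trace_const(2) subspace_0[OF subspace_H1] by (simp add: trace_constant_def)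
  then have "0 \<le> Hmhalf_norm \<Omega> z" by (rule Hmhalf_norm_nonneg[OF data(3)])
  then show ?thesis
    unfolding data_bound_def using params trace_const by (intro mult_nonneg_nonneg add_nonneg_nonneg) auto
qed

lemma F_linear: "linear_functional_on X F"
  unfolding F_def
  by (rule form_F_linear[OF subspace_X Hh_Y _ data trace_const(2)]) (auto simp: Hh_def Hh_p_def)

lemma b_linear: "\<eta> \<in> L2_space M \<Longrightarrow> linear_functional_on Y (\<lambda>y. b y \<eta>)"
  unfolding form_b_eq[abs_def] by (rule L2_operator_left_linear[OF subspace_Y Y_operator_stress])

lemma b_diff:
  assumes "y \<in> Y" "\<eta> \<in> L2_space M" "\<eta>' \<in> L2_space M"
  shows "b y (\<eta> - \<eta>') = b y \<eta> - b y \<eta>'"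
  unfolding form_b_eq
  by (rule linear_functional_onD(4)[OF bilinear_on_right[OF bilinear_L2
          L2_operator_L2[OF Y_operator_stress assms(1)]] subspace_L2 assms(2,3)])

lemma permeability_diff_bound:
  assumes w: "w \<in> W" "w' \<in> W" and y: "y \<in> Y" "y' \<in> Y"
  shows "\<bar>a w y y' - a w' y y'\<bar>
    \<le> \<kappa>2 * H1_norm \<Omega> (snd w - snd w') * H1_norm \<Omega> (snd (snd y)) * H1_norm \<Omega> (snd (snd y'))"
proof -
  have "Linf_norm M (\<lambda>x. \<kappa> (fst w) (snd w) x - \<kappa> (fst w') (snd w') x) \<le> ereal (\<kappa>2 * H1_norm \<Omega> (snd w - snd w'))"
    using kappa(2) W_H1[OF w(1)] W_H1[OF w(2)] by (simp add: permeability_def fun_diff_def)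
  moreover have "AE x in M. ereal (norm (\<kappa> (fst w) (snd w) x - \<kappa> (fst w') (snd w') x))
      \<le> Linf_norm M (\<lambda>x. \<kappa> (fst w) (snd w) x - \<kappa> (fst w') (snd w') x)"
    unfolding Linf_norm_def by (rule esssup_AE)
  ultimately have "AE x in M. norm (\<kappa> (fst w) (snd w) x - \<kappa> (fst w') (snd w') x)
      \<le> \<kappa>2 * H1_norm \<Omega> (snd w - snd w')"
    by (auto elim!: eventually_mono dest: order_trans)
  then show ?thesis
    unfolding a_eq using kappa(1) by (intro form_a_diff_bound kappa_Linf w y) auto
qed

text \<open>Both equations are read as one bilinear equation on \<open>X \<times> E\<close> whose
  right-hand side is \<open>F\<close> of the primal part. Compatibility holds because a kernel
  element has a primal part of norm zero by coercivity, and the load does not see its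
  multiplier.\<close>

lemma solution_exists:
  assumes w: "w \<in> W"
  shows "\<exists>s. solution w s"
proof -
  let ?Z = "Y \<times> (L2_space M :: 'd tens set)" and ?N = "null_triples \<times> (AE_null M :: 'd tens set)"
  define B where "B s t = a w (fst s) (fst t) + L2_inner M (snd s) (fst (fst t)) + L2_inner M (fst (fst s)) (snd t)"
    for s t :: "'d triple \<times> 'd tens"
  have sZ: "subspace ?Z" and sN: "subspace ?N" and sXE: "subspace (X \<times> E)"
    by (intro subspace_Times subspace_Y subspace_L2 subspace_null_triples subspace_AE_null subspace_X subspace_E)+
  have XE: "X \<times> E \<subseteq> ?Z" by (intro Sigma_mono Hh_Y Qh_L2)
  have lin: "linear (fst :: 'd triple \<times> 'd tens \<Rightarrow> _)" "linear (snd :: 'd triple \<times> 'd tens \<Rightarrow> _)"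
    by (rule linearI; simp)+
  have o1: "L2_operator M ?N ?Z (\<lambda>s. fst (fst s))"
    by (rule L2_operator_compose[OF Y_operator_stress lin(1)]) auto
  have o2: "L2_operator M ?N ?Z snd"
    by (rule L2_operator_compose[OF L2_operator_id[OF order.refl] lin(2)]) auto
  have "bilinear_on ?Z (\<lambda>s t. a w (fst s) (fst t))"
    using a_bilinear[OF w] by (auto simp: bilinear_on_def)
  then have BZ: "bilinear_on ?Z B"
    unfolding B_def[abs_def]
    by (intro bilinear_on_add L2_operator_inner_bilinear[OF sZ o1 o2] L2_operator_inner_bilinear[OF sZ o2 o1])
  have B_null: "B s t = 0" if "s \<in> ?Z" "t \<in> ?Z" "s \<in> ?N \<or> t \<in> ?N" for s t
    unfolding B_def using that a_null[OF w, of "fst s" "fst t"]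
      L2_operator_inner_null[OF o1 o2 that] L2_operator_inner_null[OF o2 o1 that] by auto
  have G: "linear_functional_on (X \<times> E) (\<lambda>s. F (fst s))"
    using F_linear by (auto simp: linear_functional_on_def)
  from finite_dim_modulo_basis[OF sXE sN finite_dim_modulo_Times[OF discrete_finite_dim[OF mesh]]]
  obtain S where S: "finite S" "S \<subseteq> X \<times> E" "\<forall>s\<in>X \<times> E. \<exists>e\<in>span S. s - e \<in> ?N"
    by (elim exE conjE)
  have "\<exists>s\<in>X \<times> E. \<forall>t\<in>X \<times> E. B s t = F (fst t)"
  proof (rule finite_bilinear_solvable[OF sXE bilinear_on_subset[OF BZ XE] G S(1,2)])
    fix s assume s: "s \<in> X \<times> E"
    obtain e where e: "e \<in> span S" "s - e \<in> ?N" using bspec[OF S(3) s] by (elim bexE)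
    have "e \<in> X \<times> E" by (rule subsetD[OF span_minimal[OF S(2) sXE] e(1)])
    then have d: "s - e \<in> ?Z" by (rule subsetD[OF XE subspace_diff[OF sXE s]])
    have "B t (s - e) = 0 \<and> B (s - e) t = 0" if "t \<in> X \<times> E" for t
      using B_null[OF subsetD[OF XE that] d] B_null[OF d subsetD[OF XE that]] e(2) by simp
    then show "\<exists>e\<in>span S. \<forall>t\<in>X \<times> E. B t (s - e) = 0 \<and> B (s - e) t = 0"
      using e(1) by (intro bexI[of _ e] ballI)
  next
    fix t assume t: "t \<in> X \<times> E" and ker: "\<And>s. s \<in> X \<times> E \<Longrightarrow> B s t = 0"
    obtain y \<eta> where y: "t = (y, \<eta>)" "y \<in> X" "\<eta> \<in> E" using t by blast
    \<comment> \<open>The sign of the multiplier is flipped so that the two coupling terms cancel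
      and only the coercive form remains.\<close>
    have "B (y, - \<eta>) t = a w y y"
      by (simp add: B_def y(1) L2_inner_def inner_commute)
    moreover have "(y, - \<eta>) \<in> X \<times> E" using y subspace_neg[OF subspace_E] by auto
    ultimately have "a w y y = 0" using ker by metis
    then have "Chat * H_norm \<Omega> y \<le> 0" using a_coercive_bound[OF w X_Y[OF y(2)], of 0] by simp
    then have "H_norm \<Omega> y = 0"
      using coercivity(1) H_norm_nonneg[of y] by (simp add: mult_le_0_iff)
    then show "F (fst t) = 0" using F_bound[OF X_Y[OF y(2)]] y(1) by simp
  qed
  then obtain s where s: "s \<in> X \<times> E" "\<forall>t\<in>X \<times> E. B s t = F (fst t)" ..
  have z: "0 \<in> X" "0 \<in> E" by (rule subspace_0[OF subspace_X] subspace_0[OF subspace_E])+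
  have sZ': "s \<in> ?Z" by (rule subsetD[OF XE s(1)])
  \<comment> \<open>Testing with \<open>(y, 0)\<close> and with \<open>(0, \<eta>)\<close> separates
    the two equations again.\<close>
  have "a w (fst s) y + b y (snd s) = F y" if "y \<in> X" for y
  proof -
    have "B s (y, 0) = F y" using bspec[OF s(2), of "(y, 0)"] that z by simp
    then show ?thesis by (simp add: B_def form_b_eq L2_inner_def inner_commute)
  qed
  moreover have "b (fst s) \<eta> = 0" if "\<eta> \<in> E" for \<eta>
  proof -
    have "B s (0, \<eta>) = F 0" using bspec[OF s(2), of "(0, \<eta>)"] that z by simp
    moreover have "F 0 = 0" by (rule linear_functional_onD(1)[OF F_linear subspace_X])
    moreover have "a w (fst s) 0 = 0"
      using a_null[OF w, of "fst s" 0] sZ' subspace_0[OF subspace_Y] subspace_0[OF subspace_null_triples] by auto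
    ultimately show ?thesis by (simp add: B_def form_b_eq L2_inner_def)
  qed
  ultimately show ?thesis
    using s(1) unfolding saddle_solution_def by (intro exI[of _ s]) auto
qed

lemma solutionD:
  assumes "solution w (y, \<gamma>)"
  shows "y \<in> X" "\<gamma> \<in> E" "y \<in> Y" "\<gamma> \<in> L2_space M"
    "\<And>y'. y' \<in> X \<Longrightarrow> a w y y' + b y' \<gamma> = F y'" "\<And>\<eta>. \<eta> \<in> E \<Longrightarrow> b y \<eta> = 0"
  using assms X_Y E_L2 by (auto simp: saddle_solution_def)

lemma solution_bound:
  assumes w: "w \<in> W" and s: "solution w (y, \<gamma>)"
  shows "Chat * H_norm \<Omega> y \<le> data_bound"
proof (rule a_coercive_bound[OF w solutionD(3)[OF s] _ data_bound_nonneg])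
  have "a w y y = F y" using solutionD(5)[OF s solutionD(1)[OF s]] solutionD(6)[OF s solutionD(2)[OF s]] by simp
  then show "a w y y \<le> data_bound * H_norm \<Omega> y" using F_bound[OF solutionD(3)[OF s]] by simp
qed

lemma solution_in_W:
  assumes w: "w \<in> W" and s: "solution w (y, \<gamma>)"
  shows "snd y \<in> W"
proof -
  have "Chat * H_norm \<Omega> y \<le> Chat * r" using solution_bound[OF assms] small(1) by linarith
  then have "H_norm \<Omega> y \<le> r" using coercivity(1) by simp
  then have "H1v_norm \<Omega> (fst (snd y)) + H1_norm \<Omega> (snd (snd y)) \<le> r"
    using part_norms_nonneg(1)[of "fst y"] unfolding H_norm_parts by linarith
  then show ?thesis
    using solutionD(1)[OF s] X_iff[of "fst y" "snd y"] by (simp add: W_iff)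
qed

lemma inf_sup_bound:
  assumes \<eta>: "\<eta> \<in> E" and C: "\<And>y. y \<in> X \<Longrightarrow> b y \<eta> \<le> C * H_norm \<Omega> y"
  shows "\<beta> * L2_norm M \<eta> \<le> C"
proof -
  have "(SUP y\<in>{y \<in> X. H_norm \<Omega> y \<noteq> 0}. ereal (b y \<eta> / H_norm \<Omega> y)) \<le> ereal C"
  proof (rule SUP_least)
    fix y assume y: "y \<in> {y \<in> X. H_norm \<Omega> y \<noteq> 0}"
    then have "0 < H_norm \<Omega> y" by (auto simp: less_le)
    then show "ereal (b y \<eta> / H_norm \<Omega> y) \<le> ereal C" using C[of y] y by (simp add: pos_divide_le_eq)
  qed
  with inf_sup(2)[OF \<eta>] have "ereal (\<beta> * L2_norm M \<eta>) \<le> ereal C" by (rule order_trans)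
  then show ?thesis by simp
qed

text \<open>
  \<open>b\<close> only sees the stress, so the multiplier is controlled by testing with \<open>(\<tau>, 0, 0)\<close>; the
  permeability, for which no bound is available, then drops out.
\<close>

lemma multiplier_bound:
  assumes w: "w \<in> W" and s: "solution w (y, \<gamma>)"
  shows "\<beta> * L2_norm M \<gamma> \<le> data_bound + stress_bound * H_norm \<Omega> y"
proof (rule inf_sup_bound[OF solutionD(2)[OF s]])
  fix y' assume y': "y' \<in> X"
  let ?t = "(fst y', 0, 0) :: 'd triple"
  have z: "0 \<in> Hh_u \<Omega> \<Gamma>D \<T> k" "0 \<in> Hh_p \<Omega> \<T> k"
    by (rule subspace_0[OF subspace_Hh_u] subspace_0[OF subspace_Hh_p])+
  have t: "?t \<in> X" using y' z by (cases y') (simp add: Hh_def)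
  have "H_norm \<Omega> ?t = Hdiv_norm \<Omega> (fst y')" by simp
  then have le: "H_norm \<Omega> ?t \<le> H_norm \<Omega> y'" using part_norms_le(1)[of y'] by linarith
  have "\<bar>a w y ?t\<bar> \<le> stress_bound * H_norm \<Omega> y * H_norm \<Omega> ?t"
    unfolding a_eq stress_bound_def
    by (rule form_a_stress_bound[OF params(1-4,6,7) kappa_Linf[OF w] solutionD(3)[OF s] X_Y[OF t]])
  moreover have "b y' \<gamma> = F ?t - a w y ?t"
    using solutionD(5)[OF s t] by (simp add: form_b_eq)
  ultimately have "b y' \<gamma> \<le> (data_bound + stress_bound * H_norm \<Omega> y) * H_norm \<Omega> ?t"
    using F_bound[OF X_Y[OF t]] by (simp add: distrib_right)
  also have "\<dots> \<le> (data_bound + stress_bound * H_norm \<Omega> y) * H_norm \<Omega> y'"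
    using le stress_bound_nonneg data_bound_nonneg by (intro mult_left_mono) auto
  finally show "b y' \<gamma> \<le> (data_bound + stress_bound * H_norm \<Omega> y) * H_norm \<Omega> y'" .
qed

text \<open>After multiplication by \<open>Chat * \<beta>\<close> the primal part contributes
  \<open>\<beta> * data_bound\<close> and the multiplier
  \<open>(Chat + stress_bound) * data_bound\<close>; their sum is the numerator.\<close>

lemma solution_HQ_bound:
  assumes w: "w \<in> W" and s: "solution w (y, \<gamma>)"
  shows "HQ_norm \<Omega> (y, \<gamma>) \<le> (Chat + \<beta> + stress_bound) / (Chat * \<beta>) * data_bound"
proof -
  have 1: "Chat * H_norm \<Omega> y \<le> data_bound" by (rule solution_bound[OF assms])
  have "Chat * (\<beta> * L2_norm M \<gamma>) \<le> Chat * (data_bound + stress_bound * H_norm \<Omega> y)"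
    using multiplier_bound[OF assms] coercivity(1) by (intro mult_left_mono) auto
  also have "\<dots> = Chat * data_bound + stress_bound * (Chat * H_norm \<Omega> y)" by (simp add: algebra_simps)
  also have "\<dots> \<le> Chat * data_bound + stress_bound * data_bound"
    using 1 stress_bound_nonneg by (intro add_left_mono mult_left_mono) auto
  finally have 2: "Chat * (\<beta> * L2_norm M \<gamma>) \<le> Chat * data_bound + stress_bound * data_bound" .
  have "\<beta> * (Chat * H_norm \<Omega> y) \<le> \<beta> * data_bound" using 1 inf_sup(1) by (intro mult_left_mono) auto
  with 2 have "(Chat * \<beta>) * HQ_norm \<Omega> (y, \<gamma>) \<le> (Chat + \<beta> + stress_bound) * data_bound"
    by (simp add: algebra_simps)
  then show ?thesis
    using coercivity(1) inf_sup(1) by (simp add: field_simps)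
qed

text \<open>One factor \<open>Chat\<close> comes from coercivity applied to the difference, the
  other from the a priori bound on \<open>y'\<close>, which the change of permeability brings in. If
  the two frozen pressures agree, this change vanishes, the primal parts coincide, and the inf-sup
  condition forces the multipliers to coincide as well.\<close>

lemma solution_difference:
  assumes w: "w \<in> W" "w' \<in> W" and s: "solution w (y, \<gamma>)" "solution w' (y', \<gamma>')"
  shows "Chat\<^sup>2 * H_norm \<Omega> (y - y') \<le> \<kappa>2 * data_bound * H1_norm \<Omega> (snd w - snd w')"
    and "H1_norm \<Omega> (snd w - snd w') = 0 \<Longrightarrow> \<gamma> - \<gamma>' \<in> AE_null M"
proof -
  note s1 = solutionD[OF s(1)] and s2 = solutionD[OF s(2)]
  define d where "d = H1_norm \<Omega> (snd w - snd w')"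
  have d0: "0 \<le> d" by (simp add: d_def)
  have yd: "y - y' \<in> X" using subspace_diff[OF subspace_X s1(1) s2(1)] .
  \<comment> \<open>The difference solves the linear problem frozen at \<open>w\<close>; its data
    are the change of permeability acting on the fixed function \<open>y'\<close>.\<close>
  have eq: "a w (y - y') x + b x (\<gamma> - \<gamma>') = a w' y' x - a w y' x" if x: "x \<in> X" for x
  proof -
    have "a w (y - y') x = a w y x - a w y' x"
      by (rule linear_functional_onD(4)[OF bilinear_on_left[OF a_bilinear[OF w(1)] X_Y[OF x]] subspace_Y s1(3) s2(3)])
    then show ?thesis
      using s1(5)[OF x] s2(5)[OF x] b_diff[OF X_Y[OF x] s1(4) s2(4)] by simp
  qed
  have diff: "\<bar>a w' y' x - a w y' x\<bar> \<le> \<kappa>2 * d * H_norm \<Omega> y' * H_norm \<Omega> x" if x: "x \<in> X" for x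
  proof -
    have "\<bar>a w' y' x - a w y' x\<bar> = \<bar>a w y' x - a w' y' x\<bar>" by simp
    also have "\<dots> \<le> \<kappa>2 * d * H1_norm \<Omega> (snd (snd y')) * H1_norm \<Omega> (snd (snd x))"
      unfolding d_def by (rule permeability_diff_bound[OF w s2(3) X_Y[OF x]])
    also have "\<dots> \<le> \<kappa>2 * d * H_norm \<Omega> y' * H_norm \<Omega> x"
      using kappa(1) d0 by (intro mult_mono part_norms_le) auto
    finally show ?thesis .
  qed
  \<comment> \<open>Both stresses are orthogonal to \<open>E\<close>, which contains the difference
    of the multipliers.\<close>
  have "b (y - y') (\<gamma> - \<gamma>') = 0"
  proof -
    have \<gamma>: "\<gamma> - \<gamma>' \<in> E" by (rule subspace_diff[OF subspace_E s1(2) s2(2)])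
    have "b (y - y') (\<gamma> - \<gamma>') = b y (\<gamma> - \<gamma>') - b y' (\<gamma> - \<gamma>')"
      by (rule linear_functional_onD(4)[OF b_linear[OF E_L2[OF \<gamma>]] subspace_Y s1(3) s2(3)])
    then show ?thesis using s1(6)[OF \<gamma>] s2(6)[OF \<gamma>] by simp
  qed
  then have "a w (y - y') (y - y') \<le> \<kappa>2 * d * H_norm \<Omega> y' * H_norm \<Omega> (y - y')"
    using eq[OF yd] diff[OF yd] by linarith
  then have coer: "Chat * H_norm \<Omega> (y - y') \<le> \<kappa>2 * d * H_norm \<Omega> y'"
    by (rule a_coercive_bound[OF w(1) X_Y[OF yd]]) (use kappa(1) d0 in auto)
  have "Chat\<^sup>2 * H_norm \<Omega> (y - y') = Chat * (Chat * H_norm \<Omega> (y - y'))" by (simp add: power2_eq_square)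
  also have "\<dots> \<le> Chat * (\<kappa>2 * d * H_norm \<Omega> y')" using coer coercivity(1) by (intro mult_left_mono) auto
  also have "\<dots> = \<kappa>2 * d * (Chat * H_norm \<Omega> y')" by simp
  also have "\<dots> \<le> \<kappa>2 * d * data_bound"
    using solution_bound[OF w(2) s(2)] kappa(1) d0 by (intro mult_left_mono) auto
  finally show "Chat\<^sup>2 * H_norm \<Omega> (y - y') \<le> \<kappa>2 * data_bound * H1_norm \<Omega> (snd w - snd w')"
    by (simp add: d_def mult_ac)
  show "\<gamma> - \<gamma>' \<in> AE_null M" if "H1_norm \<Omega> (snd w - snd w') = 0"
  proof -
    have d: "d = 0" using that by (simp add: d_def)
    have "H_norm \<Omega> (y - y') = 0"
      using coer d coercivity(1) H_norm_nonneg[of "y - y'"] by (simp add: mult_le_0_iff)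
    then have null: "y - y' \<in> null_triples" by (rule H_norm_eq_0_imp_null[OF X_Y[OF yd]])
    have \<gamma>: "\<gamma> - \<gamma>' \<in> E" by (rule subspace_diff[OF subspace_E s1(2) s2(2)])
    \<comment> \<open>With a null primal difference and no change of permeability, \<open>eq\<close>
      leaves only the coupling term, so \<open>b\<close> annihilates the difference of the
      multipliers.\<close>
    have "\<beta> * L2_norm M (\<gamma> - \<gamma>') \<le> 0"
    proof (rule inf_sup_bound[OF \<gamma>])
      fix x assume x: "x \<in> X"
      then show "b x (\<gamma> - \<gamma>') \<le> 0 * H_norm \<Omega> x"
        using eq[OF x] diff[OF x] d a_null[OF w(1) X_Y[OF yd] X_Y[OF x]] null by simp
    qed
    then have "L2_norm M (\<gamma> - \<gamma>') = 0"
      using inf_sup(1) L2_norm_nonneg[of M "\<gamma> - \<gamma>'"] by (simp add: mult_le_0_iff)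
    then show ?thesis using L2_norm_eq_0[OF E_L2[OF \<gamma>]] by (simp add: AE_null_def)
  qed
qed

section \<open>Uniqueness and fixed points of the nonlinear problem\<close>

lemma ae_eq_iff: "ae_eq \<Omega> h h' \<longleftrightarrow> h - h' \<in> AE_null M" for h h' :: "real^'d \<Rightarrow> 'b::real_vector"
  by (simp add: ae_eq_def AE_null_def)

lemma ae_eq_pair_iff: "ae_eq_pair \<Omega> w w' \<longleftrightarrow> (0, w - w') \<in> null_triples"
  by (cases w; cases w') (simp add: ae_eq_pair_def ae_eq_iff null_triples_def subspace_0[OF subspace_AE_null])

lemma ae_eq_pair_if_null: "y - y' \<in> null_triples \<Longrightarrow> ae_eq_pair \<Omega> (snd y) (snd y')"
  by (cases y; cases y') (simp add: ae_eq_pair_def ae_eq_iff null_triples_def)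

text \<open>The case of equal permeabilities in the difference estimate, whose right-hand side is
  then zero.\<close>

lemma linear_solution_unique:
  assumes w: "w \<in> W" and s: "solution w (y, \<gamma>)" "solution w (y', \<gamma>')"
  shows "y - y' \<in> null_triples"
proof -
  have "H1_norm \<Omega> (0 :: 'd scal) = 0" by simp
  then have "Chat\<^sup>2 * H_norm \<Omega> (y - y') \<le> 0" using solution_difference(1)[OF w w s] by simp
  then have "H_norm \<Omega> (y - y') = 0"
    using coercivity(1) H_norm_nonneg[of "y - y'"] by (simp add: mult_le_0_iff)
  then show ?thesis
    by (rule H_norm_eq_0_imp_null[OF subspace_diff[OF subspace_Y solutionD(3)[OF s(1)] solutionD(3)[OF s(2)]]])
qed

lemma nonlinear_solution_unique:
  assumes w: "w \<in> W" "w' \<in> W" and s: "solution w ((\<sigma>, w), \<gamma>)" "solution w' ((\<sigma>', w'), \<gamma>')"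
  shows "(\<sigma>, w) - (\<sigma>', w') \<in> null_triples" "\<gamma> - \<gamma>' \<in> AE_null M"
proof -
  let ?y = "(\<sigma>, w)" and ?y' = "(\<sigma>', w')"
  have yd: "?y - ?y' \<in> Y" by (rule subspace_diff[OF subspace_Y solutionD(3)[OF s(1)] solutionD(3)[OF s(2)]])
  have p: "H1_norm \<Omega> (snd w - snd w') \<le> H_norm \<Omega> (?y - ?y')"
    using part_norms_le(3)[of "?y - ?y'"] by simp
  have "0 \<le> \<kappa>2 * data_bound" using kappa(1) data_bound_nonneg by simp
  then have "Chat\<^sup>2 * H_norm \<Omega> (?y - ?y') \<le> \<kappa>2 * data_bound * H_norm \<Omega> (?y - ?y')"
    using solution_difference(1)[OF w s] mult_left_mono[OF p, of "\<kappa>2 * data_bound"] by linarith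
  then have "(Chat\<^sup>2 - \<kappa>2 * data_bound) * H_norm \<Omega> (?y - ?y') \<le> 0" by (simp add: left_diff_distrib)
  then have 0: "H_norm \<Omega> (?y - ?y') = 0"
    using small(2) H_norm_nonneg[of "?y - ?y'"] by (simp add: mult_le_0_iff)
  then show "?y - ?y' \<in> null_triples" by (rule H_norm_eq_0_imp_null[OF yd])
  have "H1_norm \<Omega> (snd w - snd w') = 0"
    using p 0 part_norms_nonneg(3)[of "snd w - snd w'"] by linarith
  then show "\<gamma> - \<gamma>' \<in> AE_null M" by (rule solution_difference(2)[OF w s])
qed

abbreviation "J \<equiv> op_J a b F X E"

lemma J_solution:
  assumes "w \<in> W"
  obtains y \<gamma> where "solution w (y, \<gamma>)" "J w = snd y"
proof -
  have "solution w (SOME s. solution w s)" using solution_exists[OF assms] by (rule someI_ex)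
  then show ?thesis
    by (intro that[of "fst (SOME s. solution w s)" "snd (SOME s. solution w s)"]) (simp_all add: op_J_def)
qed

text \<open>\<open>J\<close> returns a chosen representative, so at a fixed point it agrees with
  \<open>w\<close> only up to null functions. Since \<open>a\<close> ignores null triples and
  \<open>b\<close> sees the stress alone, \<open>w\<close> may be substituted into the chosen
  solution; conversely, linear uniqueness identifies that solution with the given one.\<close>

lemma J_fixed_point_iff:
  assumes w: "w \<in> W"
  shows "ae_eq_pair \<Omega> (J w) w \<longleftrightarrow> (\<exists>\<sigma> \<gamma>. solution w ((\<sigma>, w), \<gamma>))"
proof -
  obtain y \<gamma> where s: "solution w (y, \<gamma>)" and J: "J w = snd y" using w by (rule J_solution)
  note sD = solutionD[OF s]
  show ?thesis
  proof
    assume "ae_eq_pair \<Omega> (J w) w"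
    then have "(0, snd y - w) \<in> null_triples" by (simp add: J ae_eq_pair_iff)
    then have null: "y - (fst y, w) \<in> null_triples" by (cases y) simp
    have X: "(fst y, w) \<in> X" using sD(1) w X_iff[of "fst y" "snd y"] by (simp add: X_iff W_iff)
    have "a w (fst y, w) x = a w y x" if x: "x \<in> X" for x
    proof -
      have "a w (y - (fst y, w)) x = 0"
        using null by (intro a_null[OF w] subspace_diff[OF subspace_Y] sD X_Y X x) auto
      then show ?thesis
        using linear_functional_onD(4)[OF bilinear_on_left[OF a_bilinear[OF w] X_Y[OF x]] subspace_Y sD(3) X_Y[OF X]] by simp
    qed
    then have "solution w ((fst y, w), \<gamma>)"
      using X sD by (simp add: saddle_solution_def form_b_eq)
    then show "\<exists>\<sigma> \<gamma>. solution w ((\<sigma>, w), \<gamma>)" by blast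
  next
    assume "\<exists>\<sigma> \<gamma>. solution w ((\<sigma>, w), \<gamma>)"
    then obtain \<sigma> \<gamma>' where "solution w ((\<sigma>, w), \<gamma>')" by blast
    then have "y - (\<sigma>, w) \<in> null_triples" by (rule linear_solution_unique[OF w s])
    then show "ae_eq_pair \<Omega> (J w) w" using ae_eq_pair_if_null by (fastforce simp: J)
  qed
qed

text \<open>The iteration runs on triples, for which a semi-inner product and a finite spanning set
  are at hand, although \<open>T\<close> uses only the displacement and pressure of its
  argument.\<close>

lemma nonlinear_solution_exists: "\<exists>w\<in>W. \<exists>\<sigma> \<gamma>. solution w ((\<sigma>, w), \<gamma>)"
proof -
  define T where "T y = fst (SOME s. solution (snd y) s)" for y :: "'d triple"
  define D where "D = {y \<in> X. snd y \<in> W}"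
  define L where "L = \<kappa>2 * data_bound / Chat\<^sup>2"
  have T: "\<exists>\<gamma>. solution (snd y) (T y, \<gamma>)" if "y \<in> D" for y
  proof -
    have W: "snd y \<in> W" using that by (simp add: D_def)
    from someI_ex[OF solution_exists[OF W]] show ?thesis
      by (intro exI[of _ "snd (SOME s. solution (snd y) s)"]) (simp add: T_def)
  qed
  have semi: "semi_inner_on X ip_H"
    using semi_inner_H subspace_X bilinear_on_subset[OF _ Hh_Y[of \<T> k], of ip_H] X_Y
    unfolding semi_inner_on_def by simp
  from finite_dim_modulo_basis[OF subspace_X subspace_null_triples discrete_finite_dim(1)[OF mesh]]
  obtain S where S: "finite S" "S \<subseteq> X" "\<forall>x\<in>X. \<exists>e\<in>span S. x - e \<in> null_triples"
    by (elim exE conjE)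
  have ip0: "0 \<le> ip_H y y" if "y \<in> X" for y using semi that by (simp add: semi_inner_on_def)
  have "\<exists>v\<in>D. sqrt (ip_H (T v - v) (T v - v)) = 0"
  proof (rule semi_inner_contraction_fixpoint[OF semi S(1,2)])
    fix x assume x: "x \<in> X"
    obtain e where e: "e \<in> span S" "x - e \<in> null_triples" using bspec[OF S(3) x] by (elim bexE)
    have "x - e \<in> X" by (rule subspace_diff[OF subspace_X x subsetD[OF span_minimal[OF S(2) subspace_X] e(1)]])
    then have "sqrt (ip_H (x - e) (x - e)) \<le> 0"
      using sqrt_ip_H_le[of "x - e"] null_imp_H_norm_eq_0[of "x - e"] e(2) X_Y by simp
    then have "ip_H (x - e) (x - e) = 0" using ip0[OF \<open>x - e \<in> X\<close>] by simp
    then show "\<exists>e\<in>span S. ip_H (x - e) (x - e) = 0" using e(1) by (rule bexI)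
  next
    show "D \<subseteq> X" by (auto simp: D_def)
    show "0 \<in> D"
      using params(5) subspace_0[OF subspace_X] subspace_0[OF subspace_Hh_u] subspace_0[OF subspace_Hh_p]
      by (simp add: D_def W_iff)
  next
    fix y assume y: "y \<in> D"
    obtain \<gamma> where s: "solution (snd y) (T y, \<gamma>)" using T[OF y] by blast
    have "snd y \<in> W" using y by (simp add: D_def)
    then show "T y \<in> D" using solution_in_W[OF _ s] solutionD(1)[OF s] by (simp add: D_def)
  next
    fix x :: "nat \<Rightarrow> 'd triple" and v
    assume x: "\<And>n. x n \<in> D" and v: "v \<in> X" and lim: "(\<lambda>n. sqrt (ip_H (x n - v) (x n - v))) \<longlonglongrightarrow> 0"
    \<comment> \<open>The ball is measured by the sum of two norms, each dominated by the seminorm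
      of \<open>ip_H\<close>; hence the factor 2 below, harmless in the limit.\<close>
    let ?n = "\<lambda>y :: 'd triple. H1v_norm \<Omega> (fst (snd y)) + H1_norm \<Omega> (snd (snd y))"
    have "?n v \<le> r + 2 * sqrt (ip_H (x n - v) (x n - v))" for n
    proof -
      have xn: "x n \<in> X" "?n (x n) \<le> r" using x[of n] by (auto simp: D_def W_iff)
      have d: "v - x n \<in> X" by (rule subspace_diff[OF subspace_X v xn(1)])
      have "?n v \<le> ?n (x n) + ?n (v - x n)"
        using part_norms_triangle[OF X_Y[OF xn(1)] X_Y[OF d]] by simp
      also have "\<dots> \<le> r + 2 * sqrt (ip_H (v - x n) (v - x n))"
        using part_norms_le_ip[OF X_Y[OF d]] xn(2) by linarith
      also have "ip_H (v - x n) (v - x n) = ip_H (x n - v) (x n - v)"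
        by (rule semi_inner_minus[OF semi v xn(1)])
      finally show ?thesis .
    qed
    moreover have "(\<lambda>n. r + 2 * sqrt (ip_H (x n - v) (x n - v))) \<longlonglongrightarrow> r + 2 * 0"
      by (intro tendsto_intros lim)
    ultimately have "?n v \<le> r"
      using LIMSEQ_le_const[of "\<lambda>n. r + 2 * sqrt (ip_H (x n - v) (x n - v))" "r + 2 * 0" "?n v"] by simp
    then show "v \<in> D" using v X_iff[of "fst v" "snd v"] by (simp add: D_def W_iff)
  next
    show "0 \<le> L" "L < 1"
      using kappa(1) data_bound_nonneg small(2) coercivity(1) by (auto simp: L_def)
  next
    fix x y assume xy: "x \<in> D" "y \<in> D"
    obtain \<gamma> where s: "solution (snd x) (T x, \<gamma>)" using T[OF xy(1)] by blast
    obtain \<gamma>' where s': "solution (snd y) (T y, \<gamma>')" using T[OF xy(2)] by blast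
    have W: "snd x \<in> W" "snd y \<in> W" and X: "x \<in> X" "y \<in> X" using xy by (auto simp: D_def)
    have Td: "T x - T y \<in> Y" using subspace_diff[OF subspace_Y solutionD(3)[OF s] solutionD(3)[OF s']] .
    have xyd: "x - y \<in> Y" using subspace_diff[OF subspace_X X] X_Y by blast
    \<comment> \<open>The seminorm of \<open>ip_H\<close> lies below \<open>H_norm\<close> on the
      left and above the pressure norm on the right, so switching norms costs no constant.\<close>
    have "sqrt (ip_H (T x - T y) (T x - T y)) \<le> H_norm \<Omega> (T x - T y)" by (rule sqrt_ip_H_le[OF Td])
    also have "\<dots> \<le> L * H1_norm \<Omega> (snd (snd (x - y)))"
      using solution_difference(1)[OF W s s'] coercivity(1) by (simp add: L_def field_simps)
    also have "\<dots> \<le> L * sqrt (ip_H (x - y) (x - y))"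
      using part_norms_le_ip(2)[OF xyd] kappa(1) data_bound_nonneg by (intro mult_left_mono) (auto simp: L_def)
    finally show "sqrt (ip_H (T x - T y) (T x - T y)) \<le> L * sqrt (ip_H (x - y) (x - y))" .
  qed
  then obtain v where v: "v \<in> D" "sqrt (ip_H (T v - v) (T v - v)) = 0" by blast
  have W: "snd v \<in> W" and X: "v \<in> X" using v(1) by (auto simp: D_def)
  obtain \<gamma> where s: "solution (snd v) (T v, \<gamma>)" using T[OF v(1)] by blast
  have d: "T v - v \<in> Y" using subspace_diff[OF subspace_X solutionD(1)[OF s] X] X_Y by blast
  \<comment> \<open>The stress is replaced by zero so that the whole triple has norm zero as soon as
    its displacement and pressure do.\<close>
  let ?y = "(0, snd (T v) - snd v) :: 'd triple"
  have "H1v_norm \<Omega> (fst (snd ?y)) \<le> 0" "H1_norm \<Omega> (snd (snd ?y)) \<le> 0"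
    using part_norms_le_ip[OF d] v(2) by (simp_all add: fst_diff snd_diff)
  moreover have y: "?y \<in> Y"
    using d subspace_0[OF subspace_HdivN] by (cases "T v"; cases v) (auto simp: H_space_def)
  ultimately have "H_norm \<Omega> ?y = 0"
    using part_norms_nonneg(2)[of "fst (snd ?y)"] part_norms_nonneg(3)[of "snd (snd ?y)"]
    unfolding H_norm_parts fst_conv zero_norms by linarith
  then have null: "?y \<in> null_triples" by (rule H_norm_eq_0_imp_null[OF y])
  obtain y' \<gamma>' where s': "solution (snd v) (y', \<gamma>')" and J: "J (snd v) = snd y'"
    using W by (rule J_solution)
  \<comment> \<open>\<open>J\<close> and \<open>T\<close> choose solutions of the same linear
    problem, and these agree up to null functions.\<close>
  have "y' - T v \<in> null_triples" by (rule linear_solution_unique[OF W s' s])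
  then have "ae_eq_pair \<Omega> (snd y') (snd (T v))" by (rule ae_eq_pair_if_null)
  moreover have "ae_eq_pair \<Omega> (snd (T v)) (snd v)" using null by (simp add: ae_eq_pair_iff)
  ultimately have "ae_eq_pair \<Omega> (J (snd v)) (snd v)"
    unfolding J ae_eq_pair_iff using subspace_add[OF subspace_null_triples] by fastforce
  then show ?thesis using J_fixed_point_iff[OF W] W by blast
qed

end

theorem theorem4p2:
  fixes \<Omega> \<Gamma>D \<Gamma>N :: "(real^'d) set"
    and \<T> :: "(real^'d) set set" and k :: nat
    and lam mu \<alpha> c0 r \<kappa>1 \<kappa>2 CP CK Ctr Chat \<beta> \<delta>1 \<delta>2 norm_a \<rho> :: real
    and \<kappa> :: "'d vect \<Rightarrow> 'd scal \<Rightarrow> 'd tens"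
    and f :: "'d vect" and g :: "'d scal" and z :: "'d scal \<Rightarrow> real"
    and a :: "'d vect \<times> 'd scal \<Rightarrow> 'd triple \<Rightarrow> 'd triple \<Rightarrow> real"
    and b :: "'d triple \<Rightarrow> 'd tens \<Rightarrow> real" and F :: "'d triple \<Rightarrow> real"
    and J :: "'d vect \<times> 'd scal \<Rightarrow> 'd vect \<times> 'd scal"
  assumes dim: "CARD('d) = 2 \<or> CARD('d) = 3"
    and domain: "polyhedral_lipschitz_domain \<Omega>"
    and boundary: "\<Gamma>D \<subseteq> frontier \<Omega>" "\<Gamma>N \<subseteq> frontier \<Omega>" "\<Gamma>D \<inter> \<Gamma>N = {}"
        "frontier \<Omega> = closure \<Gamma>D \<union> closure \<Gamma>N"
        "emeasure (surface_measure \<Omega>) \<Gamma>D > 0" "emeasure (surface_measure \<Omega>) \<Gamma>N > 0"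
    and mesh: "mesh \<Omega> \<T>"
    and params: "lam > 0" "mu > 0" "0 \<le> \<alpha>" "\<alpha> \<le> 1" "c0 > 0" "r > 0"
    and kappa: "\<kappa>1 > 0" "\<kappa>2 > 0" "permeability \<Omega> \<Gamma>D \<kappa>1 \<kappa>2 \<kappa>"
    and CP: "CP > 0" "poincare_constant \<Omega> \<Gamma>D CP"
    and CK: "CK > 0" "korn_constant \<Omega> \<Gamma>D CK"
    and Ctr: "Ctr > 0" "trace_constant \<Omega> Ctr"
    and deltas: "\<delta>1 = 3 * mu / 2" "\<delta>2 = 3 / (CK * mu)"
    and data: "f \<in> L2_space (lebesgue_on \<Omega>)" "g \<in> L2_space (lebesgue_on \<Omega>)" "z \<in> Hmhalf \<Omega>"
    and a: "a = (\<lambda>(u, p). form_a \<Omega> lam mu \<alpha> c0 \<delta>1 \<delta>2 (\<kappa> u p))"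
    and b: "b = form_b \<Omega>"
    and F: "F = form_F \<Omega> \<delta>2 f g z"
    and J: "J = op_J a b F (Hh \<Omega> \<Gamma>D \<T> k) (Qh \<Omega> \<T> k)"
    and coercivity: "Chat > 0"
        "\<And>u p y. u \<in> H1D \<Omega> \<Gamma>D \<Longrightarrow> p \<in> H1 \<Omega> \<Longrightarrow> H1v_norm \<Omega> u + H1_norm \<Omega> p \<le> r \<Longrightarrow>
           y \<in> H_space \<Omega> \<Gamma>D \<Longrightarrow> a (u, p) y y \<ge> Chat * (H_norm \<Omega> y)\<^sup>2"
    and inf_sup: "\<beta> > 0"
        "\<And>\<eta>. \<eta> \<in> Qh \<Omega> \<T> k \<Longrightarrow>
           (SUP y\<in>{y \<in> Hh \<Omega> \<Gamma>D \<T> k. H_norm \<Omega> y \<noteq> 0}. ereal (b y \<eta> / H_norm \<Omega> y))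
             \<ge> ereal (\<beta> * L2_norm (lebesgue_on \<Omega>) \<eta>)"
    and norm_a: "norm_a = 1 / (2 * mu) + \<alpha> * sqrt (real CARD('d)) / mu + c0
           + real CARD('d) * \<alpha>\<^sup>2 / (2 * mu) + r + 2 + \<delta>2
           + \<delta>1 * (1 + 1 / (2 * mu) + \<alpha> * sqrt (real CARD('d)) / (2 * mu))\<^sup>2"
    and rho: "\<rho> = (Chat + \<beta> + norm_a)\<^sup>2 / (Chat * \<beta>)"
    and small: "\<rho> / r * max 1 (\<rho> * \<kappa>2 * r) * (1 + \<delta>2 + Ctr)
           * (L2_norm (lebesgue_on \<Omega>) f + L2_norm (lebesgue_on \<Omega>) g + Hmhalf_norm \<Omega> z) < 1"
  shows "\<exists>\<sigma> u p \<gamma>.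
      (u, p) \<in> Wh \<Omega> \<Gamma>D \<T> k r
      \<and> ae_eq_pair \<Omega> (J (u, p)) (u, p)
      \<and> (\<forall>w\<in>Wh \<Omega> \<Gamma>D \<T> k r. ae_eq_pair \<Omega> (J w) w \<longrightarrow> ae_eq_pair \<Omega> w (u, p))
      \<and> saddle_solution (a (u, p)) b F (Hh \<Omega> \<Gamma>D \<T> k) (Qh \<Omega> \<T> k) ((\<sigma>, u, p), \<gamma>)
      \<and> (\<forall>\<sigma>' u' p' \<gamma>'. (u', p') \<in> Wh \<Omega> \<Gamma>D \<T> k r \<longrightarrow>
            saddle_solution (a (u', p')) b F (Hh \<Omega> \<Gamma>D \<T> k) (Qh \<Omega> \<T> k) ((\<sigma>', u', p'), \<gamma>') \<longrightarrow>
            ae_eq \<Omega> \<sigma>' \<sigma> \<and> ae_eq \<Omega> u' u \<and> ae_eq \<Omega> p' p \<and> ae_eq \<Omega> \<gamma>' \<gamma>)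
      \<and> (\<forall>u' p'. (u', p') \<in> Wh \<Omega> \<Gamma>D \<T> k r \<longrightarrow>
            (ae_eq_pair \<Omega> (J (u', p')) (u', p') \<longleftrightarrow>
             (\<exists>\<sigma>' \<gamma>'. saddle_solution (a (u', p')) b F (Hh \<Omega> \<Gamma>D \<T> k) (Qh \<Omega> \<T> k)
                        ((\<sigma>', u', p'), \<gamma>'))))
      \<and> HQ_norm \<Omega> ((\<sigma>, u, p), \<gamma>)
          \<le> \<rho> * (1 + \<delta>2 + Ctr)
             * (L2_norm (lebesgue_on \<Omega>) f + L2_norm (lebesgue_on \<Omega>) g + Hmhalf_norm \<Omega> z)"
proof -
  define data_bound where
    "data_bound = (1 + \<delta>2 + Ctr) * (L2_norm (lebesgue_on \<Omega>) f + L2_norm (lebesgue_on \<Omega>) g + Hmhalf_norm \<Omega> z)"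
  define stress_bound where
    "stress_bound = 1 / (2 * mu) + \<alpha> * sqrt (real CARD('d)) / (2 * mu) + 1 + \<delta>2
        + \<delta>1 * (1 + 1 / (2 * mu) + \<alpha> * sqrt (real CARD('d)) / (2 * mu))\<^sup>2"
  have J_eq: "J = op_J a (form_b \<Omega>) F (Hh \<Omega> \<Gamma>D \<T> k) (Qh \<Omega> \<T> k)" by (simp add: J b)
  interpret mixed_domain \<Omega> \<Gamma>D
    using domain by unfold_locales (auto simp: polyhedral_lipschitz_domain_def)
  have \<delta>: "0 \<le> \<delta>1" "0 \<le> \<delta>2" using params CK(1) by (simp_all add: deltas)
  \<comment> \<open>\<open>norm_a\<close> dominates \<open>stress_bound\<close> summand by summand,
    its trace term being twice as large; its summand 2 makes it at least 1.\<close>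
  have stress_le: "stress_bound \<le> norm_a" and norm_a_ge: "1 \<le> norm_a"
  proof -
    have "0 \<le> \<alpha> * sqrt (real CARD('d)) / (2 * mu)" "0 \<le> real CARD('d) * \<alpha>\<^sup>2 / (2 * mu)" "0 \<le> 1 / (2 * mu)"
      "0 \<le> \<delta>1 * (1 + 1 / (2 * mu) + \<alpha> * sqrt (real CARD('d)) / (2 * mu))\<^sup>2"
      "\<alpha> * sqrt (real CARD('d)) / mu = 2 * (\<alpha> * sqrt (real CARD('d)) / (2 * mu))"
      using params \<delta> by simp_all
    then show "stress_bound \<le> norm_a" "1 \<le> norm_a"
      unfolding stress_bound_def norm_a using params \<delta> by linarith+
  qed
  have "bdry_trace \<Omega> 0 \<in> Hhalf \<Omega>"
    using Ctr(2) subspace_0[OF subspace_H1] by (simp add: trace_constant_def)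
  then have "0 \<le> Hmhalf_norm \<Omega> z" by (rule Hmhalf_norm_nonneg[OF data(3)])
  then have data0: "0 \<le> data_bound"
    unfolding data_bound_def using \<delta> Ctr(1) by (intro mult_nonneg_nonneg add_nonneg_nonneg) auto
  define s where "s = Chat + \<beta> + norm_a"
  have s: "1 \<le> s" "\<beta> \<le> s" "Chat + \<beta> + stress_bound \<le> s"
    using coercivity(1) inf_sup(1) norm_a_ge stress_le by (simp_all add: s_def)
  \<comment> \<open>Since \<open>1 \<le> s\<close>, the squared numerator of \<open>\<rho>\<close>
    dominates both the numerator of the a priori bound and \<open>\<beta>\<close>; the latter yields
    \<open>1 \<le> \<rho> * Chat\<close>.\<close>
  have "s \<le> s\<^sup>2" using s(1) by (simp add: power2_eq_square)
  then have \<rho>_ge: "(Chat + \<beta> + stress_bound) / (Chat * \<beta>) \<le> \<rho>" "\<beta> / (Chat * \<beta>) \<le> \<rho>"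
    using s coercivity(1) inf_sup(1) unfolding rho s_def[symmetric]
    by (intro divide_right_mono; simp)+
  then have \<rho>: "1 \<le> \<rho> * Chat" using coercivity(1) inf_sup(1) by (simp add: field_simps)
  have \<rho>0: "0 < \<rho>" using \<rho> coercivity(1) by (metis less_le_trans zero_less_mult_pos2 zero_less_one)
  have small': "\<rho> / r * max 1 (\<rho> * \<kappa>2 * r) * data_bound < 1"
    using small by (simp add: data_bound_def mult.assoc)
  \<comment> \<open>The maximum packs two conditions: \<open>t = 1\<close> keeps the iteration in
    the ball, and \<open>t = \<rho> * \<kappa>2 * r\<close> makes it contract.\<close>
  have le: "\<rho> / r * t * data_bound < 1" if "t \<le> max 1 (\<rho> * \<kappa>2 * r)" for t
  proof -
    have "\<rho> / r * t * data_bound \<le> \<rho> / r * max 1 (\<rho> * \<kappa>2 * r) * data_bound"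
      using that \<rho>0 params data0 by (intro mult_right_mono mult_left_mono) auto
    then show ?thesis using small' by linarith
  qed
  have small1: "data_bound \<le> Chat * r"
  proof -
    have "\<rho> * data_bound < r" using le[of 1] params by (simp add: field_simps)
    then have "Chat * (\<rho> * data_bound) \<le> Chat * r" using coercivity(1) by simp
    \<comment> \<open>Multiplying by \<open>Chat\<close> and using
      \<open>1 \<le> \<rho> * Chat\<close> removes \<open>\<rho>\<close> from the bound.\<close>
    moreover have "1 * data_bound \<le> (\<rho> * Chat) * data_bound" using \<rho> data0 by (intro mult_right_mono)
    ultimately show ?thesis by (simp add: mult_ac)
  qed
  have small2: "\<kappa>2 * data_bound < Chat\<^sup>2"
  proof -
    \<comment> \<open>The radius cancels for this choice of \<open>t\<close>; what remains is
      compared with \<open>(\<rho> * Chat)\<^sup>2\<close>, which is at least 1.\<close>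
    have "\<rho>\<^sup>2 * (\<kappa>2 * data_bound) < 1"
      using le[of "\<rho> * \<kappa>2 * r"] params by (simp add: power2_eq_square mult_ac)
    moreover have "1 \<le> (\<rho> * Chat)\<^sup>2" using \<rho> by simp
    ultimately have "\<rho>\<^sup>2 * (\<kappa>2 * data_bound) < \<rho>\<^sup>2 * Chat\<^sup>2" by (simp add: power_mult_distrib)
    then show ?thesis using \<rho>0 by simp
  qed
  interpret discrete_problem \<Omega> \<Gamma>D \<T> k lam mu \<alpha> c0 r \<kappa>1 \<kappa>2 Ctr Chat \<beta> \<delta>1 \<delta>2 \<kappa> f g z a F data_bound stress_bound
    using mesh params \<delta> kappa Ctr data a F coercivity inf_sup data_bound_def stress_bound_def small1 small2
    unfolding b by unfold_locales auto
  obtain w \<sigma> \<gamma> where w: "w \<in> W" and sol: "solution w ((\<sigma>, w), \<gamma>)"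
    using nonlinear_solution_exists by blast
  obtain u p where up: "w = (u, p)" by (cases w)
  have unique: "ae_eq \<Omega> \<sigma>' \<sigma> \<and> ae_eq_pair \<Omega> w' w \<and> ae_eq \<Omega> \<gamma>' \<gamma>"
    if w': "w' \<in> W" and sol': "solution w' ((\<sigma>', w'), \<gamma>')" for \<sigma>' w' \<gamma>'
  proof -
    note null = nonlinear_solution_unique[OF w' w sol' sol]
    then show ?thesis
      using ae_eq_pair_if_null[OF null(1)] by (simp add: ae_eq_iff null_triples_def)
  qed
  have "HQ_norm \<Omega> ((\<sigma>, w), \<gamma>) \<le> (Chat + \<beta> + stress_bound) / (Chat * \<beta>) * data_bound"
    by (rule solution_HQ_bound[OF w sol])
  also have "\<dots> \<le> \<rho> * data_bound" using \<rho>_ge(1) data0 by (rule mult_right_mono)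
  finally have bound: "HQ_norm \<Omega> ((\<sigma>, w), \<gamma>) \<le> \<rho> * data_bound" .
  show ?thesis
    unfolding b J_eq
  proof (rule exI[of _ \<sigma>], rule exI[of _ u], rule exI[of _ p], rule exI[of _ \<gamma>], intro conjI allI ballI impI)
    show "(u, p) \<in> W" "solution (u, p) ((\<sigma>, u, p), \<gamma>)" using w sol up by simp_all
    show "ae_eq_pair \<Omega> (op_J a (form_b \<Omega>) F (Hh \<Omega> \<Gamma>D \<T> k) (Qh \<Omega> \<T> k) (u, p)) (u, p)"
      using J_fixed_point_iff[OF w] sol up by blast
    show "ae_eq_pair \<Omega> w' (u, p)"
      if "w' \<in> W" "ae_eq_pair \<Omega> (op_J a (form_b \<Omega>) F (Hh \<Omega> \<Gamma>D \<T> k) (Qh \<Omega> \<T> k) w') w'" for w'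
      using J_fixed_point_iff[OF that(1)] that(2) unique[OF that(1)] up by blast
    show "ae_eq \<Omega> \<sigma>' \<sigma>" "ae_eq \<Omega> u' u" "ae_eq \<Omega> p' p" "ae_eq \<Omega> \<gamma>' \<gamma>"
      if "(u', p') \<in> W" "solution (u', p') ((\<sigma>', u', p'), \<gamma>')" for \<sigma>' u' p' \<gamma>'
      using unique[OF that] by (simp_all add: up ae_eq_pair_def)
    show "ae_eq_pair \<Omega> (op_J a (form_b \<Omega>) F (Hh \<Omega> \<Gamma>D \<T> k) (Qh \<Omega> \<T> k) (u', p')) (u', p')
        \<longleftrightarrow> (\<exists>\<sigma>' \<gamma>'. solution (u', p') ((\<sigma>', u', p'), \<gamma>'))" if "(u', p') \<in> W" for u' p'
      by (rule J_fixed_point_iff[OF that])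
    show "HQ_norm \<Omega> ((\<sigma>, u, p), \<gamma>) \<le> \<rho> * (1 + \<delta>2 + Ctr)
        * (L2_norm (lebesgue_on \<Omega>) f + L2_norm (lebesgue_on \<Omega>) g + Hmhalf_norm \<Omega> z)"
      using bound by (simp add: up data_bound_def mult.assoc)
  qed
qed

end
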